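(* There is a constant $c>0$ such that asymptotically almost all matroids on $n$ elements have connectivity at least $c\sqrt{\log_2 n}$; that is, the fraction of matroids in $\mathbb{M}_n$ that have no $k$-separation with $k< c\sqrt{\log_2 n}$ tends to $1$ as $n\to\infty$.
   Context: $\mathbb{M}_n$ is the set of matroids with ground set $\{1,\dots,n\}$. For a matroid $M$ on $E$ with rank function $r_M$, a partition $\{A,B\}$ of $E$ is $k$-separating if $r_M(A)+r_M(B)<r(M)+k$, and is a $k$-separation if in addition $|A|,|B|\ge k$. The connectivity of $M$ is the smallest $k$ such that $M$ has a $k$-separation (infinite if there is none). *)

theory Defs
  imports Complex_Main "HOL-Library.Extended_Nat" "HOL-Library.Extended_Real"
begin

text \<open>A matroid on a finite ground set \<open>E\<close> is given by its family \<open>I\<close> of independent sets.\<close>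

locale matroid =
  fixes E :: "'a set" and I :: "'a set set"
  assumes finite_ground: "finite E"
    and indep_subset_ground: "X \<in> I \<Longrightarrow> X \<subseteq> E"
    and indep_empty: "{} \<in> I"
    and indep_subset: "X \<in> I \<Longrightarrow> Y \<subseteq> X \<Longrightarrow> Y \<in> I"
    and indep_augment: "X \<in> I \<Longrightarrow> Y \<in> I \<Longrightarrow> card X < card Y \<Longrightarrow> \<exists>y \<in> Y - X. insert y X \<in> I"

definition matroid_rank :: "'a set set \<Rightarrow> 'a set \<Rightarrow> nat" where
  "matroid_rank I A = Max (card ` {X \<in> I. X \<subseteq> A})"

definition k_separating :: "'a set \<Rightarrow> 'a set set \<Rightarrow> nat \<Rightarrow> 'a set \<Rightarrow> 'a set \<Rightarrow> bool" where
  "k_separating E I k A B \<longleftrightarrow>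
     A \<union> B = E \<and> A \<inter> B = {} \<and> matroid_rank I A + matroid_rank I B < matroid_rank I E + k"

text \<open>For \<open>k \<ge> 1\<close> the cardinality bounds force both parts to be nonempty. There is no
  \<open>0\<close>-separation of a matroid, by subadditivity of the rank function, so \<open>k\<close> need not be
  restricted to positive values.\<close>

definition k_separation :: "'a set \<Rightarrow> 'a set set \<Rightarrow> nat \<Rightarrow> 'a set \<Rightarrow> 'a set \<Rightarrow> bool" where
  "k_separation E I k A B \<longleftrightarrow> k_separating E I k A B \<and> k \<le> card A \<and> k \<le> card B"

text \<open>In \<^typ>\<open>enat\<close> the infimum of a nonempty set is its least element, and that of the empty set
  is \<open>\<infinity>\<close>.\<close>

definition matroid_connectivity :: "'a set \<Rightarrow> 'a set set \<Rightarrow> enat" where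
  "matroid_connectivity E I = Inf {enat k | k. \<exists>A B. k_separation E I k A B}"

text \<open>The (labelled) matroids with ground set \<open>{1, \<dots>, n}\<close>; as the ground set is fixed,
  a matroid is identified with its family of independent sets.\<close>

definition matroids_on :: "nat \<Rightarrow> nat set set set" where
  "matroids_on n = {I. matroid {1..n} I}"

lemma finite_matroids_on: "finite (matroids_on n)"
proof (rule finite_subset)
  show "matroids_on n \<subseteq> Pow (Pow {1..n})"
    unfolding matroids_on_def using matroid.indep_subset_ground by blast
qed simp

lemma matroids_on_nonempty: "matroids_on n \<noteq> {}"
proof -
  have "matroid {1..n} {{}}"
    by unfold_locales auto
  then show ?thesis
    by (auto simp: matroids_on_def)
qed

lemma le_matroid_connectivity_iff:
  "ereal x \<le> ereal_of_enat (matroid_connectivity E I) \<longleftrightarrow>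
     (\<nexists>k A B. real k < x \<and> k_separation E I k A B)"
proof -
  let ?S = "{enat k | k. \<exists>A B. k_separation E I k A B}"
  show ?thesis
  proof (cases "?S = {}")
    case True
    then have "matroid_connectivity E I = \<infinity>"
      unfolding matroid_connectivity_def by (simp only: True) (simp add: Inf_enat_def)
    then show ?thesis
      using True by auto
  next
    case False
    then have "Inf ?S \<in> ?S"
      unfolding Inf_enat_def by (metis (no_types, lifting) LeastI ex_in_conv)
    then obtain m A B where m: "Inf ?S = enat m" and sep: "k_separation E I m A B"
      by blast
    have "m \<le> k" if "k_separation E I k A' B'" for k A' B'
    proof -
      have "Inf ?S \<le> enat k"
        using that by (intro Inf_lower) blast
      then show ?thesis
        using m by simp
    qed
    then show ?thesis
      using m sep unfolding matroid_connectivity_def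
      by (auto simp: not_less) (meson of_nat_le_iff order_trans)+
  qed
qed

end

theory Submission
  imports Defs "HOL-Library.FuncSet" "HOL-Real_Asymp.Real_Asymp"
begin

text \<open>
  A matroid of rank \<open>r\<close> is determined by one basis together with its \<open>r\<close>-subsets of rank \<open>r - 1\<close>.
  Join two \<open>r\<close>-sets when they differ in one exchange. Two neighbours of rank \<open>r - 1\<close> share their
  circuit or their closure, so that a maximal stable family of such sets nearly determines all of
  them. What gets lost is recovered from a sketch: the short cocircuits and circuits, and short
  lists of exceptional circuits, of flats of rank \<open>r - 2\<close> and of hyperplanes. There are only
  \<open>2 powr o(binomial n r / n)\<close> sketches, whereas every stable family is the family of nonbases of a
  (sparse paving) matroid; hence the number of matroids of rank \<open>r\<close> is at most the number of stable
  families times \<open>2 powr o(binomial n r / n)\<close>.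

  A structure that forces a large family \<open>Z\<close> of further nonbases improves this: sets in \<open>Z\<close> need not
  be recorded, so that the stable family may be enlarged by stable subsets of \<open>Z\<close>, and the proper
  colouring by the sum modulo \<open>n\<close> gives \<open>2 ^ (card Z / n)\<close> such choices. A separation with both sides
  large forces such a \<open>Z\<close>, and so does a short cocircuit with at least two elements. A separation
  with a side of at most \<open>k + 1\<close> elements yields a short circuit or cocircuit. Coloops are rare because
  a coloop can be replaced by a principal extension in exponentially many ways, and loops are dual.
  The ranks outside \<open>[n / 4, 3 n / 4]\<close> are negligible by the trivial bound \<open>2 ^ binomial n r\<close>.
\<close>

section \<open>Rank functions\<close>

text \<open>The proof is a budget of bits. Write N for \<open>binomial n r\<close>. A forced family
  of N / n^o(1) nonbases gains N / n^(1 + o(1)) bits, because one of n colour classes is used. Hence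
  all that is recorded besides the stable family must cost less than N / n^(1 + c) bits for a fixed
  c > 0, which dictates the thresholds of the sketch. The order sqrt(log n) of the connectivity
  enters through the density of the forced family: it falls by a bounded factor for each unit of k,
  and 36^(k + 2) must remain n^o(1). The obstacle is a short cocircuit. The r-subsets of its
  hyperplane H are nonbases, but they can be added to a stable family only if that family has no
  neighbours of them, and such neighbours, with a single element off H, may be present. Either they
  are few, and most r-subsets of H are free, or they are many, and then the element off H can be
  chosen in several ways. For the second alternative H must miss at least two elements; a coloop
  leaves no choice, whence its separate treatment.\<close>

locale rank_function =
  fixes E :: "'a set" and rk :: "'a set \<Rightarrow> nat"
  assumes finite_E: "finite E"
    and rk_empty: "rk {} = 0"
    and rk_insert_le: "rk (insert x A) \<le> Suc (rk A)"
    and rk_mono: "A \<subseteq> B \<Longrightarrow> rk A \<le> rk B"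
    and rk_submod: "rk (A \<union> B) + rk (A \<inter> B) \<le> rk A + rk B"
begin

lemma finite_subset_E: "A \<subseteq> E \<Longrightarrow> finite A"
  using finite_E by (rule rev_finite_subset)

lemma rk_Un_card: "finite B \<Longrightarrow> rk (A \<union> B) \<le> rk A + card B"
proof (induction B rule: finite_induct)
  case (insert x B)
  have "rk (A \<union> insert x B) \<le> Suc (rk (A \<union> B))"
    using rk_insert_le[of x "A \<union> B"] by simp
  then show ?case using insert by simp
qed simp

lemma rk_le_card: "finite B \<Longrightarrow> rk B \<le> card B"
  using rk_Un_card[of B "{}"] rk_empty by simp

lemma rk_insert_cases: "rk (insert x A) = rk A \<or> rk (insert x A) = Suc (rk A)"
  using rk_insert_le[of x A] rk_mono[OF subset_insertI, of A x] by linarith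

lemma rk_insert_span_mono:
  assumes "rk (insert x A) = rk A" "A \<subseteq> B"
  shows "rk (insert x B) = rk B"
proof -
  have "rk (insert x A \<union> B) + rk (insert x A \<inter> B) \<le> rk (insert x A) + rk B"
    by (rule rk_submod)
  moreover have "rk A \<le> rk (insert x A \<inter> B)" using assms(2) by (intro rk_mono) auto
  moreover have "insert x A \<union> B = insert x B" using assms(2) by auto
  moreover have "rk B \<le> rk (insert x B)" by (intro rk_mono) auto
  ultimately show ?thesis using assms(1) by simp
qed

lemma rk_Un_span:
  assumes "finite B" "\<And>b. b \<in> B \<Longrightarrow> rk (insert b A) = rk A"
  shows "rk (A \<union> B) = rk A"
  using assms
proof (induction B rule: finite_induct)
  case (insert x B)
  have "rk (insert x (A \<union> B)) = rk (A \<union> B)"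
    by (rule rk_insert_span_mono[of _ A]) (use insert in auto)
  then show ?case using insert by simp
qed simp

lemma rk_subset_indep:
  assumes "finite A" "rk A = card A" "B \<subseteq> A"
  shows "rk B = card B"
proof -
  have fB: "finite B" using assms finite_subset by blast
  have "rk (B \<union> (A - B)) \<le> rk B + card (A - B)"
    using assms by (intro rk_Un_card) auto
  moreover have "B \<union> (A - B) = A" using assms by auto
  moreover have "card (A - B) = card A - card B" "card B \<le> card A"
    using assms fB by (auto simp: card_Diff_subset card_mono)
  ultimately show ?thesis using rk_le_card[OF fB] assms(2) by simp
qed

text \<open>A coloop of \<open>A\<close> is a coloop of every subset of \<open>A\<close> that
  contains it, so the elements of \<open>P\<close> can be removed one at a time, each lowering the
  rank by one.\<close>

lemma rk_remove_coloops:
  assumes "finite A" "P \<subseteq> A" "\<And>x. x \<in> P \<Longrightarrow> rk (A - {x}) \<noteq> rk A"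
  shows "rk (A - P) + card P = rk A"
proof -
  have "finite P" using assms finite_subset by blast
  then show ?thesis using assms(2,3)
  proof (induction P rule: finite_induct)
    case (insert x P)
    have IH: "rk (A - P) + card P = rk A" using insert by auto
    have xA: "x \<in> A" "x \<notin> P" using insert by auto
    have "rk (insert x (A - insert x P)) \<noteq> rk (A - insert x P)"
    proof
      assume "rk (insert x (A - insert x P)) = rk (A - insert x P)"
      then have "rk (insert x (A - {x})) = rk (A - {x})"
        by (rule rk_insert_span_mono) auto
      moreover have "insert x (A - {x}) = A" using xA by auto
      ultimately show False using insert by auto
    qed
    moreover have "insert x (A - insert x P) = A - P" using xA by auto
    ultimately have "rk (A - P) = Suc (rk (A - insert x P))"
      using rk_insert_cases[of x "A - insert x P"] by auto
    then show ?case using IH insert by simp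
  qed simp
qed

section \<open>Closures and flats\<close>

definition cl :: "'a set \<Rightarrow> 'a set" where
  "cl A = {e \<in> E. rk (insert e A) = rk A}"

lemma cl_subset_E: "cl A \<subseteq> E" by (auto simp: cl_def)

lemma finite_cl: "finite (cl A)" by (rule finite_subset_E[OF cl_subset_E])

lemma subset_cl: "A \<subseteq> E \<Longrightarrow> A \<subseteq> cl A"
  by (auto simp: cl_def insert_absorb)

lemma rk_cl: "A \<subseteq> E \<Longrightarrow> rk (cl A) = rk A"
proof -
  assume "A \<subseteq> E"
  have "rk (A \<union> cl A) = rk A" by (rule rk_Un_span[OF finite_cl]) (auto simp: cl_def)
  moreover have "A \<union> cl A = cl A" using subset_cl[OF \<open>A \<subseteq> E\<close>] by auto
  ultimately show ?thesis by simp
qed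

lemma cl_mono: "A \<subseteq> B \<Longrightarrow> cl A \<subseteq> cl B"
  unfolding cl_def using rk_insert_span_mono by blast

lemma rk_subset_cl_insert:
  assumes "A \<subseteq> B" "B \<subseteq> cl A" "A \<subseteq> E"
  shows "rk B = rk A"
  using assms rk_mono[of A B] rk_mono[of B "cl A"] rk_cl[of A] by simp

lemma not_in_clD: "e \<in> E \<Longrightarrow> e \<notin> cl A \<Longrightarrow> rk (insert e A) = Suc (rk A)"
  using rk_insert_cases[of e A] by (auto simp: cl_def)

lemma cl_eqI:
  assumes "A \<subseteq> B" "B \<subseteq> E" "rk A = rk B"
  shows "cl A = cl B"
proof
  show "cl A \<subseteq> cl B" using assms cl_mono by blast
  show "cl B \<subseteq> cl A"
  proof
    fix e assume e: "e \<in> cl B"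
    have "rk (insert e A) \<le> rk (insert e B)" using assms by (intro rk_mono) auto
    also have "\<dots> = rk A" using e assms by (simp add: cl_def)
    finally have "rk (insert e A) = rk A" using rk_mono[OF subset_insertI, of A e] by linarith
    then show "e \<in> cl A" using e by (simp add: cl_def)
  qed
qed

lemma cl_flat: "A \<subseteq> E \<Longrightarrow> e \<in> E - cl A \<Longrightarrow> rk (insert e (cl A)) = Suc (rk (cl A))"
proof -
  assume A: "A \<subseteq> E" and e: "e \<in> E - cl A"
  have "cl (cl A) = cl A" using cl_eqI[of A "cl A"] subset_cl[OF A] rk_cl[OF A] cl_subset_E by simp
  then show ?thesis using e not_in_clD[of e "cl A"] by auto
qed

end

text \<open>The rank function of the dual matroid. The intersection with \<open>E\<close> is there
  because the axioms of \<open>rank_function\<close> range over all sets, also those that leave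
  \<open>E\<close>. By \<open>corank_add\<close> the subtraction never truncates.\<close>

definition corank :: "'a set \<Rightarrow> ('a set \<Rightarrow> nat) \<Rightarrow> 'a set \<Rightarrow> nat" where
  "corank E rk A = card (E \<inter> A) + rk (E - A) - rk E"

context rank_function
begin

lemma corank_add: "corank E rk A + rk E = card (E \<inter> A) + rk (E - A)"
proof -
  have "rk ((E - A) \<union> (E \<inter> A)) \<le> rk (E - A) + card (E \<inter> A)"
    using finite_E by (intro rk_Un_card) auto
  moreover have "(E - A) \<union> (E \<inter> A) = E" by auto
  ultimately show ?thesis by (simp add: corank_def)
qed

lemma corank_E: "corank E rk E + rk E = card E"
  using corank_add[of E] rk_empty by simp

lemma rank_function_corank: "rank_function E (corank E rk)"
proof
  show "finite E" by (rule finite_E)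
  show "corank E rk {} = 0" using corank_add[of "{}"] by simp
next
  fix x A
  show "corank E rk (insert x A) \<le> Suc (corank E rk A)"
  proof -
    have "card (E \<inter> insert x A) \<le> Suc (card (E \<inter> A))"
      by (cases "x \<in> E") (auto simp: Int_insert_right card_insert_if finite_E)
    moreover have "rk (E - insert x A) \<le> rk (E - A)" by (intro rk_mono) auto
    ultimately show ?thesis using corank_add[of A] corank_add[of "insert x A"] by linarith
  qed
next
  fix A B :: "'a set" assume AB: "A \<subseteq> B"
  have "E - A = (E - B) \<union> (E \<inter> (B - A))" using AB by auto
  then have "rk (E - A) \<le> rk (E - B) + card (E \<inter> (B - A))"
    using rk_Un_card[of "E \<inter> (B - A)" "E - B"] finite_E by simp
  moreover have "card (E \<inter> B) = card (E \<inter> A) + card (E \<inter> (B - A))"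
    using AB finite_E by (subst card_Un_disjoint[symmetric]) (auto intro: arg_cong[where f=card])
  ultimately show "corank E rk A \<le> corank E rk B"
    using corank_add[of A] corank_add[of B] by linarith
next
  fix A B :: "'a set"
  have "rk ((E - A) \<union> (E - B)) + rk ((E - A) \<inter> (E - B)) \<le> rk (E - A) + rk (E - B)"
    by (rule rk_submod)
  moreover have "(E - A) \<union> (E - B) = E - (A \<inter> B)" "(E - A) \<inter> (E - B) = E - (A \<union> B)" by auto
  moreover have "card (E \<inter> (A \<union> B)) + card (E \<inter> (A \<inter> B)) = card (E \<inter> A) + card (E \<inter> B)"
    using card_Un_Int[of "E \<inter> A" "E \<inter> B"] finite_E
    by (simp add: Int_Un_distrib Int_assoc Int_left_commute)
  ultimately show "corank E rk (A \<union> B) + corank E rk (A \<inter> B) \<le> corank E rk A + corank E rk B"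
    using corank_add[of A] corank_add[of B] corank_add[of "A \<union> B"] corank_add[of "A \<inter> B"]
    by simp
qed

lemma corank_corank: "A \<subseteq> E \<Longrightarrow> corank E (corank E rk) A = rk A"
proof -
  assume A: "A \<subseteq> E"
  interpret D: rank_function E "corank E rk" by (rule rank_function_corank)
  have "E \<inter> A = A" "E - (E - A) = A" "E \<inter> (E - A) = E - A" using A by auto
  then have "corank E (corank E rk) A + corank E rk E = card A + corank E rk (E - A)"
    "corank E rk (E - A) + rk E = card (E - A) + rk A"
    using D.corank_add[of A] corank_add[of "E - A"] by auto
  moreover have "card A + card (E - A) = card E"
    using A finite_E by (metis card_Diff_subset card_mono finite_subset le_add_diff_inverse)
  ultimately show ?thesis using corank_E by linarith
qed

end

section \<open>Matroids and rank functions\<close>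

context matroid
begin

lemma finite_I: "finite I"
  using finite_subset[of I "Pow E"] indep_subset_ground finite_ground by auto

lemma finite_indep: "X \<in> I \<Longrightarrow> finite X"
  using indep_subset_ground finite_ground finite_subset by blast

lemma card_le_rank: "X \<in> I \<Longrightarrow> X \<subseteq> A \<Longrightarrow> card X \<le> matroid_rank I A"
  unfolding matroid_rank_def using finite_I by (intro Max_ge) auto

lemma rank_leI: "(\<And>X. X \<in> I \<Longrightarrow> X \<subseteq> A \<Longrightarrow> card X \<le> k) \<Longrightarrow> matroid_rank I A \<le> k"
  unfolding matroid_rank_def using finite_I indep_empty by (subst Max_le_iff) auto

lemma rank_attained: "\<exists>X\<in>I. X \<subseteq> A \<and> card X = matroid_rank I A"
proof -
  have "matroid_rank I A \<in> card ` {X \<in> I. X \<subseteq> A}"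
    unfolding matroid_rank_def using finite_I indep_empty by (intro Max_in) auto
  then show ?thesis by auto
qed

lemma extend_indep:
  assumes "X \<in> I" "X \<subseteq> A"
  shows "\<exists>Y\<in>I. X \<subseteq> Y \<and> Y \<subseteq> A \<and> card Y = matroid_rank I A"
  using assms
proof (induction "matroid_rank I A - card X" arbitrary: X rule: less_induct)
  case less
  show ?case
  proof (cases "card X = matroid_rank I A")
    case True then show ?thesis using less by auto
  next
    case False
    then have lt: "card X < matroid_rank I A" using card_le_rank[OF less.prems] by simp
    obtain Z where Z: "Z \<in> I" "Z \<subseteq> A" "card Z = matroid_rank I A" using rank_attained by blast
    obtain y where y: "y \<in> Z - X" "insert y X \<in> I" using indep_augment[of X Z] less Z lt by auto
    have c: "card (insert y X) = Suc (card X)" using y finite_indep[OF less.prems(1)] by auto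
    have "\<exists>Y\<in>I. insert y X \<subseteq> Y \<and> Y \<subseteq> A \<and> card Y = matroid_rank I A"
      by (rule less.hyps) (use y Z less.prems lt c in auto)
    then show ?thesis by auto
  qed
qed

lemma rank_function_matroid_rank: "rank_function E (matroid_rank I)"
proof
  show "finite E" by (rule finite_ground)
  have "matroid_rank I {} \<le> 0" by (rule rank_leI) auto
  then show "matroid_rank I {} = 0" by simp
next
  fix x A
  show "matroid_rank I (insert x A) \<le> Suc (matroid_rank I A)"
  proof (rule rank_leI)
    fix X assume X: "X \<in> I" "X \<subseteq> insert x A"
    have "card (X - {x}) \<le> matroid_rank I A"
      using X indep_subset[of X "X - {x}"] by (intro card_le_rank) auto
    then show "card X \<le> Suc (matroid_rank I A)" using card_Diff1_le[of X x] finite_indep[OF X(1)]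
      by (cases "x \<in> X") (auto simp: card_Diff_singleton)
  qed
next
  fix A B :: "'a set" assume "A \<subseteq> B"
  then show "matroid_rank I A \<le> matroid_rank I B" by (intro rank_leI card_le_rank) auto
next
  fix A B
  obtain X where X: "X \<in> I" "X \<subseteq> A \<inter> B" "card X = matroid_rank I (A \<inter> B)"
    using rank_attained by blast
  obtain Y where Y: "Y \<in> I" "X \<subseteq> Y" "Y \<subseteq> A \<union> B" "card Y = matroid_rank I (A \<union> B)"
    using extend_indep[of X "A \<union> B"] X by auto
  have fY: "finite Y" using Y finite_indep by blast
  have "card (Y \<inter> A) + card (Y \<inter> B) = card Y + card (Y \<inter> A \<inter> (Y \<inter> B))"
    using card_Un_Int[of "Y \<inter> A" "Y \<inter> B"] fY Y by (simp add: Int_Un_distrib[symmetric] Int_absorb2)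
  moreover have "card X \<le> card (Y \<inter> A \<inter> (Y \<inter> B))" using X Y fY by (intro card_mono) auto
  moreover have "card (Y \<inter> A) \<le> matroid_rank I A" "card (Y \<inter> B) \<le> matroid_rank I B"
    using Y indep_subset[of Y] by (auto intro!: card_le_rank)
  ultimately show "matroid_rank I (A \<union> B) + matroid_rank I (A \<inter> B) \<le> matroid_rank I A + matroid_rank I B"
    using X Y by linarith
qed

lemma indep_iff_rank: "X \<in> I \<longleftrightarrow> X \<subseteq> E \<and> matroid_rank I X = card X"
proof
  assume X: "X \<in> I"
  then have "card X \<le> matroid_rank I X" by (intro card_le_rank) auto
  moreover have "matroid_rank I X \<le> card X"
    by (rule rank_leI) (use X finite_indep card_mono in blast)
  ultimately show "X \<subseteq> E \<and> matroid_rank I X = card X" using X indep_subset_ground by auto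
next
  assume X: "X \<subseteq> E \<and> matroid_rank I X = card X"
  obtain Y where Y: "Y \<in> I" "Y \<subseteq> X" "card Y = matroid_rank I X" using rank_attained by blast
  have "Y = X" using X Y finite_subset[OF _ finite_ground] by (intro card_subset_eq) auto
  then show "X \<in> I" using Y by simp
qed

end

definition indeps :: "'a set \<Rightarrow> ('a set \<Rightarrow> nat) \<Rightarrow> 'a set set" where
  "indeps E rk = {X. X \<subseteq> E \<and> rk X = card X}"

context rank_function
begin

lemma matroid_indeps: "matroid E (indeps E rk)"
proof
  show "finite E" by (rule finite_E)
  show "\<And>X. X \<in> indeps E rk \<Longrightarrow> X \<subseteq> E" by (auto simp: indeps_def)
  show "{} \<in> indeps E rk" by (simp add: indeps_def rk_empty)
  fix X Y assume "X \<in> indeps E rk" "Y \<subseteq> X"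
  then show "Y \<in> indeps E rk"
    using rk_subset_indep[OF finite_subset_E, of X Y] by (auto simp: indeps_def)
next
  fix X Y assume XY: "X \<in> indeps E rk" "Y \<in> indeps E rk" "card X < card Y"
  have fin: "finite X" "finite Y" using XY by (auto simp: indeps_def intro: finite_subset_E)
  show "\<exists>y\<in>Y - X. insert y X \<in> indeps E rk"
  proof (rule ccontr)
    assume neg: "\<not> ?thesis"
    have "rk (insert y X) = rk X" if "y \<in> Y" for y
    proof (cases "y \<in> X")
      case False
      then have "insert y X \<notin> indeps E rk" using neg that by auto
      then show ?thesis using rk_insert_cases[of y X] XY that False fin by (auto simp: indeps_def)
    qed (simp add: insert_absorb)
    then have "rk (X \<union> Y) = rk X" using fin by (intro rk_Un_span) auto
    moreover have "rk Y \<le> rk (X \<union> Y)" by (intro rk_mono) auto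
    ultimately show False using XY by (auto simp: indeps_def)
  qed
qed

lemma matroid_rank_indeps:
  assumes "A \<subseteq> E"
  shows "matroid_rank (indeps E rk) A = rk A"
proof -
  interpret M: matroid E "indeps E rk" by (rule matroid_indeps)
  obtain X where X: "X \<in> indeps E rk" "X \<subseteq> A" "card X = matroid_rank (indeps E rk) A"
    using M.rank_attained by blast
  have rX: "rk X = card X" and XE: "X \<subseteq> E" using X by (auto simp: indeps_def)
  have fA: "finite A" "finite X" using assms XE by (auto intro: finite_subset_E)
  have "rk (X \<union> A) = rk X"
  proof (rule rk_Un_span[OF fA(1)])
    fix b assume b: "b \<in> A"
    show "rk (insert b X) = rk X"
    proof (rule ccontr)
      assume ne: "rk (insert b X) \<noteq> rk X"
      then have "b \<notin> X" by (auto simp: insert_absorb)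
      then have "insert b X \<in> indeps E rk"
        using ne rk_insert_cases[of b X] rX XE b assms fA by (auto simp: indeps_def)
      then have "card (insert b X) \<le> matroid_rank (indeps E rk) A"
        using X b by (intro M.card_le_rank) auto
      then show False using \<open>b \<notin> X\<close> fA X by simp
    qed
  qed
  moreover have "X \<union> A = A" using X by auto
  ultimately show ?thesis using X rX by simp
qed

end

section \<open>Sketches\<close>

definition rsets :: "'a set \<Rightarrow> nat \<Rightarrow> 'a set set" where
  "rsets E r = {X. X \<subseteq> E \<and> card X = r}"

lemma finite_rsets: "finite E \<Longrightarrow> finite (rsets E r)"
  by (simp add: rsets_def)

lemma card_rsets: "finite E \<Longrightarrow> card (rsets E r) = card E choose r"
  by (simp add: rsets_def n_subsets)

lemma card_le_fibers:
  assumes "finite B" "f ` A \<subseteq> B" "\<And>b. b \<in> B \<Longrightarrow> finite {a \<in> A. f a = b} \<and> card {a \<in> A. f a = b} \<le> k"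
  shows "card A \<le> k * card B"
proof -
  have "A = (\<Union>b\<in>B. {a \<in> A. f a = b})" using assms(2) by auto
  then have "card A \<le> (\<Sum>b\<in>B. card {a \<in> A. f a = b})"
    using card_UN_le[OF assms(1), of "\<lambda>b. {a \<in> A. f a = b}"] by simp
  also have "\<dots> \<le> (\<Sum>b\<in>B. k)" using assms(3) by (intro sum_mono) auto
  finally show ?thesis by (simp add: mult.commute)
qed

lemma card_ordered_pairs_le: "finite {p. {fst p, snd p} = W} \<and> card {p. {fst p, snd p} = W} \<le> 2"
proof (cases "\<exists>a b. W = {a, b}")
  case True
  then obtain a b where W: "W = {a, b}" by blast
  have sub: "{p. {fst p, snd p} = W} \<subseteq> {(a, b), (b, a)}"
    unfolding W by (auto simp: doubleton_eq_iff)
  then have "card {p. {fst p, snd p} = W} \<le> card {(a, b), (b, a)}" by (intro card_mono) auto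
  also have "\<dots> \<le> Suc (card {(b, a)})" by (rule card_insert_le_m1) auto
  finally show ?thesis using finite_subset[OF sub] by simp
next
  case False
  then have "{p. {fst p, snd p} = W} = {}" by force
  then show ?thesis by simp
qed

context rank_function
begin

section \<open>Sets of rank r - 1 and their circuits\<close>

definition nonbases :: "'a set set" where
  "nonbases = {X \<in> rsets E (rk E). rk X < rk E}"

definition near :: "'a set set" where
  "near = {X \<in> rsets E (rk E). Suc (rk X) = rk E}"

text \<open>For \<open>X\<close> in \<^const>\<open>near\<close>, this is the unique circuit contained in \<open>X\<close>.\<close>

definition circ :: "'a set \<Rightarrow> 'a set" where
  "circ X = {u \<in> X. rk (X - {u}) = rk X}"

lemma nearD:
  assumes "X \<in> near"
  shows "X \<subseteq> E" "card X = rk E" "Suc (rk X) = rk E" "finite X"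
  using assms finite_subset_E by (auto simp: near_def rsets_def)

lemma near_nonbases: "near \<subseteq> nonbases"
  by (auto simp: near_def nonbases_def)

lemma circ_subset: "circ X \<subseteq> X" by (auto simp: circ_def)

text \<open>\<open>X - circ X\<close> consists of the coloops of \<open>X\<close>. Removing them
  lowers size and rank equally, so \<open>circ X\<close> inherits nullity one.\<close>

lemma rk_circ:
  assumes "X \<in> near"
  shows "Suc (rk (circ X)) = card (circ X)"
proof -
  have "rk (X - (X - circ X)) + card (X - circ X) = rk X"
    using nearD[OF assms] by (intro rk_remove_coloops) (auto simp: circ_def)
  moreover have "X - (X - circ X) = circ X" using circ_subset by auto
  moreover have "card X = card (circ X) + card (X - circ X)"
    using nearD(4)[OF assms] circ_subset
    by (metis Un_Diff_cancel card_Un_disjoint Diff_disjoint finite_Diff finite_subset sup.absorb2)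
  ultimately show ?thesis using nearD[OF assms] by simp
qed

lemma rk_circ_remove:
  assumes "X \<in> near" "u \<in> circ X"
  shows "rk (circ X - {u}) = rk (circ X)"
proof -
  have 1: "rk (X - {u}) = card (X - {u})" using assms nearD[OF assms(1)] by (simp add: circ_def)
  have "finite (X - {u})" "circ X - {u} \<subseteq> X - {u}" using nearD(4)[OF assms(1)] circ_subset by auto
  from rk_subset_indep[OF this(1) 1 this(2)] have "rk (circ X - {u}) = card (circ X - {u})" .
  then show ?thesis using rk_circ[OF assms(1)] assms(2) by simp
qed

text \<open>A set of nullity one contains one circuit only. Dependencies inside
  \<open>circ X\<close> persist in \<open>X'\<close>; and deleting an element of
  \<open>circ X'\<close> outside \<open>circ X\<close> would leave an independent set around the
  dependent set \<open>circ X\<close>.\<close>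

lemma circ_unique:
  assumes "X \<in> near" "X' \<in> near" "circ X \<subseteq> X'"
  shows "circ X' = circ X"
proof
  show "circ X \<subseteq> circ X'"
  proof
    fix u assume u: "u \<in> circ X"
    have "rk (insert u (circ X - {u})) = rk (circ X - {u})"
      using rk_circ_remove[OF assms(1) u] u by (simp add: insert_absorb)
    then have "rk (insert u (X' - {u})) = rk (X' - {u})"
      by (rule rk_insert_span_mono) (use assms in auto)
    then show "u \<in> circ X'" using u assms by (auto simp: circ_def insert_absorb)
  qed
  show "circ X' \<subseteq> circ X"
  proof
    fix w assume w: "w \<in> circ X'"
    show "w \<in> circ X"
    proof (rule ccontr)
      assume nw: "w \<notin> circ X"
      have 1: "rk (X' - {w}) = card (X' - {w})" using w nearD[OF assms(2)] by (simp add: circ_def)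
      have "finite (X' - {w})" "circ X \<subseteq> X' - {w}" using nearD(4)[OF assms(2)] assms(3) nw by auto
      from rk_subset_indep[OF this(1) 1 this(2)] have "rk (circ X) = card (circ X)" .
      then show False using rk_circ[OF assms(1)] by simp
    qed
  qed
qed

text \<open>Two adjacent near-bases share their circuit or their closure, according to whether the
  element that is exchanged is a coloop or not.\<close>

lemma near_adjacent:
  assumes X: "X \<in> near" "X' \<in> near" and X': "X' = insert v (X - {u})" and u: "u \<in> X" and v: "v \<notin> X"
  shows "circ X \<subseteq> X' \<or> X' \<subseteq> cl X"
proof (cases "u \<in> circ X")
  case False
  then show ?thesis using X' circ_subset by blast
next
  case True
  then have r1: "rk (X - {u}) = rk X" by (simp add: circ_def)
  have "rk (insert v (X - {u})) = rk (X - {u})" using X X' r1 nearD(3)[OF X(1)] nearD(3)[OF X(2)] by simp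
  then have "rk (insert v X) = rk X" by (rule rk_insert_span_mono) auto
  then have "v \<in> cl X" using X' nearD(1)[OF X(2)] by (auto simp: cl_def)
  then show ?thesis using X' subset_cl[OF nearD(1)[OF X(1)]] by auto
qed

text \<open>The moves that preserve the circuit: a coloop \<open>x\<close> may be replaced by any
  \<open>y\<close> that restores the rank. They are the source of the lower bound on
  \<open>mult\<close>.\<close>

lemma near_exchange:
  assumes X: "X \<in> near" and x: "x \<in> X - circ X" and y: "y \<in> E - cl (X - {x})"
  shows "insert y (X - {x}) \<in> near" "circ (insert y (X - {x})) = circ X"
    "Suc (rk (X - {x})) = rk X" "y \<notin> X - {x}"
proof -
  have "rk (insert x (X - {x})) \<le> Suc (rk (X - {x}))" by (rule rk_insert_le)
  moreover have "rk (X - {x}) \<le> rk X" "rk (X - {x}) \<noteq> rk X"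
    using x rk_mono[of "X - {x}" X] by (auto simp: circ_def)
  ultimately show 1: "Suc (rk (X - {x})) = rk X" using x by (simp add: insert_absorb)
  have "X - {x} \<subseteq> cl (X - {x})" using nearD(1)[OF X] by (intro subset_cl) auto
  then show 2: "y \<notin> X - {x}" using y by auto
  have "rk (insert y (X - {x})) = Suc (rk (X - {x}))" using y not_in_clD by auto
  moreover have "card (insert y (X - {x})) = card X"
    using 2 x nearD(4)[OF X] by (metis Diff_iff card.insert card.remove finite_Diff)
  ultimately show 3: "insert y (X - {x}) \<in> near"
    using 1 y nearD[OF X] by (auto simp: near_def rsets_def)
  show "circ (insert y (X - {x})) = circ X"
    by (rule circ_unique[OF X 3]) (use x circ_subset in auto)
qed

text \<open>The complements of the cocircuits with at most \<open>s\<close> elements.\<close>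

definition coshort :: "nat \<Rightarrow> 'a set set" where
  "coshort s = {H. H \<subseteq> E \<and> card (E - H) \<le> s \<and> Suc (rk H) = rk E \<and> (\<forall>e\<in>E - H. rk (insert e H) = rk E)}"

lemma cl_coshort:
  assumes "X \<in> near" "card (E - cl X) \<le> s"
  shows "cl X \<in> coshort s"
  using assms cl_subset_E rk_cl[OF nearD(1)[OF assms(1)]] cl_flat[OF nearD(1)[OF assms(1)]] nearD(3)[OF assms(1)]
  by (auto simp: coshort_def)

section \<open>Exceptional circuits, flats and hyperplanes of a sketch\<close>

definition mult :: "'a set \<Rightarrow> nat" where
  "mult C = card {X \<in> near. circ X = C}"

text \<open>For a circuit \<open>C\<close> with r - 1 elements, the hyperplanes H through
  \<open>cl C\<close> partition \<open>E - cl C\<close>. So this is the sum of |H - cl C| / |H - C|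
  over them, a weighted count of these hyperplanes.\<close>

definition spread :: "'a set \<Rightarrow> real" where
  "spread C = (\<Sum>y\<in>E - cl C. 1 / real (card (cl (insert y C) - C)))"

text \<open>The inequality says that the sets with this circuit pay for its weight
  \<open>card (X - circ X)\<close>. Sets with different circuits are different, so the total weight
  of the list is bounded; and the weight is, up to a logarithm, the cost of recording the
  circuit.\<close>

definition long_circs :: "nat \<Rightarrow> 'a set set" where
  "long_circs s = {circ X | X. X \<in> near \<and> 2 \<le> card (X - circ X) \<and>
     card (X - circ X) * (s * (s - 1)) \<le> 4 * mult (circ X)}"

text \<open>With a single coloop no second exchange is available, and \<open>mult\<close> is at most
  n. A lower bound on \<open>spread\<close> takes its place.\<close>

definition spread_circs :: "nat \<Rightarrow> 'a set set" where
  "spread_circs K = {circ X | X. X \<in> near \<and> card (X - circ X) = 1 \<and> real K \<le> spread (circ X)}"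

definition big_flats :: "nat \<Rightarrow> 'a set set" where
  "big_flats \<theta> = {F. F \<subseteq> E \<and> Suc (Suc (rk F)) = rk E \<and>
     \<theta> \<le> card {Z \<in> rsets E (rk E). Suc (Suc (rk Z)) = rk E \<and> cl Z = F}}"

definition big_hyps :: "nat \<Rightarrow> 'a set set" where
  "big_hyps \<theta> = {H. H \<subseteq> E \<and> Suc (rk H) = rk E \<and> cl H = H \<and> \<theta> \<le> card {Z \<in> near. cl Z = H}}"

definition sketch where
  "sketch s K \<theta> = (coshort s, long_circs s \<union> spread_circs K, big_flats \<theta>, big_hyps \<theta>)"

end

text \<open>All sets that are visibly dependent from a sketch: a set that meets a flat of rank \<open>r - 2\<close> in at
  least \<open>r - 1\<close> elements has rank less than \<open>r\<close>, and two hyperplanes meet in a flat of smaller rank.\<close>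

definition covered :: "nat \<Rightarrow> 'a set set \<times> 'a set set \<times> 'a set set \<times> 'a set set \<Rightarrow> 'a set \<Rightarrow> bool" where
  "covered r S X = (case S of (Q, L, F, P) \<Rightarrow>
     (\<exists>H\<in>Q. X \<subseteq> H) \<or> (\<exists>C\<in>L. C \<subseteq> X) \<or> (\<exists>G\<in>F. r \<le> Suc (card (X \<inter> G))) \<or>
     (\<exists>H1\<in>P. \<exists>H2\<in>P. H1 \<noteq> H2 \<and> r \<le> Suc (card (X \<inter> (H1 \<inter> H2)))))"

context rank_function
begin

text \<open>Soundness of the sketch. A hyperplane bounds the rank of \<open>X\<close> directly; in
  the other cases some \<open>X \<inter> G\<close> has more elements than rank, which
  \<open>key\<close> turns into dependence of \<open>X\<close>.\<close>

lemma covered_nonbasis: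
  assumes X: "X \<in> rsets E (rk E)" and c: "covered (rk E) (sketch s K \<theta>) X"
  shows "X \<in> nonbases"
proof -
  have fX: "finite X" and XE: "X \<subseteq> E" and cX: "card X = rk E"
    using X by (auto simp: rsets_def intro: finite_subset_E)
  have key: "rk X < rk E" if "rk (X \<inter> G) < card (X \<inter> G)" for G
  proof -
    have "rk X \<noteq> card X"
      using rk_subset_indep[OF fX, of "X \<inter> G"] that by auto
    then show ?thesis using rk_le_card[OF fX] cX by simp
  qed
  consider H where "H \<in> coshort s" "X \<subseteq> H" | C where "C \<in> long_circs s \<union> spread_circs K" "C \<subseteq> X"
    | G where "G \<in> big_flats \<theta>" "rk E \<le> Suc (card (X \<inter> G))"
    | H1 H2 where "H1 \<in> big_hyps \<theta>" "H2 \<in> big_hyps \<theta>" "H1 \<noteq> H2" "rk E \<le> Suc (card (X \<inter> (H1 \<inter> H2)))"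
    using c unfolding covered_def sketch_def prod.case by blast
  then have "rk X < rk E"
  proof cases
    case 1
    then show ?thesis using rk_mono[of X H] by (auto simp: coshort_def)
  next
    case 2
    then obtain Y where "Y \<in> near" "C = circ Y" by (auto simp: long_circs_def spread_circs_def)
    then have "rk C < card C" using rk_circ[of Y] by simp
    moreover have "X \<inter> C = C" using 2 by auto
    ultimately show ?thesis by (intro key[of C]) simp
  next
    case 3
    have "rk (X \<inter> G) \<le> rk G" by (intro rk_mono) auto
    then show ?thesis using 3 by (intro key[of G]) (auto simp: big_flats_def)
  next
    case 4
    have h: "H1 \<subseteq> E" "H2 \<subseteq> E" "Suc (rk H1) = rk E" "Suc (rk H2) = rk E" "cl H1 = H1" "cl H2 = H2"
      using 4 by (auto simp: big_hyps_def)
    \<comment> \<open>Otherwise both hyperplanes would have the same closure. So the union has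
      larger rank, and submodularity leaves rank at most r - 2 for the intersection.\<close>
    have "rk (H1 \<union> H2) \<noteq> rk H1"
    proof
      assume a: "rk (H1 \<union> H2) = rk H1"
      have "cl H1 = cl (H1 \<union> H2)" "cl H2 = cl (H1 \<union> H2)"
        using cl_eqI[of H1 "H1 \<union> H2"] cl_eqI[of H2 "H1 \<union> H2"] a h(1-4) by simp_all
      then show False using 4(3) h(5,6) by simp
    qed
    then have "rk H1 < rk (H1 \<union> H2)" using rk_mono[of H1 "H1 \<union> H2"] by simp
    then have "Suc (Suc (rk (H1 \<inter> H2))) \<le> rk E"
      using rk_submod[of H1 H2] h by linarith
    moreover have "rk (X \<inter> (H1 \<inter> H2)) \<le> rk (H1 \<inter> H2)" by (intro rk_mono) auto
    ultimately show ?thesis using 4 by (intro key[of "H1 \<inter> H2"]) auto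
  qed
  then show ?thesis using X by (simp add: nonbases_def)
qed

text \<open>Exchange twice: \<open>x\<close> for \<open>y\<close>, then another coloop
  \<open>x'\<close> for \<open>y'\<close>. The circuit survives both moves. The result
  \<open>Z\<close> reveals \<open>x'\<close> through \<open>X - Z\<close>, and \<open>y\<close>,
  \<open>y'\<close> up to their order through \<open>Z - X\<close>, whence the factor 2.\<close>

lemma mult_lower_bound:
  assumes X: "X \<in> near" and x: "x \<in> X - circ X"
    and wide: "\<And>y. y \<in> E - cl (X - {x}) \<Longrightarrow> s < card (E - cl (insert y (X - {x})))"
  shows "(card (X - circ X) - 1) * (s * (s - 1)) \<le> 2 * mult (circ X)"
proof -
  note nX = nearD[OF X]
  \<comment> \<open>\<open>x\<close> and \<open>x'\<close> are excluded so that no exchange is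
    undone. Of the at least s + 1 candidates given by \<open>wide\<close>, s remain for
    \<open>y\<close> and s - 1 for \<open>y'\<close>.\<close>
  define A where "A = E - cl (X - {x}) - {x}"
  define B where "B x' y = E - cl (insert y (X - {x}) - {x'}) - {x, x'}" for x' y
  define fam where "fam x' = {Z \<in> near. circ Z = circ X \<and> X - Z = {x, x'}}" for x'
  have finfam: "finite (fam x')" for x'
    using finite_rsets[OF finite_E] by (auto simp: fam_def near_def)
  have xcl: "x \<in> E - cl (X - {x})"
  proof -
    have "rk (insert x (X - {x})) \<noteq> rk (X - {x})" using x by (auto simp: insert_absorb circ_def)
    then show ?thesis using x nX by (auto simp: cl_def)
  qed
  have each: "s * (s - 1) \<le> 2 * card (fam x')" if x': "x' \<in> X - circ X - {x}" for x'
  proof -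
    have cA: "s \<le> card A"
    proof -
      have "s < card (E - cl (insert x (X - {x})))" using wide xcl by blast
      also have "\<dots> \<le> card (E - cl (X - {x}))"
        using finite_E cl_mono[of "X - {x}" "insert x (X - {x})"] by (intro card_mono) auto
      finally show ?thesis using xcl finite_E by (simp add: A_def)
    qed
    have in_near: "insert y (X - {x}) \<in> near" "circ (insert y (X - {x})) = circ X"
       "x' \<in> insert y (X - {x}) - circ (insert y (X - {x}))" "y \<noteq> x'" "y \<notin> X" "y \<in> E" if "y \<in> A" for y
      using near_exchange[OF X x, of y] that x' by (auto simp: A_def)
    have cB: "s - 1 \<le> card (B x' y)" if "y \<in> A" for y
    proof -
      have "s < card (E - cl (insert y (X - {x})))" using wide that by (auto simp: A_def)
      also have "\<dots> \<le> card (E - cl (insert y (X - {x}) - {x'}))"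
        using finite_E cl_mono[of "insert y (X - {x}) - {x'}" "insert y (X - {x})"] by (intro card_mono) auto
      also have "\<dots> \<le> card (B x' y) + 2"
      proof -
        have "card (E - cl (insert y (X - {x}) - {x'})) \<le> card (B x' y \<union> {x, x'})"
          using finite_E by (intro card_mono) (auto simp: B_def)
        also have "\<dots> \<le> card (B x' y) + card {x, x'}" by (rule card_Un_le)
        also have "card {x, x'} \<le> 2" by (simp add: card_insert_if)
        finally show ?thesis by simp
      qed
      finally show ?thesis by simp
    qed
    define f where "f p = insert (snd p) (insert (fst p) (X - {x}) - {x'})" for p
    have fprop: "f (y, y') \<in> fam x' \<and> f (y, y') - X = {y, y'}" if y: "y \<in> A" and y': "y' \<in> B x' y" for y y'
    proof -
      note h = in_near[OF y]
      have y'': "y' \<in> E - cl (insert y (X - {x}) - {x'})" "y' \<noteq> x" "y' \<noteq> x'" using y' by (auto simp: B_def)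
      note g = near_exchange[OF h(1) h(3) y''(1)]
      have "y' \<notin> X" using g(4) y'' by auto
      then have "X - f (y, y') = {x, x'}" "f (y, y') - X = {y, y'}"
        using x x' h y'' by (auto simp: f_def)
      then show ?thesis using g h by (auto simp: fam_def f_def)
    qed
    have "s * (s - 1) \<le> card A * (s - 1)" using cA by simp
    also have "\<dots> = (\<Sum>y\<in>A. s - 1)" by simp
    also have "\<dots> \<le> (\<Sum>y\<in>A. card (B x' y))" by (intro sum_mono cB)
    also have "\<dots> = card (Sigma A (B x'))"
      using finite_E by (subst card_SigmaI) (auto simp: A_def B_def)
    also have "\<dots> \<le> 2 * card (fam x')"
    proof (rule card_le_fibers[of _ f])
      show "finite (fam x')" by (rule finfam)
      show "f ` Sigma A (B x') \<subseteq> fam x'" using fprop by auto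
      fix Z assume "Z \<in> fam x'"
      have "{a \<in> Sigma A (B x'). f a = Z} \<subseteq> {p. {fst p, snd p} = Z - X}" using fprop by force
      then show "finite {a \<in> Sigma A (B x'). f a = Z} \<and> card {a \<in> Sigma A (B x'). f a = Z} \<le> 2"
        using card_ordered_pairs_le[of "Z - X"] by (meson card_mono finite_subset le_trans)
    qed
    finally show ?thesis .
  qed
  have "(card (X - circ X) - 1) * (s * (s - 1)) = (\<Sum>x'\<in>X - circ X - {x}. s * (s - 1))"
    using x nX by simp
  also have "\<dots> \<le> (\<Sum>x'\<in>X - circ X - {x}. 2 * card (fam x'))" by (intro sum_mono each)
  also have "\<dots> = 2 * (\<Sum>x'\<in>X - circ X - {x}. card (fam x'))" by (simp add: sum_distrib_left)
  also have "(\<Sum>x'\<in>X - circ X - {x}. card (fam x')) = card (\<Union>x'\<in>X - circ X - {x}. fam x')"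
  proof (rule card_UN_disjoint[symmetric])
    show "\<forall>i\<in>X - circ X - {x}. \<forall>j\<in>X - circ X - {x}. i \<noteq> j \<longrightarrow> fam i \<inter> fam j = {}"
    proof (intro ballI impI)
      fix i j assume "i \<in> X - circ X - {x}" "j \<in> X - circ X - {x}" "i \<noteq> j"
      then have "{x, i} \<noteq> {x, j}" by blast
      then show "fam i \<inter> fam j = {}" unfolding fam_def by force
    qed
  qed (use nX(4) finfam in simp_all)
  also have "\<dots> \<le> mult (circ X)"
    unfolding mult_def using finite_rsets[OF finite_E] by (intro card_mono) (auto simp: fam_def near_def)
  finally show ?thesis by simp
qed

text \<open>One element of \<open>C\<close> is traded for two of \<open>S\<close>; both are visible
  in the difference with \<open>C\<close>, so different trades give different sets. A circuit with r
  - 1 elements thus yields many r-sets, and below all of them span the same flat.\<close>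

lemma card_swap_pairs:
  assumes "finite C" "finite S" "C \<inter> S = {}"
    and "\<And>u W. u \<in> C \<Longrightarrow> W \<subseteq> S \<Longrightarrow> card W = 2 \<Longrightarrow> (C - {u}) \<union> W \<in> \<Z>" and "finite \<Z>"
  shows "card C * (card S choose 2) \<le> card \<Z>"
proof -
  define g where "g p = (C - {fst p}) \<union> snd p" for p
  define D where "D = C \<times> {W. W \<subseteq> S \<and> card W = 2}"
  have "inj_on g D"
  proof (rule inj_onI)
    fix p q assume pq: "p \<in> D" "q \<in> D" "g p = g q"
    have dec: "C - g p = {fst p} \<and> g p - C = snd p" if "p \<in> D" for p
    proof -
      have "fst p \<in> C" "snd p \<subseteq> S" using that by (auto simp: D_def)
      then show ?thesis unfolding g_def using assms(3) by blast
    qed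
    have "{fst p} = {fst q}" "snd p = snd q" using dec[OF pq(1)] dec[OF pq(2)] pq(3) by simp_all
    then show "p = q" by (simp add: prod_eq_iff)
  qed
  moreover have "g ` D \<subseteq> \<Z>" using assms(4) by (auto simp: g_def D_def)
  ultimately have "card D \<le> card \<Z>" using assms(5) card_inj_on_le by blast
  then show ?thesis using assms by (simp add: D_def card_cartesian_product n_subsets)
qed

text \<open>Suppose that no recorded hyperplane isolates the coloop \<open>x\<close>. Then each
  hyperplane spanned by \<open>X - {x}\<close> and a further element misses more than
  \<open>s\<close> elements. If there is another coloop, \<open>mult_lower_bound\<close> puts
  \<open>circ X\<close> on the list of long circuits. If not, \<open>X - {x}\<close> is a circuit
  \<open>C\<close> with r - 1 elements; unless its spread reaches \<open>K\<close>, two large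
  hyperplanes pass through it, and either both of them or \<open>cl C\<close> are on the lists. In
  each case \<open>X\<close> is covered.\<close>

lemma good_coloops:
  assumes X: "X \<in> near" and nc: "\<not> covered (rk E) (sketch s K \<theta>) X" and x: "x \<in> X - circ X"
    and s: "s = K * (2 * t)" and t: "0 < t" and \<theta>: "\<theta> \<le> (rk E - 1) * (t choose 2)"
  shows "\<exists>H\<in>coshort s. X \<inter> H = X - {x}"
proof (rule ccontr)
  assume neg: "\<not> ?thesis"
  note nX = nearD[OF X]
  have noH: "\<not> X \<subseteq> H" if "H \<in> coshort s" for H using nc that by (auto simp: covered_def sketch_def)
  \<comment> \<open>Otherwise this hyperplane is recorded. It contains \<open>X - {x}\<close> but
    not the uncovered set \<open>X\<close>, so it would isolate \<open>x\<close>.\<close>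
  have wide: "s < card (E - cl (insert y (X - {x})))" if y: "y \<in> E - cl (X - {x})" for y
  proof (rule ccontr)
    assume "\<not> ?thesis"
    then have H: "cl (insert y (X - {x})) \<in> coshort s" (is "?H \<in> _")
      using cl_coshort[OF near_exchange(1)[OF X x y]] by simp
    have "X - {x} \<subseteq> ?H"
      using subset_cl[of "insert y (X - {x})"] y nX by auto
    then have "X \<inter> ?H = X - {x}" using noH[OF H] x by auto
    then show False using neg H by auto
  qed
  show False
  proof (cases "2 \<le> card (X - circ X)")
    case True
    have "(card (X - circ X) - 1) * (s * (s - 1)) \<le> 2 * mult (circ X)"
      by (rule mult_lower_bound[OF X x wide])
    \<comment> \<open>With two or more coloops, the one used up by the exchange costs at most a
      factor 2; this is how 4 arises in \<open>long_circs\<close>.\<close>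
    moreover have "card (X - circ X) \<le> 2 * (card (X - circ X) - 1)" using True by simp
    then have "card (X - circ X) * (s * (s - 1)) \<le> 2 * (card (X - circ X) - 1) * (s * (s - 1))"
      by (intro mult_right_mono) auto
    ultimately have "card (X - circ X) * (s * (s - 1)) \<le> 4 * mult (circ X)" by linarith
    then have "circ X \<in> long_circs s" using X True unfolding long_circs_def by blast
    then show False using nc circ_subset[of X] by (auto simp: covered_def sketch_def)
  next
    case False
    moreover have "card (X - circ X) \<noteq> 0" using x nX by auto
    ultimately have c1: "card (X - circ X) = 1" by simp
    then obtain x0 where "X - circ X = {x0}" using card_1_singletonE by blast
    then have CX: "X - {x} = circ X" using x circ_subset by auto
    define C where "C = circ X"
    have CE: "C \<subseteq> E" and fC: "finite C" using circ_subset[of X] nX finite_subset by (auto simp: C_def)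
    have cC: "Suc (card C) = rk E" using x nX CX unfolding C_def[symmetric] by (metis Diff_iff card.remove)
    have rC: "Suc (rk C) = card C" using rk_circ[OF X] by (simp add: C_def)
    have rCu: "rk (C - {u}) = rk C" if "u \<in> C" for u using rk_circ_remove[OF X] that by (simp add: C_def)
    have wide': "s < card (E - cl (insert y C))" if "y \<in> E - cl C" for y
      using wide that by (simp add: CX C_def)
    have CcX: "C \<subseteq> X" using circ_subset by (simp add: C_def)
    have rkins: "Suc (rk (insert y C)) = rk E" if "y \<in> E - cl C" for y
      using not_in_clD[of y C] that rC cC by simp
    have XC: "card (X \<inter> C) = card C" using CcX by (simp add: Int_absorb1)
    have "C \<notin> spread_circs K" using nc CcX by (auto simp: covered_def sketch_def)
    then have sp: "spread C < real K" using X c1 unfolding spread_circs_def C_def by force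
    \<comment> \<open>Averaging: if all these hyperplanes had at most 2t elements outside
      \<open>C\<close>, then more than s = 2Kt terms of \<open>spread C\<close> would be at least 1
      / (2t), and the sum at least \<open>K\<close>.\<close>
    have pick: "\<exists>y\<in>Z. 2 * t < card (cl (insert y C) - C)" if Z: "Z \<subseteq> E - cl C" "s < card Z" for Z
    proof (rule ccontr)
      assume n: "\<not> ?thesis"
      have fZ: "finite Z" using Z finite_E by (meson finite_Diff finite_subset)
      have pos: "0 < card (cl (insert y C) - C)" if "y \<in> E - cl C" for y
      proof -
        have "y \<in> cl (insert y C) - C" using that subset_cl[of "insert y C"] subset_cl[OF CE] CE by auto
        then show ?thesis using finite_cl by (auto simp: card_gt_0_iff)
      qed
      have "real K = real s / real (2 * t)" using s t by simp
      also have "\<dots> \<le> real (card Z) * (1 / real (2 * t))" using Z t by (simp add: divide_right_mono)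
      also have "\<dots> = (\<Sum>y\<in>Z. 1 / real (2 * t))" by simp
      also have "\<dots> \<le> (\<Sum>y\<in>Z. 1 / real (card (cl (insert y C) - C)))"
      proof (rule sum_mono)
        fix y assume y: "y \<in> Z"
        have "card (cl (insert y C) - C) \<le> 2 * t" using n y by auto
        then show "1 / real (2 * t) \<le> 1 / real (card (cl (insert y C) - C))"
          using pos[of y] y Z t by (intro divide_left_mono) (auto simp del: of_nat_mult)
      qed
      also have "\<dots> \<le> spread C" unfolding spread_def using Z finite_E by (intro sum_mono2) auto
      finally show False using sp by simp
    qed
    obtain y0 where y0: "y0 \<in> E - cl C"
    proof -
      have "rk (X - {x}) \<noteq> rk X" using x by (auto simp: circ_def)
      then have "rk X \<noteq> rk C" unfolding C_def CX by simp
      moreover have "insert x C = X" using x CX unfolding C_def by blast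
      ultimately have "x \<in> E - cl C" using x nX(1) by (auto simp: cl_def)
      then show ?thesis using that by blast
    qed
    have "s < card (E - cl C)"
      using wide'[OF y0] finite_E cl_mono[of C "insert y0 C"]
      by (meson Diff_mono card_mono finite_Diff less_le_trans order_refl subset_insertI)
    then obtain y1 where y1: "y1 \<in> E - cl C" "2 * t < card (cl (insert y1 C) - C)" using pick[of "E - cl C"] by auto
    \<comment> \<open>\<open>y2\<close> is chosen outside the hyperplane of \<open>y1\<close>, so
      that the two hyperplanes differ.\<close>
    have "E - cl (insert y1 C) \<subseteq> E - cl C" using cl_mono[of C "insert y1 C"] by auto
    then obtain y2 where y2: "y2 \<in> E - cl (insert y1 C)" "2 * t < card (cl (insert y2 C) - C)" "y2 \<in> E - cl C"
      using pick[OF _ wide'[OF y1(1)]] by blast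
    show False
    \<comment> \<open>Each hyperplane has more than 2t elements outside \<open>C\<close>. Either at
      least t elements of \<open>E - C\<close> lie in \<open>cl C\<close>, which makes it a big
      flat, or both hyperplanes have at least t elements outside \<open>cl C\<close>, which makes
      them big hyperplanes.\<close>
    proof (cases "t \<le> card (cl C - C)")
      case True
      have "card C * (card (cl C - C) choose 2) \<le> card {Z \<in> rsets E (rk E). Suc (Suc (rk Z)) = rk E \<and> cl Z = cl C}"
      proof (rule card_swap_pairs)
        fix u W assume uW: "u \<in> C" "W \<subseteq> cl C - C" "card W = 2"
        let ?Z = "C - {u} \<union> W"
        have fW: "finite W" using uW by (intro card_ge_0_finite) simp
        have cZ: "card ?Z = rk E"
          using card_Suc_Diff1[OF fC uW(1)] card_Un_disjoint[of "C - {u}" W] uW fC fW cC by fastforce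
        have ZE: "?Z \<subseteq> E" using CE uW cl_subset_E by blast
        have cu: "cl (C - {u}) = cl C" using rCu[OF uW(1)] CE by (intro cl_eqI) auto
        have "rk ?Z = rk (C - {u})"
          using uW CE subset_cl[OF CE] cu by (intro rk_subset_cl_insert) auto
        moreover have "cl ?Z = cl (C - {u})"
          using calculation ZE by (intro cl_eqI[symmetric]) auto
        ultimately show "?Z \<in> {Z \<in> rsets E (rk E). Suc (Suc (rk Z)) = rk E \<and> cl Z = cl C}"
          using cZ ZE cu rCu[OF uW(1)] rC cC by (auto simp: rsets_def)
      qed (use fC finite_cl finite_rsets[OF finite_E] in auto)
      moreover have "(rk E - 1) * (t choose 2) \<le> card C * (card (cl C - C) choose 2)"
        using True cC by (intro mult_le_mono binomial_right_mono) auto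
      ultimately have "cl C \<in> big_flats \<theta>"
        using \<theta> cl_subset_E rk_cl[OF CE] rC cC by (auto simp: big_flats_def)
      moreover have "card C \<le> card (X \<inter> cl C)"
        using CcX subset_cl[OF CE] nX by (intro card_mono) auto
      ultimately show False using nc cC unfolding covered_def sketch_def by auto
    next
      case False
      have big: "cl (insert y C) \<in> big_hyps \<theta>" if y: "y \<in> E - cl C" "2 * t < card (cl (insert y C) - C)" for y
      proof -
        let ?H = "cl (insert y C)"
        have yE: "insert y C \<subseteq> E" using y CE by auto
        have CH: "C \<subseteq> ?H" "cl C \<subseteq> ?H" using subset_cl[OF yE] cl_mono[of C "insert y C"] by auto
        have rH: "Suc (rk ?H) = rk E" using rk_cl[OF yE] rkins[OF y(1)] by simp
        have clH: "cl ?H = ?H" using rk_cl[OF yE] subset_cl[OF yE] cl_subset_E by (intro cl_eqI[symmetric]) auto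
        have "?H - C = (?H - cl C) \<union> (cl C - C)" using CH subset_cl[OF CE] by auto
        then have "card (?H - C) \<le> card (?H - cl C) + card (cl C - C)" by (metis card_Un_le)
        then have tp: "t \<le> card (?H - cl C)" using y False by simp
        have "card C * (card (?H - cl C) choose 2) \<le> card {Z \<in> near. cl Z = ?H}"
        proof (rule card_swap_pairs)
          fix u W assume uW: "u \<in> C" "W \<subseteq> ?H - cl C" "card W = 2"
          let ?Z = "C - {u} \<union> W"
          have fW: "finite W" using uW by (intro card_ge_0_finite) simp
          have dis: "C \<inter> W = {}" using uW subset_cl[OF CE] by auto
          have cZ: "card ?Z = rk E"
            using card_Suc_Diff1[OF fC uW(1)] card_Un_disjoint[of "C - {u}" W] uW fC fW cC dis by fastforce
          have ZH: "?Z \<subseteq> ?H" using CH uW by blast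
          obtain v where v: "v \<in> W" using uW by fastforce
          have cu: "cl (C - {u}) = cl C" using rCu[OF uW(1)] CE by (intro cl_eqI) auto
          have "v \<in> E - cl (C - {u})" using v uW cu cl_subset_E by auto
          then have "rk (insert v (C - {u})) = Suc (rk C)" using not_in_clD rCu[OF uW(1)] by auto
          moreover have "rk (insert v (C - {u})) \<le> rk ?Z" using v by (intro rk_mono) auto
          moreover have "rk ?Z \<le> rk ?H" using ZH by (rule rk_mono)
          ultimately have rZ: "rk ?Z = rk ?H" using rH rC cC by simp
          then have "cl ?Z = ?H" using cl_eqI[OF ZH cl_subset_E rZ] clH by simp
          then show "?Z \<in> {Z \<in> near. cl Z = ?H}"
            using cZ rZ rH order_trans[OF ZH cl_subset_E] by (simp add: near_def rsets_def)
        qed (use fC finite_cl finite_rsets[OF finite_E] subset_cl[OF CE] in \<open>auto simp: near_def\<close>)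
        moreover have "(rk E - 1) * (t choose 2) \<le> card C * (card (?H - cl C) choose 2)"
          using tp cC by (intro mult_le_mono binomial_right_mono) auto
        ultimately show ?thesis using \<theta> cl_subset_E rH clH by (auto simp: big_hyps_def)
      qed
      have y1E: "insert y1 C \<subseteq> E" and y2E: "insert y2 C \<subseteq> E" using y1 y2 CE by auto
      have "cl (insert y1 C) \<noteq> cl (insert y2 C)" using y2 subset_cl[OF y2E] by auto
      moreover have "cl (insert y1 C) \<in> big_hyps \<theta>" "cl (insert y2 C) \<in> big_hyps \<theta>"
        using big y1 y2 by auto
      moreover have "card C \<le> card (X \<inter> (cl (insert y1 C) \<inter> cl (insert y2 C)))"
        using CcX subset_cl[OF y1E] subset_cl[OF y2E] nX by (intro card_mono) auto
      then have "rk E \<le> Suc (card (X \<inter> (cl (insert y1 C) \<inter> cl (insert y2 C))))" using cC by simp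
      ultimately have "covered (rk E) (sketch s K \<theta>) X"
        unfolding covered_def sketch_def prod.case by blast
      then show False using nc by simp
    qed
  qed
qed

end

section \<open>Reconstruction from a stable family\<close>

text \<open>If \<open>X\<close> is a nonbasis and \<open>Q\<close> consists of hyperplanes, then each deleted element is a coloop of \<open>X\<close>,
  so that the core still contains a circuit.\<close>

definition core :: "'a set set \<Rightarrow> 'a set \<Rightarrow> 'a set" where
  "core Q X = X - {x \<in> X. \<exists>H\<in>Q. X \<inter> H = X - {x}}"

text \<open>The first alternative propagates a circuit; the second one is its dual and propagates a
  cocircuit in the complement, that is, a hyperplane containing \<open>X\<close>.\<close>

definition derives :: "'a set \<Rightarrow> 'a set set \<Rightarrow> 'a set set \<Rightarrow> 'a set \<Rightarrow> 'a set \<Rightarrow> bool" where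
  "derives E Q Q' X Y \<longleftrightarrow> core Q X \<subseteq> Y \<or> core Q' (E - X) \<subseteq> E - Y"

text \<open>Two derivation steps are allowed since \<open>trace_derives\<close> needs an
  intermediate set; a single step is the case \<open>Y' = Y\<close>. The family \<open>Z\<close> is
  common to a whole class of matroids, so its members cost nothing.\<close>

definition recon where
  "recon E r S S' Z T = {X \<in> rsets E r. covered r S X \<or> covered (card E - r) S' (E - X) \<or> X \<in> Z \<or>
     (\<exists>Y\<in>T. \<exists>Y'\<in>rsets E r. derives E (fst S) (fst S') Y Y' \<and> derives E (fst S) (fst S') Y' X)}"

definition adj :: "'a set \<Rightarrow> 'a set \<Rightarrow> bool" where
  "adj X Y \<longleftrightarrow> (\<exists>u v. u \<in> X \<and> v \<notin> X \<and> Y = insert v (X - {u}))"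

definition stable_family :: "'a set set \<Rightarrow> bool" where
  "stable_family T \<longleftrightarrow> (\<forall>X\<in>T. \<forall>Y\<in>T. \<not> adj X Y)"

lemma adj_sym: "adj X Y \<Longrightarrow> adj Y X"
proof -
  assume "adj X Y"
  then obtain u v where uv: "u \<in> X" "v \<notin> X" "Y = insert v (X - {u})" by (auto simp: adj_def)
  then have "v \<in> Y" "u \<notin> Y" "X = insert u (Y - {v})" by auto
  then show "adj Y X" unfolding adj_def by blast
qed

lemma stable_subset: "stable_family T \<Longrightarrow> S \<subseteq> T \<Longrightarrow> stable_family S"
  by (auto simp: stable_family_def)

lemma derives_refl: "derives E Q Q' X X"
  by (auto simp: derives_def core_def)

lemma maximal_stable_exists:
  assumes "finite U" "S \<subseteq> U" "stable_family S"
  shows "\<exists>T. S \<subseteq> T \<and> T \<subseteq> U \<and> stable_family T \<and> (\<forall>X\<in>U. X \<in> T \<or> (\<exists>Y\<in>T. adj Y X))"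
proof -
  let ?F = "{T. S \<subseteq> T \<and> T \<subseteq> U \<and> stable_family T}"
  have "finite ?F" using assms(1) by (rule_tac finite_subset[of _ "Pow U"]) auto
  moreover have "S \<in> ?F" using assms by auto
  ultimately obtain T where T: "T \<in> ?F" "\<And>T'. T' \<in> ?F \<Longrightarrow> T \<subseteq> T' \<Longrightarrow> T = T'"
    using finite_has_maximal[of ?F] by (metis (no_types, lifting) empty_iff)
  have "\<exists>Y\<in>T. adj Y X" if X: "X \<in> U" "X \<notin> T" for X
  proof (rule ccontr)
    assume n: "\<not> ?thesis"
    have "\<not> adj X X" by (auto simp: adj_def)
    then have "stable_family (insert X T)"
      using T(1) n adj_sym unfolding stable_family_def by blast
    then have "insert X T \<in> ?F" using T(1) X by auto
    then show False using T(2)[of "insert X T"] X by auto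
  qed
  then show ?thesis using T(1) by blast
qed

context rank_function
begin

section \<open>Lengths of the lists in a sketch\<close>

lemma sum_long_circs:
  "(\<Sum>C\<in>long_circs s. rk E - card C) * (s * (s - 1)) \<le> 4 * (card E choose rk E)"
proof -
  have fN: "finite near" using finite_rsets[OF finite_E] by (auto simp: near_def)
  have sub: "long_circs s \<subseteq> circ ` near" by (auto simp: long_circs_def)
  then have fL: "finite (long_circs s)" using fN finite_surj by blast
  have "(\<Sum>C\<in>long_circs s. rk E - card C) * (s * (s - 1)) = (\<Sum>C\<in>long_circs s. (rk E - card C) * (s * (s - 1)))"
    by (simp add: sum_distrib_right)
  also have "\<dots> \<le> (\<Sum>C\<in>long_circs s. 4 * mult C)"
  proof (rule sum_mono)
    fix C assume "C \<in> long_circs s"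
    then obtain X where X: "X \<in> near" "C = circ X" "card (X - circ X) * (s * (s - 1)) \<le> 4 * mult (circ X)"
      by (auto simp: long_circs_def)
    moreover have "card (X - circ X) = rk E - card C"
      using X nearD[OF X(1)] circ_subset[of X] by (simp add: card_Diff_subset finite_subset)
    ultimately show "(rk E - card C) * (s * (s - 1)) \<le> 4 * mult C" by simp
  qed
  also have "\<dots> = 4 * card (\<Union>C\<in>long_circs s. {X \<in> near. circ X = C})"
    unfolding mult_def sum_distrib_left[symmetric]
    using fL fN by (subst card_UN_disjoint) auto
  also have "\<dots> \<le> 4 * card (rsets E (rk E))"
    using finite_rsets[OF finite_E] by (intro mult_left_mono card_mono) (auto simp: near_def)
  finally show ?thesis by (simp add: card_rsets[OF finite_E])
qed

lemma card_families_le: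
  assumes "\<And>F. F \<in> \<F> \<Longrightarrow> \<theta> \<le> card {Z \<in> A. g Z = F}" "finite A" "finite \<F>"
  shows "card \<F> * \<theta> \<le> card A"
proof -
  have "card \<F> * \<theta> = (\<Sum>F\<in>\<F>. \<theta>)" by simp
  also have "\<dots> \<le> (\<Sum>F\<in>\<F>. card {Z \<in> A. g Z = F})" using assms(1) by (rule sum_mono)
  also have "\<dots> = card (\<Union>F\<in>\<F>. {Z \<in> A. g Z = F})" using assms by (subst card_UN_disjoint) auto
  also have "\<dots> \<le> card A" using assms by (intro card_mono) auto
  finally show ?thesis .
qed

lemma card_big_flats: "card (big_flats \<theta>) * \<theta> \<le> (card E choose rk E)"
proof -
  have "card (big_flats \<theta>) * \<theta> \<le> card {Z \<in> rsets E (rk E). Suc (Suc (rk Z)) = rk E}"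
    using finite_rsets[OF finite_E] finite_E
    by (intro card_families_le[where g = cl]) (auto simp: big_flats_def conj_assoc)
  also have "\<dots> \<le> card (rsets E (rk E))" using finite_rsets[OF finite_E] by (intro card_mono) auto
  finally show ?thesis by (simp add: card_rsets[OF finite_E])
qed

lemma card_big_hyps: "card (big_hyps \<theta>) * \<theta> \<le> (card E choose rk E)"
proof -
  have "card (big_hyps \<theta>) * \<theta> \<le> card near"
    using finite_rsets[OF finite_E] finite_E
    by (intro card_families_le[where g = cl]) (auto simp: big_hyps_def near_def)
  also have "\<dots> \<le> card (rsets E (rk E))" using finite_rsets[OF finite_E] by (intro card_mono) (auto simp: near_def)
  finally show ?thesis by (simp add: card_rsets[OF finite_E])
qed

text \<open>Each independent set \<open>S\<close> of size \<open>rk E - 1\<close> arises from at most \<open>card (cl S - S)\<close> of the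
  listed circuits, which cancels against the weights in \<^const>\<open>spread\<close>.\<close>

lemma card_spread_circs:
  "card (spread_circs K) * (K * (rk E - 1)) \<le> (card E choose (rk E - 1))"
proof -
  define L where "L = spread_circs K"
  have LD: "C \<subseteq> E \<and> finite C \<and> Suc (card C) = rk E \<and> Suc (rk C) = card C \<and> (\<forall>u\<in>C. rk (C - {u}) = rk C) \<and>
     (\<forall>y\<in>E - cl C. insert y C \<in> near \<and> circ (insert y C) = C) \<and> real K \<le> spread C" if CL: "C \<in> L" for C
  proof -
    obtain X where X: "X \<in> near" "C = circ X" "card (X - circ X) = 1" "real K \<le> spread (circ X)"
      using CL unfolding L_def spread_circs_def by blast
    note nX = nearD[OF X(1)]
    obtain x where x: "X - circ X = {x}" using X(3) card_1_singletonE by blast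
    then have CX: "X - {x} = C" "x \<in> X - circ X" using circ_subset[of X] X(2) by auto
    have "finite C" "C \<subseteq> E" using CX nX by auto
    moreover have "Suc (card C) = rk E" using CX nX by (metis Diff_iff card.remove)
    moreover have "insert y C \<in> near \<and> circ (insert y C) = C" if "y \<in> E - cl C" for y
      using near_exchange[OF X(1) CX(2), of y] that CX X(2) by simp
    ultimately show ?thesis using X rk_circ[OF X(1)] rk_circ_remove[OF X(1)] by auto
  qed
  have "L \<subseteq> Pow E" using LD by blast
  then have finL: "finite L" by (rule finite_subset) (use finite_E in simp)
  define Tr where "Tr = (SIGMA C:L. (E - cl C) \<times> C)"
  have finTr: "finite Tr" unfolding Tr_def using finL finite_E LD by auto
  define f where "f p = (case p of (C, y, u) \<Rightarrow> insert y (C - {u}))" for p :: "'a set \<times> 'a \<times> 'a"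
  define w where "w p = (case p of (C, y, u) \<Rightarrow> 1 / real (card (cl (insert y C) - C)))" for p :: "'a set \<times> 'a \<times> 'a"
  \<comment> \<open>\<open>S\<close> has as many elements as \<open>C\<close> and the same closure
    as \<open>insert y C\<close>, so the weight of a triple depends on \<open>S\<close>
    alone.\<close>
  have fp: "insert y (C - {u}) \<in> rsets E (rk E - 1) \<and> w (C, y, u) = 1 / real (card (cl S - S)) \<and>
      u \<in> cl S - S \<and> insert u S = insert y C \<and> y \<notin> C" if t: "C \<in> L" "y \<in> E - cl C" "u \<in> C" "S = insert y (C - {u})" for C y u S
  proof -
    note pC = LD[OF t(1)]
    have CE: "C \<subseteq> E" and yE: "insert y C \<subseteq> E" using pC t by auto
    have yC: "y \<notin> C" using t subset_cl[OF CE] by auto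
    have cS: "card S = card C" using t yC pC by (metis Diff_iff card.remove card_insert_disjoint finite_Diff)
    have SE: "S \<subseteq> insert y C" using t by auto
    have cu: "cl (C - {u}) = cl C" using pC t by (intro cl_eqI) auto
    have "rk S = Suc (rk (C - {u}))" using not_in_clD[of y "C - {u}"] cu t by auto
    then have "rk S = rk (insert y C)" using not_in_clD[of y C] t pC by auto
    then have clS: "cl S = cl (insert y C)" using SE yE by (intro cl_eqI) auto
    have sub: "insert y C \<subseteq> cl S" using subset_cl[OF yE] clS by simp
    have fS: "finite S" "finite C" using finite_subset_E CE SE yE by auto
    have "card (cl S - S) = card (cl S) - card S" "card (cl S - C) = card (cl S) - card C"
      using card_Diff_subset[of S "cl S"] card_Diff_subset[of C "cl S"] fS sub SE by auto
    then have "card (cl S - S) = card (cl S - C)" using cS by simp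
    moreover have "S \<in> rsets E (rk E - 1)" using cS pC SE yE by (auto simp: rsets_def)
    moreover have "insert u S = insert y C" "u \<notin> S" using t yC by auto
    ultimately show ?thesis using t sub clS yC by (auto simp: w_def)
  qed
  have "real (card L * (K * (rk E - 1))) = (\<Sum>C\<in>L. real K * real (rk E - 1))" by simp
  also have "\<dots> \<le> (\<Sum>C\<in>L. spread C * real (card C))"
  proof (intro sum_mono mult_mono)
    fix C assume "C \<in> L"
    then show "real K \<le> spread C" "real (rk E - 1) \<le> real (card C)" using LD[of C] by auto
  qed (auto simp: spread_def intro!: sum_nonneg)
  also have "\<dots> = (\<Sum>C\<in>L. \<Sum>q\<in>(E - cl C) \<times> C. w (C, q))"
  proof (rule sum.cong[OF refl])
    fix C assume "C \<in> L"
    show "spread C * real (card C) = (\<Sum>q\<in>(E - cl C) \<times> C. w (C, q))"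
      unfolding spread_def w_def sum_distrib_right
      by (simp add: sum.cartesian_product[symmetric])
  qed
  also have "\<dots> = sum w Tr"
    unfolding Tr_def using finL finite_E LD by (subst sum.Sigma) auto
  also have "\<dots> = (\<Sum>S\<in>rsets E (rk E - 1). sum w {p \<in> Tr. f p = S})"
    by (rule sum.group[symmetric]) (use finTr finite_rsets[OF finite_E] fp in \<open>auto simp: Tr_def f_def\<close>)
  also have "\<dots> \<le> (\<Sum>S\<in>rsets E (rk E - 1). 1)"
  proof (rule sum_mono)
    fix S assume S: "S \<in> rsets E (rk E - 1)"
    let ?P = "{p \<in> Tr. f p = S}"
    have inP: "\<exists>C y u. p = (C, y, u) \<and> C \<in> L \<and> y \<in> E - cl C \<and> u \<in> C \<and> S = insert y (C - {u})" if "p \<in> ?P" for p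
      using that by (auto simp: Tr_def f_def)
    \<comment> \<open>Given \<open>S\<close>, the element \<open>u\<close> determines the triple:
      \<open>insert u S\<close> equals \<open>insert y C\<close>, whose only circuit is
      \<open>C\<close>.\<close>
    have "inj_on (\<lambda>p. snd (snd p)) ?P"
    proof (rule inj_onI)
      fix p q assume pq: "p \<in> ?P" "q \<in> ?P" "snd (snd p) = snd (snd q)"
      obtain C y u where p: "p = (C, y, u)" "C \<in> L" "y \<in> E - cl C" "u \<in> C" "S = insert y (C - {u})" using inP[OF pq(1)] by blast
      obtain D z v where q: "q = (D, z, v)" "D \<in> L" "z \<in> E - cl D" "v \<in> D" "S = insert z (D - {v})" using inP[OF pq(2)] by blast
      have uv: "u = v" using pq p q by simp
      have e: "insert y C = insert z D" using fp[OF p(2-5)] fp[OF q(2-5)] uv by metis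
      have "circ (insert y C) = C" "circ (insert z D) = D" using LD[OF p(2)] LD[OF q(2)] p q by auto
      then have "C = D" using e by simp
      moreover have "y \<notin> C" "z \<notin> D" using fp[OF p(2-5)] fp[OF q(2-5)] by auto
      ultimately have "y = z" using e by blast
      then show "p = q" using p q uv \<open>C = D\<close> by simp
    qed
    moreover have "(\<lambda>p. snd (snd p)) ` ?P \<subseteq> cl S - S"
    proof
      fix a assume "a \<in> (\<lambda>p. snd (snd p)) ` ?P"
      then obtain p where a: "p \<in> ?P" "a = snd (snd p)" by blast
      then obtain C y u where p: "p = (C, y, u)" "C \<in> L" "y \<in> E - cl C" "u \<in> C" "S = insert y (C - {u})" using inP[OF a(1)] by blast
      then show "a \<in> cl S - S" using fp[OF p(2-5)] a by simp
    qed
    ultimately have "card ?P \<le> card (cl S - S)" by (rule card_inj_on_le) (use finite_cl in simp)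
    have "sum w ?P = (\<Sum>p\<in>?P. 1 / real (card (cl S - S)))"
    proof (rule sum.cong[OF refl])
      fix p assume "p \<in> ?P"
      from inP[OF this] obtain C y u where p: "p = (C, y, u)" "C \<in> L" "y \<in> E - cl C" "u \<in> C" "S = insert y (C - {u})" by blast
      then show "w p = 1 / real (card (cl S - S))" using fp[OF p(2-5)] by simp
    qed
    also have "\<dots> = real (card ?P) / real (card (cl S - S))" by simp
    also have "\<dots> \<le> 1" using \<open>card ?P \<le> card (cl S - S)\<close> by (cases "card (cl S - S) = 0") auto
    finally show "sum w ?P \<le> 1" .
  qed
  also have "\<dots> = real (card E choose (rk E - 1))" by (simp add: card_rsets[OF finite_E])
  finally show ?thesis unfolding L_def by (simp only: of_nat_le_iff)
qed

section \<open>Soundness and completeness of the reconstruction\<close>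

lemma nonbasis_of_core:
  assumes X: "X \<in> nonbases" and Y: "Y \<in> rsets E (rk E)" and c: "core (coshort s) X \<subseteq> Y"
  shows "Y \<in> nonbases"
proof -
  have X': "X \<subseteq> E" "card X = rk E" "rk X < rk E" "finite X" using X finite_subset_E by (auto simp: nonbases_def rsets_def)
  define P where "P = {x \<in> X. \<exists>H\<in>coshort s. X \<inter> H = X - {x}}"
  have "rk (X - P) + card P = rk X"
  proof (rule rk_remove_coloops)
    fix x assume "x \<in> P"
    then obtain H where H: "x \<in> X" "H \<in> coshort s" "X \<inter> H = X - {x}" by (auto simp: P_def)
    show "rk (X - {x}) \<noteq> rk X"
    proof
      assume "rk (X - {x}) = rk X"
      then have "rk (insert x (X - {x})) = rk (X - {x})" using H by (simp add: insert_absorb)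
      then have "rk (insert x H) = rk H" by (rule rk_insert_span_mono) (use H in auto)
      moreover have "x \<in> E - H" using H X' by auto
      ultimately show False using H(2) by (auto simp: coshort_def)
    qed
  qed (use X' in \<open>auto simp: P_def\<close>)
  moreover have "card (X - P) + card P = card X"
    using X' by (metis (no_types, lifting) P_def card_Diff_subset card_mono finite_subset le_add_diff_inverse2 mem_Collect_eq subsetI)
  ultimately have "rk (X - P) < card (X - P)" using X' by simp
  moreover have "X - P \<subseteq> Y" using c by (simp add: core_def P_def)
  moreover have fY: "finite Y" "card Y = rk E" using Y finite_subset_E by (auto simp: rsets_def)
  ultimately have "rk Y \<noteq> card Y" using rk_subset_indep[of Y "X - P"] by auto
  then show ?thesis using Y fY rk_le_card[of Y] by (auto simp: nonbases_def)
qed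

lemma corank_Diff: "X \<subseteq> E \<Longrightarrow> corank E rk (E - X) + rk E = card (E - X) + rk X"
  using corank_add[of "E - X"] by (simp add: double_diff Int_absorb1 Diff_subset)

lemma rk_E_le: "rk E \<le> card E" using rk_le_card[OF finite_E] .

lemma corank_E_eq: "corank E rk E = card E - rk E" using corank_E by linarith

lemma compl_rsets: "X \<in> rsets E r \<Longrightarrow> r \<le> card E \<Longrightarrow> E - X \<in> rsets E (card E - r)"
  by (auto simp: rsets_def card_Diff_subset finite_subset_E)

lemma dual_nonbases:
  assumes "X \<in> rsets E (rk E)"
  shows "E - X \<in> rank_function.nonbases E (corank E rk) \<longleftrightarrow> X \<in> nonbases"
proof -
  interpret D: rank_function E "corank E rk" by (rule rank_function_corank)
  have X: "X \<subseteq> E" "card X = rk E" using assms by (auto simp: rsets_def)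
  have "card (E - X) = card E - rk E" using X finite_subset_E by (simp add: card_Diff_subset)
  then have "corank E rk (E - X) < corank E rk E \<longleftrightarrow> rk X < rk E"
    using corank_Diff[OF X(1)] corank_E rk_E_le by linarith
  then show ?thesis using assms compl_rsets[OF assms rk_E_le]
    by (simp add: nonbases_def D.nonbases_def corank_E_eq)
qed

text \<open>For \<open>u\<close> outside \<open>X\<close>, deleting \<open>u\<close> from
  \<open>E - X\<close> preserves the corank iff adding \<open>u\<close> to \<open>X\<close> raises
  the rank. So the circuit of \<open>E - X\<close> in the dual is the cocircuit that is
  complementary to the hyperplane \<open>cl X\<close>.\<close>

lemma dual_near:
  assumes "X \<in> near"
  shows "E - X \<in> rank_function.near E (corank E rk)"
    "rank_function.circ (corank E rk) (E - X) = E - cl X"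
proof -
  interpret D: rank_function E "corank E rk" by (rule rank_function_corank)
  note X = nearD[OF assms]
  have c: "card (E - X) = card E - rk E" using X by (simp add: card_Diff_subset)
  have "Suc (corank E rk (E - X)) = corank E rk E"
    using corank_Diff[OF X(1)] corank_E rk_E_le c X by linarith
  then show "E - X \<in> rank_function.near E (corank E rk)"
    using X c compl_rsets[of X "rk E"] rk_E_le by (simp add: D.near_def corank_E_eq near_def rsets_def)
  have "corank E rk (E - X - {u}) = corank E rk (E - X) \<longleftrightarrow> rk (insert u X) \<noteq> rk X" if u: "u \<in> E - X" for u
  proof -
    have e: "E - X - {u} = E - insert u X" by auto
    have "corank E rk (E - insert u X) + rk E = card (E - insert u X) + rk (insert u X)"
      using u X by (intro corank_Diff) auto
    moreover have "Suc (card (E - insert u X)) = card (E - X)"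
      using u finite_E by (metis Diff_insert card_Suc_Diff1 finite_Diff)
    ultimately show ?thesis using corank_Diff[OF X(1)] rk_insert_cases[of u X] unfolding e by linarith
  qed
  then show "rank_function.circ (corank E rk) (E - X) = E - cl X"
    using subset_cl[OF X(1)] unfolding D.circ_def cl_def by (auto simp: insert_absorb)
qed

lemma derives_nonbasis:
  assumes X: "X \<in> nonbases" and Y: "Y \<in> rsets E (rk E)"
    and d: "derives E (coshort s) (rank_function.coshort E (corank E rk) s) X Y"
  shows "Y \<in> nonbases"
proof -
  interpret D: rank_function E "corank E rk" by (rule rank_function_corank)
  have X': "X \<in> rsets E (rk E)" using X by (simp add: nonbases_def)
  show ?thesis
  proof (cases "core (coshort s) X \<subseteq> Y")
    case True then show ?thesis using nonbasis_of_core[OF X Y] by simp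
  next
    case False
    then have "core (D.coshort s) (E - X) \<subseteq> E - Y" using d by (simp add: derives_def)
    then have "E - Y \<in> D.nonbases"
      using D.nonbasis_of_core[of "E - X" "E - Y" s] dual_nonbases[OF X'] X compl_rsets[OF Y rk_E_le]
      by (simp add: corank_E_eq)
    then show ?thesis using dual_nonbases[OF Y] by simp
  qed
qed

abbreviation "dsketch \<equiv> rank_function.sketch E (corank E rk)"

lemma fst_sketch: "fst (sketch s K \<theta>) = coshort s"
  by (simp add: sketch_def)

lemma recon_nonbases:
  assumes "Z \<subseteq> nonbases" "T \<subseteq> nonbases"
  shows "recon E (rk E) (sketch s K \<theta>) (dsketch s K \<theta>) Z T \<subseteq> nonbases"
proof
  interpret D: rank_function E "corank E rk" by (rule rank_function_corank)
  fix X assume X: "X \<in> recon E (rk E) (sketch s K \<theta>) (dsketch s K \<theta>) Z T"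
  then have Xr: "X \<in> rsets E (rk E)" by (simp add: recon_def)
  have 1: "X \<in> nonbases" if "covered (rk E) (sketch s K \<theta>) X" using covered_nonbasis[OF Xr that] .
  have 2: "X \<in> nonbases" if "covered (card E - rk E) (dsketch s K \<theta>) (E - X)"
    using D.covered_nonbasis[of "E - X" s K \<theta>] that dual_nonbases[OF Xr] compl_rsets[OF Xr rk_E_le]
    by (simp add: corank_E_eq)
  have 3: "X \<in> nonbases" if "Y \<in> T" "Y' \<in> rsets E (rk E)"
    "derives E (coshort s) (D.coshort s) Y Y'" "derives E (coshort s) (D.coshort s) Y' X" for Y Y'
    using derives_nonbasis[OF _ that(2,3)] derives_nonbasis[OF _ Xr that(4)] assms that(1) by auto
  show "X \<in> nonbases"
    using X 1 2 3 assms(1) unfolding recon_def fst_sketch D.fst_sketch by blast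
qed

text \<open>The sets of rank r - 1 whose detection is left to the stable family.\<close>

definition uncovered where
  "uncovered s K \<theta> Z = {X \<in> near. \<not> covered (rk E) (sketch s K \<theta>) X \<and>
     \<not> covered (card E - rk E) (dsketch s K \<theta>) (E - X) \<and> X \<notin> Z}"

text \<open>\<open>good_coloops\<close> for the matroid and for its dual: the cores have lost all
  coloops. The two bounds on \<open>\<theta>\<close> come from the ranks r and n - r.\<close>

lemma uncovered_core:
  assumes X: "X \<in> uncovered s K \<theta> Z"
    and s: "s = K * (2 * t)" and t: "0 < t"
    and \<theta>: "\<theta> \<le> (rk E - 1) * (t choose 2)" "\<theta> \<le> (card E - rk E - 1) * (t choose 2)"
  shows "core (coshort s) X \<subseteq> circ X" "core (rank_function.coshort E (corank E rk) s) (E - X) \<subseteq> E - cl X"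
proof -
  interpret D: rank_function E "corank E rk" by (rule rank_function_corank)
  have nX: "X \<in> near" using X by (simp add: uncovered_def)
  have "\<exists>H\<in>coshort s. X \<inter> H = X - {x}" if "x \<in> X - circ X" for x
    using good_coloops[OF nX _ that s t \<theta>(1)] X by (simp add: uncovered_def)
  then show "core (coshort s) X \<subseteq> circ X" by (auto simp: core_def)
  have "\<exists>H\<in>D.coshort s. (E - X) \<inter> H = E - X - {x}" if "x \<in> E - X - D.circ (E - X)" for x
    using D.good_coloops[OF dual_near(1)[OF nX] _ that s t, of \<theta>] X \<theta>(2) by (simp add: uncovered_def corank_E_eq)
  then have "core (D.coshort s) (E - X) \<subseteq> D.circ (E - X)" by (auto simp: core_def)
  then show "core (D.coshort s) (E - X) \<subseteq> E - cl X" using dual_near(2)[OF nX] by simp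
qed

lemma uncovered_derives:
  assumes X: "X \<in> uncovered s K \<theta> Z" and Y: "Y \<in> near" "circ X \<subseteq> Y \<or> Y \<subseteq> cl X"
    and s: "s = K * (2 * t)" and t: "0 < t"
    and \<theta>: "\<theta> \<le> (rk E - 1) * (t choose 2)" "\<theta> \<le> (card E - rk E - 1) * (t choose 2)"
  shows "derives E (coshort s) (rank_function.coshort E (corank E rk) s) X Y"
  using uncovered_core[OF X s t \<theta>] Y(2) nearD(1)[OF Y(1)] unfolding derives_def by blast

lemma near_subset_recon:
  assumes dom: "\<And>X. X \<in> uncovered s K \<theta> Z \<Longrightarrow> \<exists>Y\<in>T. \<exists>Y'\<in>rsets E (rk E).
      derives E (coshort s) (rank_function.coshort E (corank E rk) s) Y Y' \<and>
      derives E (coshort s) (rank_function.coshort E (corank E rk) s) Y' X"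
  shows "near \<subseteq> recon E (rk E) (sketch s K \<theta>) (dsketch s K \<theta>) Z T"
proof
  interpret D: rank_function E "corank E rk" by (rule rank_function_corank)
  fix X assume X: "X \<in> near"
  then have Xr: "X \<in> rsets E (rk E)" by (simp add: near_def)
  show "X \<in> recon E (rk E) (sketch s K \<theta>) (dsketch s K \<theta>) Z T"
  proof (cases "X \<in> uncovered s K \<theta> Z")
    case True
    then show ?thesis using dom[OF True] Xr unfolding recon_def fst_sketch D.fst_sketch by blast
  next
    case False
    then show ?thesis using X Xr unfolding recon_def uncovered_def by blast
  qed
qed

lemma basis_exchange:
  assumes B: "B \<in> rsets E (rk E)" "rk B = rk E" and B0: "B0 \<in> rsets E (rk E)" "rk B0 = rk E" and u: "u \<in> B - B0"
  shows "\<exists>v\<in>B0 - B. rk (insert v (B - {u})) = rk E"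
proof (rule ccontr)
  assume n: "\<not> ?thesis"
  have fB: "finite B" "card B = rk E" "finite B0" using B B0 finite_subset_E by (auto simp: rsets_def)
  have r: "rk (B - {u}) = card (B - {u})" by (rule rk_subset_indep[of B]) (use fB B in auto)
  have cu: "Suc (card (B - {u})) = rk E" using fB u card_Suc_Diff1[of B u] by simp
  have "rk (insert v (B - {u})) = rk (B - {u})" if "v \<in> B0" for v
  proof (cases "v \<in> B")
    case True
    then have "insert v (B - {u}) = B - {u}" using u that by blast
    then show ?thesis by simp
  next
    case False
    then have "rk (insert v (B - {u})) \<noteq> rk E" using n that by auto
    then show ?thesis using rk_insert_cases[of v "B - {u}"] r cu by auto
  qed
  then have "rk (B - {u} \<union> B0) = rk (B - {u})" using fB by (intro rk_Un_span) auto
  moreover have "rk B0 \<le> rk (B - {u} \<union> B0)" by (intro rk_mono) auto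
  ultimately show False using r cu B0 by simp
qed

end

text \<open>The graph of bases is connected and no basis is adjacent to a set of rank \<open>r - 2\<close> or less, so
  that one basis together with all sets of rank \<open>r - 1\<close> determines the bases.\<close>

lemma bases_determined:
  assumes R1: "rank_function E rk1" and R2: "rank_function E rk2" and r: "rk1 E = r" "rk2 E = r"
    and near: "rank_function.near E rk2 \<subseteq> R" and non: "R \<subseteq> rank_function.nonbases E rk1"
    and B0: "B0 \<in> rsets E r" "rk1 B0 = r" "rk2 B0 = r"
    and B: "B \<in> rsets E r" "rk1 B = r"
  shows "rk2 B = r"
  using B
proof (induction "card (B - B0)" arbitrary: B rule: less_induct)
  case less
  interpret A: rank_function E rk1 by (rule R1)
  interpret C: rank_function E rk2 by (rule R2)
  have fB: "finite B" "finite B0" "card B = r" "card B0 = r" "B \<subseteq> E" "B0 \<subseteq> E"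
    using less.prems B0 A.finite_subset_E by (auto simp: rsets_def)
  show ?case
  proof (cases "B \<subseteq> B0")
    case True
    then have "B = B0" using fB by (intro card_subset_eq) auto
    then show ?thesis using B0 by simp
  next
    case False
    then obtain u where u: "u \<in> B - B0" by blast
    obtain v where v: "v \<in> B0 - B" "rk1 (insert v (B - {u})) = r"
      using A.basis_exchange[of B B0 u] less.prems B0 u r by auto
    \<comment> \<open>\<open>B'\<close> is closer to \<open>B0\<close> and shares r - 1 elements
      with \<open>B\<close>. So \<open>B\<close> has rank at least r - 1 in the second matroid, and
      rank exactly r - 1 would put it into \<open>R\<close>.\<close>
    define B' where "B' = insert v (B - {u})"
    have cu: "Suc (card (B - {u})) = r" using fB u card_Suc_Diff1[of B u] by simp
    have B'r: "B' \<in> rsets E r" using cu v fB by (auto simp: B'_def rsets_def)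
    have "B' - B0 \<subset> B - B0" using u v by (auto simp: B'_def)
    then have "card (B' - B0) < card (B - B0)" using fB by (intro psubset_card_mono) auto
    then have rB': "rk2 B' = r" using less.hyps B'r v by (simp add: B'_def)
    have fB': "finite B'" "card B' = r" using B'r A.finite_subset_E by (auto simp: rsets_def)
    have "rk2 (B - {u}) = card (B - {u})"
      by (rule C.rk_subset_indep[of B']) (use fB' rB' in \<open>auto simp: B'_def\<close>)
    moreover have "rk2 (B - {u}) \<le> rk2 B" by (intro C.rk_mono) auto
    moreover have "rk2 B \<le> r" using C.rk_mono[of B E] fB r by simp
    ultimately have "rk2 B = r \<or> Suc (rk2 B) = r" using cu by linarith
    moreover have "Suc (rk2 B) \<noteq> r"
    proof
      assume "Suc (rk2 B) = r"
      then have "B \<in> C.near" using less.prems r by (simp add: C.near_def)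
      then have "B \<in> A.nonbases" using near non by blast
      then show False using less.prems r by (simp add: A.nonbases_def)
    qed
    ultimately show ?thesis by simp
  qed
qed

section \<open>Many stable families for one matroid\<close>

context rank_function
begin

text \<open>A certificate for the matroid: if \<open>Z\<close> consists of nonbases, the
  reconstructed family lies between \<open>near\<close> and \<open>nonbases\<close>, which together
  with one basis suffices for \<open>bases_determined\<close>. A matroid with many certificates is
  charged less in the count.\<close>

definition valid where
  "valid s K \<theta> Z T \<longleftrightarrow> T \<subseteq> nonbases \<and> stable_family T \<and>
     near \<subseteq> recon E (rk E) (sketch s K \<theta>) (dsketch s K \<theta>) Z T"

lemma uncovered_near: "uncovered s K \<theta> Z \<subseteq> near"
  by (auto simp: uncovered_def)

lemma uncoveredD: "X \<in> uncovered s K \<theta> Z \<Longrightarrow> X \<in> near"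
  by (simp add: uncovered_def)

lemma finite_near: "finite near"
  using finite_rsets[OF finite_E] by (auto simp: near_def)

lemma finite_nonbases: "finite nonbases"
  using finite_rsets[OF finite_E] by (auto simp: nonbases_def)

lemma finite_valid: "finite {T. valid s K \<theta> Z T}"
  using finite_nonbases by (auto simp: valid_def intro: finite_subset[of _ "Pow nonbases"])

lemma adj_derives:
  assumes Y: "Y \<in> uncovered s K \<theta> Z" and X: "X \<in> near" "adj Y X"
    and s: "s = K * (2 * t)" and t: "0 < t"
    and \<theta>: "\<theta> \<le> (rk E - 1) * (t choose 2)" "\<theta> \<le> (card E - rk E - 1) * (t choose 2)"
  shows "derives E (coshort s) (rank_function.coshort E (corank E rk) s) Y X"
proof -
  obtain u v where uv: "u \<in> Y" "v \<notin> Y" "X = insert v (Y - {u})" using X by (auto simp: adj_def)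
  have "circ Y \<subseteq> X \<or> X \<subseteq> cl Y" by (rule near_adjacent[OF uncoveredD[OF Y] X(1) uv(3,1,2)])
  then show ?thesis by (rule uncovered_derives[OF Y X(1) _ s t \<theta>])
qed

lemma valid_of_dominating:
  assumes T: "T \<subseteq> nonbases" "stable_family T"
    and dom: "\<And>X. X \<in> uncovered s K \<theta> Z \<Longrightarrow> X \<in> T \<or> (\<exists>Y\<in>T \<inter> uncovered s K \<theta> Z. adj Y X)"
    and s: "s = K * (2 * t)" and t: "0 < t"
    and \<theta>: "\<theta> \<le> (rk E - 1) * (t choose 2)" "\<theta> \<le> (card E - rk E - 1) * (t choose 2)"
  shows "valid s K \<theta> Z T"
proof -
  have "near \<subseteq> recon E (rk E) (sketch s K \<theta>) (dsketch s K \<theta>) Z T"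
  proof (rule near_subset_recon)
    fix X assume X: "X \<in> uncovered s K \<theta> Z"
    have Xn: "X \<in> near" and Xr: "X \<in> rsets E (rk E)" using uncoveredD[OF X] by (auto simp: near_def)
    obtain Y where "Y \<in> T" "derives E (coshort s) (rank_function.coshort E (corank E rk) s) Y X"
      using dom[OF X] adj_derives[OF _ Xn _ s t \<theta>, of _ Z] derives_refl by blast
    then show "\<exists>Y\<in>T. \<exists>Y'\<in>rsets E (rk E).
      derives E (coshort s) (rank_function.coshort E (corank E rk) s) Y Y' \<and>
      derives E (coshort s) (rank_function.coshort E (corank E rk) s) Y' X"
      using derives_refl Xr by blast
  qed
  then show ?thesis using T by (simp add: valid_def)
qed

text \<open>A maximal stable family of uncovered sets dominates all of them. \<open>T0\<close> is
  chosen before \<open>C\<close>, so that the same \<open>T0\<close> can be combined with every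
  subset of one free family.\<close>

lemma maximal_stable_valid:
  assumes s: "s = K * (2 * t)" and t: "0 < t"
    and \<theta>: "\<theta> \<le> (rk E - 1) * (t choose 2)" "\<theta> \<le> (card E - rk E - 1) * (t choose 2)"
  shows "\<exists>T0. T0 \<subseteq> uncovered s K \<theta> Z \<and> stable_family T0 \<and>
    (\<forall>C. C \<subseteq> nonbases \<longrightarrow> stable_family C \<longrightarrow> (\<forall>X\<in>T0. \<forall>Y\<in>C. \<not> adj X Y) \<longrightarrow> valid s K \<theta> Z (T0 \<union> C))"
proof -
  have "finite (uncovered s K \<theta> Z)" by (rule finite_subset[OF uncovered_near finite_near])
  moreover have "stable_family {}" by (simp add: stable_family_def)
  ultimately obtain T0 where T0: "T0 \<subseteq> uncovered s K \<theta> Z" "stable_family T0"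
    "\<forall>X\<in>uncovered s K \<theta> Z. X \<in> T0 \<or> (\<exists>Y\<in>T0. adj Y X)"
    using maximal_stable_exists[of "uncovered s K \<theta> Z" "{}"] by blast
  have "valid s K \<theta> Z (T0 \<union> C)" if C: "C \<subseteq> nonbases" "stable_family C" "\<forall>X\<in>T0. \<forall>Y\<in>C. \<not> adj X Y" for C
  proof (rule valid_of_dominating[OF _ _ _ s t \<theta>])
    show "T0 \<union> C \<subseteq> nonbases" using T0 C uncovered_near near_nonbases by blast
    show "stable_family (T0 \<union> C)" using T0(2) C adj_sym unfolding stable_family_def by blast
    show "\<And>X. X \<in> uncovered s K \<theta> Z \<Longrightarrow> X \<in> T0 \<union> C \<or> (\<exists>Y\<in>(T0 \<union> C) \<inter> uncovered s K \<theta> Z. adj Y X)"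
      using T0 by blast
  qed
  then show ?thesis using T0 by blast
qed

end

text \<open>The sum modulo \<open>n\<close> is a proper colouring of the Johnson graph.\<close>

lemma large_stable_subset:
  assumes fin: "finite E" and W: "W \<subseteq> rsets E r" and n: "0 < card E"
  shows "\<exists>C\<subseteq>W. stable_family C \<and> card W \<le> card E * card C"
proof -
  define n where "n = card E"
  obtain h where h: "bij_betw h E {0..<n}" using ex_bij_betw_finite_nat[OF fin] by (auto simp: n_def)
  define cls where "cls i = {X \<in> W. (\<Sum>x\<in>X. h x) mod n = i}" for i
  have fW: "finite W" using W finite_rsets[OF fin] by (rule finite_subset)
  have st: "stable_family (cls i)" for i
  proof (unfold stable_family_def, intro ballI notI)
    fix X Y assume XY: "X \<in> cls i" "Y \<in> cls i" "adj X Y"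
    obtain u v where uv: "u \<in> X" "v \<notin> X" "Y = insert v (X - {u})" using XY by (auto simp: adj_def)
    have XE: "X \<subseteq> E" "Y \<subseteq> E" using XY W by (auto simp: cls_def rsets_def)
    then have fX: "finite X" using fin by (rule_tac finite_subset)
    have "sum h X = h u + sum h (X - {u})" using fX uv by (simp add: sum.remove)
    moreover have "sum h Y = h v + sum h (X - {u})" using fX uv by simp
    moreover have "sum h X mod n = sum h Y mod n" using XY by (simp add: cls_def)
    ultimately have "(h u + sum h (X - {u})) mod n = (h v + sum h (X - {u})) mod n" by simp
    then obtain q1 q2 where "h u + sum h (X - {u}) + n * q1 = h v + sum h (X - {u}) + n * q2"
      unfolding nat_mod_eq_iff by blast
    then have "h u + n * q1 = h v + n * q2" by simp
    then have "h u mod n = h v mod n" unfolding nat_mod_eq_iff by blast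
    moreover have "h ` E = {0..<n}" "u \<in> E" "v \<in> E" using h XE uv by (auto simp: bij_betw_def)
    then have "h u < n" "h v < n" by auto
    ultimately have "h u = h v" by simp
    then have "u = v" using h XE uv by (auto simp: bij_betw_def inj_on_def)
    then show False using uv by simp
  qed
  have "\<exists>i<n. card W \<le> n * card (cls i)"
  proof (rule ccontr)
    assume neg: "\<not> ?thesis"
    have "W = (\<Union>i<n. cls i)" using n by (auto simp: cls_def n_def)
    then have "card W \<le> (\<Sum>i<n. card (cls i))" using card_UN_le[of "{..<n}" cls] by simp
    then have "n * card W \<le> (\<Sum>i<n. n * card (cls i))" by (simp flip: sum_distrib_left)
    also have "\<dots> < (\<Sum>i<n. card W)" using neg n by (intro sum_strict_mono) (auto simp: n_def not_le)
    finally show False by simp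
  qed
  then obtain i where "card W \<le> n * card (cls i)" by blast
  moreover have "cls i \<subseteq> W" by (auto simp: cls_def)
  ultimately show ?thesis using st[of i] unfolding n_def by blast
qed

context rank_function
begin

lemma many_valid_of_free:
  assumes C: "C \<subseteq> nonbases" "stable_family C" "\<forall>X\<in>T0. \<forall>Y\<in>C. \<not> adj X Y" "T0 \<inter> C = {}"
    and T0: "\<forall>C. C \<subseteq> nonbases \<longrightarrow> stable_family C \<longrightarrow> (\<forall>X\<in>T0. \<forall>Y\<in>C. \<not> adj X Y) \<longrightarrow> valid s K \<theta> Z (T0 \<union> C)"
  shows "2 ^ card C \<le> card {T. valid s K \<theta> Z T}"
proof -
  have "inj_on (\<lambda>S. T0 \<union> S) (Pow C)" using C(4) by (intro inj_onI) blast
  moreover have "(\<lambda>S. T0 \<union> S) ` Pow C \<subseteq> {T. valid s K \<theta> Z T}"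
  proof (intro image_subsetI CollectI)
    fix S assume "S \<in> Pow C"
    then have "S \<subseteq> nonbases" "stable_family S" "\<forall>X\<in>T0. \<forall>Y\<in>S. \<not> adj X Y" using C stable_subset[OF C(2)] by auto
    then show "valid s K \<theta> Z (T0 \<union> S)" using T0 by simp
  qed
  ultimately have "card (Pow C) \<le> card {T. valid s K \<theta> Z T}" using finite_valid by (rule card_inj_on_le)
  moreover have "finite C" using C(1) finite_nonbases by (rule finite_subset)
  ultimately show ?thesis by (simp add: card_Pow)
qed

text \<open>\<open>T0\<close> avoids \<open>Z\<close>, hence all neighbours of \<open>W\<close> of
  rank r - 1. So every stable part of \<open>W\<close> is free, and some colour class contains at
  least \<open>g\<close> members of \<open>W\<close>.\<close>

lemma many_valid_interior:
  assumes E: "card E = n" "0 < n"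
    and Z: "Z \<subseteq> nonbases" and W: "W \<subseteq> Z" "\<And>X Y. X \<in> W \<Longrightarrow> Y \<in> near \<Longrightarrow> adj Y X \<Longrightarrow> Y \<in> Z" and g: "n * g \<le> card W"
    and s: "s = K * (2 * t)" and t: "0 < t"
    and \<theta>: "\<theta> \<le> (rk E - 1) * (t choose 2)" "\<theta> \<le> (card E - rk E - 1) * (t choose 2)"
  shows "2 ^ g \<le> card {T. valid s K \<theta> Z T}"
proof -
  obtain T0 where T0: "T0 \<subseteq> uncovered s K \<theta> Z"
    "\<forall>C. C \<subseteq> nonbases \<longrightarrow> stable_family C \<longrightarrow> (\<forall>X\<in>T0. \<forall>Y\<in>C. \<not> adj X Y) \<longrightarrow> valid s K \<theta> Z (T0 \<union> C)"
    using maximal_stable_valid[OF s t \<theta>, of Z] by (elim exE conjE) (rule that)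
  have "W \<subseteq> rsets E (rk E)" using W Z by (auto simp: nonbases_def)
  then obtain C where C: "C \<subseteq> W" "stable_family C" "card W \<le> n * card C" using large_stable_subset[OF finite_E] E by blast
  have "2 ^ card C \<le> card {T. valid s K \<theta> Z T}"
  proof (rule many_valid_of_free[OF _ C(2) _ _ T0(2)])
    show "C \<subseteq> nonbases" using C W Z by blast
    show "\<forall>X\<in>T0. \<forall>Y\<in>C. \<not> adj X Y" using W(2) C(1) T0(1) by (auto simp: uncovered_def)
    show "T0 \<inter> C = {}" using C(1) W(1) T0(1) by (auto simp: uncovered_def)
  qed
  moreover have "g \<le> card C" using g C(3) E(2) by (metis le_trans nat_mult_le_cancel1)
  ultimately show ?thesis by (meson le_trans one_le_numeral power_increasing)
qed

section \<open>Gain from a short cocircuit\<close>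

lemma dcoshort_circuit:
  assumes A: "A \<in> rank_function.coshort E (corank E rk) s" and f: "f \<in> E - A"
  shows "rk (insert f (E - A - {f})) = rk (E - A - {f})"
proof -
  interpret D: rank_function E "corank E rk" by (rule rank_function_corank)
  have h: "A \<subseteq> E" "Suc (corank E rk A) = corank E rk E" "corank E rk (insert f A) = corank E rk E"
    using A f by (auto simp: D.coshort_def)
  have fA: "finite A" using h(1) by (rule finite_subset_E)
  have "insert f (E - A - {f}) = E - A" using f by auto
  moreover have "corank E rk A + rk E = card A + rk (E - A)"
    using corank_add[of A] h by (simp add: Int_absorb1)
  moreover have "corank E rk (insert f A) + rk E = card (insert f A) + rk (E - A - {f})"
  proof -
    have "E \<inter> insert f A = insert f A" "E - insert f A = E - A - {f}" using h f by auto
    then show ?thesis using corank_add[of "insert f A"] by simp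
  qed
  moreover have "card (insert f A) = Suc (card A)" using f fA by simp
  ultimately show ?thesis using h by simp
qed

text \<open>An element off the hyperplane \<open>H\<close> raises the rank of every subset of
  \<open>H\<close>. So \<open>f\<close> can replace the single element of \<open>X0\<close> off
  \<open>H\<close>, is a coloop of the new set, and is deleted from its core because
  \<open>H\<close> isolates it.\<close>

lemma uncovered_hyperplane_trace:
  assumes H: "H \<in> coshort s" and X0: "X0 \<in> near" "Suc (card (X0 \<inter> H)) = rk E" and f: "f \<in> E - H"
  shows "insert f (X0 \<inter> H) \<in> near" "f \<notin> circ (insert f (X0 \<inter> H))"
    "core (coshort s) (insert f (X0 \<inter> H)) \<subseteq> X0 \<inter> H" "rk (insert f (X0 \<inter> H)) \<noteq> rk (X0 \<inter> H)"
    "\<exists>e\<in>E - H. X0 = insert e (X0 \<inter> H)"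
proof -
  define C where "C = X0 \<inter> H"
  note nX = nearD[OF X0(1)]
  have H': "H \<subseteq> E" "Suc (rk H) = rk E" "\<And>e. e \<in> E - H \<Longrightarrow> rk (insert e H) = rk E"
    using H by (auto simp: coshort_def)
  have fC: "finite C" "C \<subseteq> E" "C \<subseteq> H" using nX by (auto simp: C_def)
  have off: "rk (insert e C) = Suc (rk C)" if "e \<in> E - H" for e
  proof -
    have "rk (insert e C) \<noteq> rk C"
    proof
      assume "rk (insert e C) = rk C"
      then have "rk (insert e H) = rk H" by (rule rk_insert_span_mono) (use fC in auto)
      then show False using H'(2) H'(3)[OF that] by simp
    qed
    then show ?thesis using rk_insert_cases[of e C] by simp
  qed
  have "card (X0 - H) = 1"
    using card_Diff_subset_Int[of X0 H] nX X0(2) fC by (simp add: C_def)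
  then obtain e where e: "X0 - H = {e}" using card_1_singletonE by blast
  then have X0e: "X0 = insert e C" "e \<in> E - H" using nX by (auto simp: C_def)
  then show "\<exists>e\<in>E - H. X0 = insert e (X0 \<inter> H)" by (auto simp: C_def)
  have rC: "Suc (Suc (rk C)) = rk E" using off[OF X0e(2)] X0e(1) nX by simp
  have fnC: "f \<notin> C" using f fC by auto
  have "card (insert f C) = rk E" using fnC fC X0(2) by (simp add: C_def)
  then show "insert f (X0 \<inter> H) \<in> near"
    using off[OF f] rC f fC by (auto simp: near_def rsets_def C_def)
  have "rk (insert f C - {f}) \<noteq> rk (insert f C)" using off[OF f] fnC by simp
  then show "f \<notin> circ (insert f (X0 \<inter> H))" by (auto simp: circ_def C_def)
  show "rk (insert f (X0 \<inter> H)) \<noteq> rk (X0 \<inter> H)" using off[OF f] by (simp add: C_def)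
  have "insert f C \<inter> H = insert f C - {f}" using f fC fnC by auto
  then show "core (coshort s) (insert f (X0 \<inter> H)) \<subseteq> X0 \<inter> H"
    using H by (auto simp: core_def C_def)
qed

text \<open>A set \<open>X0\<close> of the uncovered family that meets the hyperplane \<open>H\<close> in all but one element may be
  replaced by \<open>insert f (X0 \<inter> H)\<close> for any \<open>f\<close> outside \<open>H\<close>: everything that is dominated by the new set
  can still be derived in two steps.\<close>

lemma trace_derives:
  assumes H: "H \<in> coshort s" and X0: "X0 \<in> uncovered s K \<theta> Z" "Suc (card (X0 \<inter> H)) = rk E" and f: "f \<in> E - H"
    and X: "X \<in> uncovered s K \<theta> Z" "adj (insert f (X0 \<inter> H)) X"
    and s: "s = K * (2 * t)" and t: "0 < t"
    and \<theta>: "\<theta> \<le> (rk E - 1) * (t choose 2)" "\<theta> \<le> (card E - rk E - 1) * (t choose 2)"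
  shows "\<exists>Y'\<in>rsets E (rk E).
      derives E (coshort s) (rank_function.coshort E (corank E rk) s) (insert f (X0 \<inter> H)) Y' \<and>
      derives E (coshort s) (rank_function.coshort E (corank E rk) s) Y' X"
proof -
  interpret D: rank_function E "corank E rk" by (rule rank_function_corank)
  define Y where "Y = insert f (X0 \<inter> H)"
  have X0n: "X0 \<in> near" and Xn: "X \<in> near" using uncoveredD[OF X0(1)] uncoveredD[OF X(1)] .
  note tr = uncovered_hyperplane_trace[OF H X0n X0(2) f, folded Y_def]
  obtain u v where uv: "u \<in> Y" "v \<notin> Y" "X = insert v (Y - {u})" using X by (auto simp: adj_def Y_def)
  have X0r: "X0 \<in> rsets E (rk E)" and Xr: "X \<in> rsets E (rk E)" using X0n Xn by (auto simp: near_def)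
  show ?thesis unfolding Y_def[symmetric]
  proof (cases "circ Y \<subseteq> X")
    case True
    \<comment> \<open>The circuit avoids the coloop \<open>f\<close>, so it is the circuit of
      \<open>X0\<close> too. The detour from \<open>Y\<close> over \<open>X0\<close> to
      \<open>X\<close> uses that the core of the uncovered set \<open>X0\<close> is known.\<close>
    have "circ Y \<subseteq> X0" using tr(2) circ_subset[of Y] by (auto simp: Y_def)
    then have "circ X0 = circ Y" using circ_unique[OF tr(1) X0n] by simp
    then have "derives E (coshort s) (D.coshort s) X0 X"
      using uncovered_derives[OF X0(1) Xn _ s t \<theta>] True by simp
    moreover have "derives E (coshort s) (D.coshort s) Y X0" using tr(3) by (auto simp: derives_def)
    ultimately show "\<exists>Y'\<in>rsets E (rk E). derives E (coshort s) (D.coshort s) Y Y' \<and> derives E (coshort s) (D.coshort s) Y' X"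
      using X0r by blast
  next
    case False
    then have Xcl: "X \<subseteq> cl Y" using near_adjacent[OF tr(1) Xn uv(3,1,2)] by simp
    note nY = nearD[OF tr(1)] and nX = nearD[OF Xn]
    have "cl X = cl (cl Y)" using Xcl nX nY rk_cl[OF nY(1)] cl_subset_E by (intro cl_eqI) auto
    also have "\<dots> = cl Y" using nY subset_cl[OF nY(1)] rk_cl[OF nY(1)] cl_subset_E by (intro cl_eqI[symmetric]) auto
    finally have clXY: "cl X = cl Y" .
    \<comment> \<open>\<open>u\<close> lies in \<open>cl X\<close> but not in \<open>X\<close>, so
      it is a coloop of \<open>E - X\<close> in the dual; as \<open>X\<close> is uncovered, a short
      dual hyperplane \<open>A\<close> isolates it.\<close>
    have "u \<in> E - X" using uv nY by auto
    moreover have "u \<notin> E - cl X" using clXY subset_cl[OF nY(1)] uv by auto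
    ultimately have "u \<notin> core (D.coshort s) (E - X)" "u \<in> E - X"
      using uncovered_core(2)[OF X(1) s t \<theta>] by auto
    then obtain A where A: "A \<in> D.coshort s" "(E - X) \<inter> A = E - X - {u}"
      by (auto simp: core_def)
    have AE: "A \<subseteq> E" using A by (auto simp: D.coshort_def)
    show "\<exists>Y'\<in>rsets E (rk E). derives E (coshort s) (D.coshort s) Y Y' \<and> derives E (coshort s) (D.coshort s) Y' X"
    proof (cases "v \<in> A")
      case True
      \<comment> \<open>\<open>E - A\<close> is a circuit inside \<open>Y\<close>. It avoids the
        coloop \<open>f\<close>, so it would lie in \<open>X0\<close> and the dual sketch would
        cover \<open>X0\<close>.\<close>
      then have sub: "E - A \<subseteq> Y" using A(2) uv nY by auto
      have "f \<notin> E - A"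
      proof
        assume fA: "f \<in> E - A"
        have "rk (insert f (E - A - {f})) = rk (E - A - {f})" by (rule dcoshort_circuit[OF A(1) fA])
        then have "rk (insert f (X0 \<inter> H)) = rk (X0 \<inter> H)"
          by (rule rk_insert_span_mono) (use sub in \<open>auto simp: Y_def\<close>)
        then show False using tr(4) by (simp add: Y_def)
      qed
      then have "E - X0 \<subseteq> A" using sub by (auto simp: Y_def)
      then have "covered (card E - rk E) (dsketch s K \<theta>) (E - X0)"
        using A(1) unfolding covered_def D.sketch_def by auto
      then show ?thesis using X0(1) by (simp add: uncovered_def)
    next
      case vA: False
      have "v \<in> E" using uv nX by auto
      \<comment> \<open>Now \<open>A\<close> isolates \<open>v\<close> in \<open>E - Y\<close>. The
        dual core of \<open>E - Y\<close> loses \<open>v\<close>, and a single step leads from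
        \<open>Y\<close> to \<open>X\<close>.\<close>
      have "(E - Y) \<inter> A = E - Y - {v}" using A(2) uv vA nY by auto
      then have "core (D.coshort s) (E - Y) \<subseteq> E - Y - {v}" using A(1) by (auto simp: core_def)
      then have "core (D.coshort s) (E - Y) \<subseteq> E - X" using uv by auto
      then have "derives E (coshort s) (D.coshort s) Y X" by (simp add: derives_def)
      then show ?thesis using derives_refl Xr by blast
    qed
  qed
qed

text \<open>Dichotomy on \<open>D\<close>, the traces on \<open>H\<close> of uncovered sets with one
  element off \<open>H\<close>. A stable family of \<open>g\<close> traces gives 2^g certificates,
  since each trace can be completed by at least two elements of \<open>E - H\<close>. If there is
  none, few members of \<open>T0\<close> are adjacent to r-subsets of \<open>H\<close>, and many of
  these are free.\<close>

lemma many_valid_hyperplane: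
  assumes E: "card E = n" "0 < n"
    and H: "H \<in> coshort s" and q: "2 \<le> card (E - H)"
    and g: "2 * n * card (E - H) * g \<le> (n - card (E - H)) choose rk E"
    and s: "s = K * (2 * t)" and t: "0 < t"
    and \<theta>: "\<theta> \<le> (rk E - 1) * (t choose 2)" "\<theta> \<le> (card E - rk E - 1) * (t choose 2)"
  shows "2 ^ g \<le> card {T. valid s K \<theta> {} T}"
proof -
  define U where "U = uncovered s K \<theta> {}"
  define D where "D = (\<lambda>X. X \<inter> H) ` {X \<in> U. Suc (card (X \<inter> H)) = rk E}"
  have finU: "finite U" unfolding U_def by (rule finite_subset[OF uncovered_near finite_near])
  then have finD: "finite D" by (simp add: D_def)
  have H': "H \<subseteq> E" "Suc (rk H) = rk E" using H by (auto simp: coshort_def)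
  show ?thesis
  proof (cases "\<exists>D'\<subseteq>D. stable_family D' \<and> g \<le> card D'")
    case True
    then obtain D' where D': "D' \<subseteq> D" "stable_family D'" "g \<le> card D'" by blast
    have finD': "finite D'" using D'(1) finD by (rule finite_subset)
    \<comment> \<open>\<open>\<phi>\<close> selects the element off \<open>H\<close> that completes
      each trace. Two completions of the same trace are adjacent, so no stable family contains both,
      and families extending \<open>S \<phi>\<close> for different \<open>\<phi>\<close> are
      different.\<close>
    define S where "S \<phi> = (\<lambda>C. insert (\<phi> C) C) ` D'" for \<phi> :: "'a set \<Rightarrow> 'a"
    define \<Phi> where "\<Phi> = (PiE D' (\<lambda>_. E - H))"
    have fromD: "\<exists>X0\<in>U. Suc (card (X0 \<inter> H)) = rk E \<and> C = X0 \<inter> H" if "C \<in> D" for C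
      using that by (auto simp: D_def)
    have ex: "\<exists>T. valid s K \<theta> {} T \<and> S \<phi> \<subseteq> T" if \<phi>: "\<phi> \<in> \<Phi>" for \<phi>
    proof -
      have \<phi>C: "\<phi> C \<in> E - H" if "C \<in> D'" for C using \<phi> that by (auto simp: \<Phi>_def)
      have CH: "C \<subseteq> H" if "C \<in> D'" for C using that D' fromD by blast
      have Snear: "S \<phi> \<subseteq> near"
      proof
        fix Y assume "Y \<in> S \<phi>"
        then obtain C where C: "C \<in> D'" "Y = insert (\<phi> C) C" by (auto simp: S_def)
        then obtain X0 where X0: "X0 \<in> U" "Suc (card (X0 \<inter> H)) = rk E" "C = X0 \<inter> H" using fromD D' by blast
        show "Y \<in> near"
          using uncovered_hyperplane_trace(1)[OF H _ X0(2) \<phi>C[OF C(1)]] X0 C uncoveredD by (simp add: U_def)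
      qed
      have stS: "stable_family (S \<phi>)"
      proof (unfold stable_family_def, intro ballI notI)
        fix Y Y' assume YY': "Y \<in> S \<phi>" "Y' \<in> S \<phi>" "adj Y Y'"
        then obtain C C' where C: "C \<in> D'" "Y = insert (\<phi> C) C" "C' \<in> D'" "Y' = insert (\<phi> C') C'" by (auto simp: S_def)
        obtain u v where uv: "u \<in> Y" "v \<notin> Y" "Y' = insert v (Y - {u})" using YY' by (auto simp: adj_def)
        have a: "\<phi> C \<notin> H" "\<phi> C' \<notin> H" "C \<subseteq> H" "C' \<subseteq> H" using \<phi>C[OF C(1)] \<phi>C[OF C(3)] CH C by auto
        have "C \<noteq> C'" using uv C by auto
        have CY: "C = Y \<inter> H" "C' = Y' \<inter> H" using C a by auto
        \<comment> \<open>Each of the two sets has exactly one element off \<open>H\<close>. Either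
          the exchange takes place inside \<open>H\<close> and the traces are adjacent, or it swaps
          these two elements and the traces coincide.\<close>
        have "adj C C'"
        proof (cases "u \<in> H \<and> v \<in> H")
          case True
          then have "u \<in> C" "v \<notin> C" "C' = insert v (C - {u})" using CY uv by auto
          then show ?thesis by (auto simp: adj_def)
        next
          case False
          have Y1: "Y - H = {\<phi> C}" and Y2: "Y' - H = {\<phi> C'}" using C a by auto
          have "u \<notin> H"
          proof
            assume "u \<in> H"
            then have "v \<notin> H" using False by simp
            then have "v \<in> Y' - H" "\<phi> C \<in> Y' - H" using uv Y1 \<open>u \<in> H\<close> by auto
            then have "v = \<phi> C" using Y2 by simp
            then show False using uv Y1 by blast
          qed
          moreover have "v \<notin> H"
          proof
            assume "v \<in> H"
            have "u \<in> Y - H" using uv calculation by simp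
            then have "u = \<phi> C" using Y1 by simp
            then have "Y' - H = {}" using uv Y1 \<open>v \<in> H\<close> by blast
            then show False using Y2 by simp
          qed
          ultimately have "C = C'" using CY uv(3) by auto
          then show ?thesis using \<open>C \<noteq> C'\<close> by simp
        qed
        then show False using D'(2) C by (auto simp: stable_family_def)
      qed
      have "finite (U \<union> S \<phi>)" using finU finD' by (simp add: S_def)
      from maximal_stable_exists[OF this _ stS] obtain T where T: "S \<phi> \<subseteq> T" "T \<subseteq> U \<union> S \<phi>" "stable_family T"
        "\<forall>X\<in>U \<union> S \<phi>. X \<in> T \<or> (\<exists>Y\<in>T. adj Y X)" by auto
      have "near \<subseteq> recon E (rk E) (sketch s K \<theta>) (dsketch s K \<theta>) {} T"
      proof (rule near_subset_recon)
        fix X assume X: "X \<in> uncovered s K \<theta> {}"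
        have Xn: "X \<in> near" and Xr: "X \<in> rsets E (rk E)" using uncoveredD[OF X] by (auto simp: near_def)
        consider "X \<in> T" | Y where "Y \<in> T" "adj Y X" "Y \<in> U" | Y where "Y \<in> T" "adj Y X" "Y \<in> S \<phi>"
          using T X unfolding U_def by blast
        then show "\<exists>Y\<in>T. \<exists>Y'\<in>rsets E (rk E).
          derives E (coshort s) (rank_function.coshort E (corank E rk) s) Y Y' \<and>
          derives E (coshort s) (rank_function.coshort E (corank E rk) s) Y' X"
        proof cases
          case 1 then show ?thesis using derives_refl Xr by blast
        next
          case 2 then show ?thesis using adj_derives[OF _ Xn _ s t \<theta>] derives_refl Xr unfolding U_def by blast
        next
          case 3
          then obtain C where C: "C \<in> D'" "Y = insert (\<phi> C) C" by (auto simp: S_def)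
          then obtain X0 where X0: "X0 \<in> U" "Suc (card (X0 \<inter> H)) = rk E" "C = X0 \<inter> H" using fromD D' by blast
          show ?thesis
            using trace_derives[OF H X0(1)[unfolded U_def] X0(2) \<phi>C[OF C(1)] X _ s t \<theta>] 3 C X0 by auto
        qed
      qed
      moreover have "T \<subseteq> nonbases" using T(2) Snear uncovered_near near_nonbases unfolding U_def by blast
      ultimately show ?thesis using T by (auto simp: valid_def)
    qed
    define F where "F \<phi> = (SOME T. valid s K \<theta> {} T \<and> S \<phi> \<subseteq> T)" for \<phi>
    have F: "valid s K \<theta> {} (F \<phi>)" "S \<phi> \<subseteq> F \<phi>" if "\<phi> \<in> \<Phi>" for \<phi>
      using someI_ex[OF ex[OF that]] unfolding F_def by auto
    have "inj_on F \<Phi>"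
    proof (rule inj_onI)
      fix \<phi> \<psi> assume pp: "\<phi> \<in> \<Phi>" "\<psi> \<in> \<Phi>" "F \<phi> = F \<psi>"
      have "\<phi> C = \<psi> C" if C: "C \<in> D'" for C
      proof (rule ccontr)
        assume ne: "\<phi> C \<noteq> \<psi> C"
        have "\<phi> C \<notin> H" "\<psi> C \<notin> H" using pp C by (auto simp: \<Phi>_def)
        moreover have "C \<subseteq> H" using C D' fromD by blast
        ultimately have "adj (insert (\<phi> C) C) (insert (\<psi> C) C)"
          unfolding adj_def using ne by (intro exI[of _ "\<phi> C"] exI[of _ "\<psi> C"]) auto
        moreover have "insert (\<phi> C) C \<in> F \<phi>" "insert (\<psi> C) C \<in> F \<phi>"
          using F(2)[OF pp(1)] F(2)[OF pp(2)] pp(3) C by (auto simp: S_def)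
        ultimately show False using F(1)[OF pp(1)] by (auto simp: valid_def stable_family_def)
      qed
      then show "\<phi> = \<psi>" using pp(1,2) by (auto simp: \<Phi>_def intro: PiE_ext)
    qed
    moreover have "F ` \<Phi> \<subseteq> {T. valid s K \<theta> {} T}" using F(1) by auto
    ultimately have "card \<Phi> \<le> card {T. valid s K \<theta> {} T}" using finite_valid by (rule card_inj_on_le)
    moreover have "card \<Phi> = card (E - H) ^ card D'" using finD' by (simp add: \<Phi>_def card_PiE)
    moreover have "2 ^ g \<le> card (E - H) ^ card D'"
      using order_trans[OF power_increasing[OF D'(3), of "2::nat"] power_mono[OF q, of "card D'"]] by simp
    ultimately show ?thesis by linarith
  next
    case False
    then have small: "card D' < g" if "D' \<subseteq> D" "stable_family D'" for D' using that not_less by blast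
    obtain T0 where T0: "T0 \<subseteq> U" "stable_family T0"
      "\<forall>C. C \<subseteq> nonbases \<longrightarrow> stable_family C \<longrightarrow> (\<forall>X\<in>T0. \<forall>Y\<in>C. \<not> adj X Y) \<longrightarrow> valid s K \<theta> {} (T0 \<union> C)"
      using maximal_stable_valid[OF s t \<theta>, of "{}", folded U_def] by (elim exE conjE) (rule that)
    define V where "V = {X \<in> rsets E (rk E). X \<subseteq> H}"
    \<comment> \<open>Only members of \<open>T1\<close> can be adjacent to an r-subset of
      \<open>H\<close>. Removing all their neighbours from \<open>V\<close> leaves the free sets
      \<open>W\<close>.\<close>
    define T1 where "T1 = {X \<in> T0. Suc (card (X \<inter> H)) = rk E}"
    define W where "W = V - (\<Union>X\<in>T1. (\<lambda>p. insert p (X \<inter> H)) ` E)"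
    have "T1 \<subseteq> U" using T0 by (auto simp: T1_def)
    then have finT1: "finite T1" using finU by (rule finite_subset)
    have Ur: "U \<subseteq> near" using uncovered_near by (simp add: U_def)
    have UH: "\<not> X \<subseteq> H" if "X \<in> U" for X
      using that H unfolding U_def uncovered_def covered_def sketch_def by auto
    have Hfin: "finite H" using H' finite_subset_E by simp
    have cV: "card V = (n - card (E - H)) choose rk E"
    proof -
      have "V = {X. X \<subseteq> H \<and> card X = rk E}" using H' by (auto simp: V_def rsets_def)
      moreover have "card H = n - card (E - H)"
        using H' E card_Diff_subset[OF Hfin H'(1)] card_mono[OF finite_E H'(1)] by simp
      ultimately show ?thesis using Hfin by (simp add: n_subsets)
    qed
    have cT1: "card T1 \<le> card (E - H) * g"
    proof -
      \<comment> \<open>Sets sharing the element \<open>e\<close> off \<open>H\<close> are adjacent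
        if their traces are. So these traces form a stable subfamily of \<open>D\<close>, which has
        fewer than \<open>g\<close> members.\<close>
      have each: "card {X \<in> T1. X - H = {e}} \<le> g" for e
      proof -
        have inj: "inj_on (\<lambda>X. X \<inter> H) {X \<in> T1. X - H = {e}}" by (intro inj_onI) blast
        have "stable_family ((\<lambda>X. X \<inter> H) ` {X \<in> T1. X - H = {e}})"
        proof (unfold stable_family_def, intro ballI notI)
          fix C C' assume CC': "C \<in> (\<lambda>X. X \<inter> H) ` {X \<in> T1. X - H = {e}}"
            "C' \<in> (\<lambda>X. X \<inter> H) ` {X \<in> T1. X - H = {e}}" "adj C C'"
          then obtain X X' where XX': "X \<in> T1" "X' \<in> T1" "X - H = {e}" "X' - H = {e}" "C = X \<inter> H" "C' = X' \<inter> H" by blast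
          obtain u v where uv: "u \<in> C" "v \<notin> C" "C' = insert v (C - {u})" using CC' by (auto simp: adj_def)
          have "u \<in> X" "v \<notin> X" "X' = insert v (X - {u})" using uv XX' by blast+
          then have "adj X X'" by (auto simp: adj_def)
          then show False using XX' T0(2) by (auto simp: stable_family_def T1_def)
        qed
        moreover have "(\<lambda>X. X \<inter> H) ` {X \<in> T1. X - H = {e}} \<subseteq> D" using T0(1) by (auto simp: D_def T1_def)
        ultimately have "card ((\<lambda>X. X \<inter> H) ` {X \<in> T1. X - H = {e}}) < g" by (intro small)
        then show ?thesis using card_image[OF inj] by simp
      qed
      have "T1 \<subseteq> (\<Union>e\<in>E - H. {X \<in> T1. X - H = {e}})"
      proof
        fix X assume X: "X \<in> T1"
        then have nX: "X \<in> near" "Suc (card (X \<inter> H)) = rk E" using T0 Ur by (auto simp: T1_def)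
        have "E - H \<noteq> {}" using q by (metis card.empty not_numeral_le_zero)
        then obtain f where "f \<in> E - H" by blast
        then obtain e where "e \<in> E - H" "X = insert e (X \<inter> H)" using uncovered_hyperplane_trace(5)[OF H nX] by blast
        then have "e \<in> E - H" "X - H = {e}" by auto
        then show "X \<in> (\<Union>e\<in>E - H. {X \<in> T1. X - H = {e}})" using X by blast
      qed
      then have "card T1 \<le> card (\<Union>e\<in>E - H. {X \<in> T1. X - H = {e}})"
        using finT1 finite_E by (intro card_mono) auto
      also have "\<dots> \<le> (\<Sum>e\<in>E - H. card {X \<in> T1. X - H = {e}})" using finite_E by (intro card_UN_le) auto
      also have "\<dots> \<le> (\<Sum>e\<in>E - H. g)" by (intro sum_mono each)
      finally show ?thesis by simp
    qed
    have "card (\<Union>X\<in>T1. (\<lambda>p. insert p (X \<inter> H)) ` E) \<le> (\<Sum>X\<in>T1. card ((\<lambda>p. insert p (X \<inter> H)) ` E))"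
      using finT1 by (rule card_UN_le)
    also have "\<dots> \<le> (\<Sum>X\<in>T1. n)" using card_image_le[OF finite_E] E by (intro sum_mono) auto
    also have "\<dots> \<le> n * (card (E - H) * g)" using cT1 by (simp add: mult.commute)
    finally have cN: "card (\<Union>X\<in>T1. (\<lambda>p. insert p (X \<inter> H)) ` E) \<le> n * (card (E - H) * g)" .
    have "card V - card (\<Union>X\<in>T1. (\<lambda>p. insert p (X \<inter> H)) ` E) \<le> card W"
      unfolding W_def using finT1 finite_E by (intro diff_card_le_card_Diff) auto
    \<comment> \<open>Half of \<open>V\<close> may be lost to neighbours of \<open>T1\<close>; this
      is the factor 2 in the hypothesis on \<open>g\<close>.\<close>
    then have cW: "n * (card (E - H) * g) \<le> card W" using cN g cV by simp
    have WV: "W \<subseteq> V" "V \<subseteq> nonbases"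
    proof -
      show "W \<subseteq> V" by (auto simp: W_def)
      show "V \<subseteq> nonbases"
      proof
        fix X assume "X \<in> V"
        then show "X \<in> nonbases" using rk_mono[of X H] H' by (auto simp: V_def nonbases_def)
      qed
    qed
    have "W \<subseteq> rsets E (rk E)" using WV by (auto simp: V_def)
    then obtain C where C: "C \<subseteq> W" "stable_family C" "card W \<le> n * card C" using large_stable_subset[OF finite_E] E by blast
    have "2 ^ card C \<le> card {T. valid s K \<theta> {} T}"
    proof (rule many_valid_of_free[OF _ C(2) _ _ T0(3)])
      show "C \<subseteq> nonbases" using C WV by blast
      have "\<forall>X\<in>C. X \<subseteq> H" using C(1) WV(1) by (auto simp: V_def)
      then show "T0 \<inter> C = {}" using UH T0(1) by blast
      show "\<forall>X\<in>T0. \<forall>Y\<in>C. \<not> adj X Y"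
      proof (intro ballI notI)
        fix X Y assume X: "X \<in> T0" and Y: "Y \<in> C" and a: "adj X Y"
        have YH: "Y \<subseteq> H" "card Y = rk E" "Y \<in> W" using Y C WV by (auto simp: V_def rsets_def)
        obtain u v where uv: "u \<in> X" "v \<notin> X" "Y = insert v (X - {u})" using a by (auto simp: adj_def)
        have nX: "X \<subseteq> E" "finite X" "card X = rk E" using X T0(1) Ur nearD by blast+
        have "u \<notin> H" using uv YH UH X T0(1) by blast
        then have XH: "X \<inter> H = X - {u}" using uv YH by auto
        then have "Suc (card (X \<inter> H)) = rk E" using nX uv card_Suc_Diff1[of X u] by simp
        then have "X \<in> T1" using X by (simp add: T1_def)
        moreover have "Y = insert v (X \<inter> H)" "v \<in> E" using uv XH YH H' by auto
        ultimately show False using YH(3) by (auto simp: W_def)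
      qed
    qed
    moreover have "g \<le> card C"
    proof -
      have "n * g \<le> n * (card (E - H) * g)" using q by simp
      then have "n * g \<le> n * card C" using cW C(3) by linarith
      then show ?thesis using E(2) by simp
    qed
    ultimately show ?thesis by (meson le_trans one_le_numeral power_increasing)
  qed
qed

end

section \<open>Duality and counting\<close>

definition dual_matroid :: "'a set \<Rightarrow> 'a set set \<Rightarrow> 'a set set" where
  "dual_matroid E I = indeps E (corank E (matroid_rank I))"

lemma
  assumes "matroid E I"
  shows matroid_dual: "matroid E (dual_matroid E I)"
    and rank_dual: "A \<subseteq> E \<Longrightarrow> matroid_rank (dual_matroid E I) A = corank E (matroid_rank I) A"
    and rank_dual_E: "matroid_rank (dual_matroid E I) E + matroid_rank I E = card E"
    and dual_dual: "dual_matroid E (dual_matroid E I) = I"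
proof -
  interpret matroid E I by (rule assms)
  interpret R: rank_function E "matroid_rank I" by (rule rank_function_matroid_rank)
  interpret D: rank_function E "corank E (matroid_rank I)" by (rule R.rank_function_corank)
  show m: "matroid E (dual_matroid E I)" unfolding dual_matroid_def by (rule D.matroid_indeps)
  show r: "matroid_rank (dual_matroid E I) A = corank E (matroid_rank I) A" if "A \<subseteq> E" for A
    unfolding dual_matroid_def using that by (rule D.matroid_rank_indeps)
  show "matroid_rank (dual_matroid E I) E + matroid_rank I E = card E"
    using r[of E] R.corank_E by simp
  interpret M: matroid E "dual_matroid E I" by (rule m)
  interpret MR: rank_function E "matroid_rank (dual_matroid E I)" by (rule M.rank_function_matroid_rank)
  have "corank E (matroid_rank (dual_matroid E I)) X = matroid_rank I X" if X: "X \<subseteq> E" for X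
  proof -
    have "corank E (matroid_rank (dual_matroid E I)) X = corank E (corank E (matroid_rank I)) X"
      unfolding corank_def[of E "matroid_rank (dual_matroid E I)"] corank_def[of E "corank E (matroid_rank I)"]
      using r by simp
    then show ?thesis using R.corank_corank[OF X] by simp
  qed
  then show "dual_matroid E (dual_matroid E I) = I"
    unfolding dual_matroid_def[of E "dual_matroid E I"] indeps_def
    using indep_iff_rank by auto
qed

lemma bij_betw_dual: "bij_betw (dual_matroid E) {I. matroid E I \<and> P I} {J. matroid E J \<and> P (dual_matroid E J)}"
  by (rule bij_betwI[where g = "dual_matroid E"]) (auto simp: matroid_dual dual_dual)

lemma finite_matroids: "finite E \<Longrightarrow> finite {I. matroid E I}"
  by (rule finite_subset[of _ "Pow (Pow E)"]) (auto dest: matroid.indep_subset_ground)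

lemma card_dual_class: "card {I. matroid E I \<and> P (dual_matroid E I)} = card {I. matroid E I \<and> P I}"
proof -
  have "card {I. matroid E I \<and> P I} = card {J. matroid E J \<and> P (dual_matroid E J)}"
    by (rule bij_betw_same_card[OF bij_betw_dual])
  then show ?thesis by simp
qed

section \<open>Recovery from bases, and sparse paving matroids\<close>

lemma matroid_eq_of_bases:
  assumes "matroid E I" "matroid E J" "matroid_rank I E = r" "matroid_rank J E = r"
    and "\<And>B. B \<in> rsets E r \<Longrightarrow> matroid_rank I B = r \<Longrightarrow> matroid_rank J B = r"
  shows "I \<subseteq> J"
proof
  interpret A: matroid E I by (rule assms)
  interpret B: matroid E J by (rule assms)
  fix X assume X: "X \<in> I"
  then obtain Y where Y: "Y \<in> I" "X \<subseteq> Y" "Y \<subseteq> E" "card Y = r"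
    using A.extend_indep[of X E] A.indep_subset_ground assms(3) by auto
  then have "matroid_rank J Y = r" using assms(5)[of Y] A.indep_iff_rank[of Y] by (simp add: rsets_def)
  then have "Y \<in> J" using Y B.indep_iff_rank by simp
  then show "X \<in> J" using Y B.indep_subset by blast
qed

text \<open>Augmentation is delicate only if \<open>insert y X\<close> is in \<open>T\<close>. Then
  \<open>Y\<close>, which is not in \<open>T\<close>, has another element \<open>z\<close> outside
  \<open>X\<close>, and \<open>insert z X\<close> is adjacent to \<open>insert y X\<close>, so
  stability keeps it out of \<open>T\<close>.\<close>

lemma sparse_paving_matroid:
  assumes E: "finite E" and T: "T \<subseteq> rsets E r" "stable_family T" and r: "1 \<le> r"
  shows "matroid E ({X. X \<subseteq> E \<and> card X < r} \<union> (rsets E r - T))" (is "matroid E ?I")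
proof
  show "finite E" by (rule E)
  show "{} \<in> ?I" using r by auto
  show "\<And>X. X \<in> ?I \<Longrightarrow> X \<subseteq> E" by (auto simp: rsets_def)
  fix X Y assume X: "X \<in> ?I" and YX: "Y \<subseteq> X"
  have XE: "X \<subseteq> E" "card X \<le> r" using X by (auto simp: rsets_def)
  show "Y \<in> ?I"
  proof (cases "Y = X")
    case False
    then have "card Y < card X" using YX XE E by (intro psubset_card_mono) (auto intro: finite_subset)
    then show ?thesis using XE YX by auto
  qed (use X in simp)
next
  fix X Y assume X: "X \<in> ?I" and Y: "Y \<in> ?I" and lt: "card X < card Y"
  have XE: "X \<subseteq> E" "card X \<le> r" "Y \<subseteq> E" "card Y \<le> r" using X Y by (auto simp: rsets_def)
  have fin: "finite X" "finite Y" using XE E by (auto intro: finite_subset)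
  have ne: "\<not> Y \<subseteq> X" using lt fin card_mono[of X Y] by auto
  then obtain y where y: "y \<in> Y - X" by blast
  show "\<exists>y\<in>Y - X. insert y X \<in> ?I"
  proof (cases "insert y X \<in> T")
    case False
    have "card (insert y X) \<le> r" using y fin XE lt by simp
    then show ?thesis using False y XE by (intro bexI[of _ y]) (auto simp: rsets_def)
  next
    case True
    then have cX: "Suc (card X) = r" using T y fin by (auto simp: rsets_def)
    then have cY: "card Y = r" using lt XE by simp
    have "Y \<noteq> insert y X"
    proof
      assume "Y = insert y X"
      then have "Y \<in> T" using True by simp
      then show False using Y cY by auto
    qed
    moreover have "Y \<subseteq> insert y X \<Longrightarrow> Y = insert y X"
      using cX cY fin y by (intro card_subset_eq) auto
    ultimately obtain z where z: "z \<in> Y - X" "z \<noteq> y" using y by blast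
    have "adj (insert y X) (insert z X)"
      unfolding adj_def using y z by (intro exI[of _ y] exI[of _ z]) auto
    then have "insert z X \<notin> T" using True T(2) by (auto simp: stable_family_def)
    then show ?thesis using z XE cX fin by (intro bexI[of _ z]) (auto simp: rsets_def)
  qed
qed

lemma card_stable_le_matroids:
  assumes E: "finite E" and r: "1 \<le> r"
  shows "card {T. T \<subseteq> rsets E r \<and> stable_family T} \<le> card {I. matroid E I}"
proof (rule card_inj_on_le[of "\<lambda>T. {X. X \<subseteq> E \<and> card X < r} \<union> (rsets E r - T)"])
  show "inj_on (\<lambda>T. {X. X \<subseteq> E \<and> card X < r} \<union> (rsets E r - T)) {T. T \<subseteq> rsets E r \<and> stable_family T}"
  proof (rule inj_onI)
    fix T S assume T: "T \<in> {T. T \<subseteq> rsets E r \<and> stable_family T}" and S: "S \<in> {T. T \<subseteq> rsets E r \<and> stable_family T}"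
      and eq: "{X. X \<subseteq> E \<and> card X < r} \<union> (rsets E r - T) = {X. X \<subseteq> E \<and> card X < r} \<union> (rsets E r - S)"
    have dis: "{X. X \<subseteq> E \<and> card X < r} \<inter> rsets E r = {}" by (auto simp: rsets_def)
    then have "rsets E r - T = rsets E r - S" using eq by blast
    then show "T = S" using T S by blast
  qed
  show "(\<lambda>T. {X. X \<subseteq> E \<and> card X < r} \<union> (rsets E r - T)) ` {T. T \<subseteq> rsets E r \<and> stable_family T} \<subseteq> {I. matroid E I}"
    using sparse_paving_matroid[OF E _ _ r] by auto
qed (rule finite_matroids[OF E])

text \<open>Circuits are limited by total weight rather than by number, so that about 2 log n bits
  per unit of weight pay for them. The lists of flats and hyperplanes are so short that n bits per
  entry are affordable.\<close>

definition sketch_space where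
  "sketch_space E r s \<Lambda> \<Theta> = {Q. Q \<subseteq> {H. H \<subseteq> E \<and> card (E - H) \<le> s}} \<times>
     {L. L \<subseteq> {C. C \<subseteq> E \<and> card C < r} \<and> (\<Sum>C\<in>L. r - card C) \<le> \<Lambda>} \<times>
     {F. F \<subseteq> Pow E \<and> card F \<le> \<Theta>} \<times> {F. F \<subseteq> Pow E \<and> card F \<le> \<Theta>}"

lemma finite_sketch_space: "finite E \<Longrightarrow> finite (sketch_space E r s \<Lambda> \<Theta>)"
  unfolding sketch_space_def
  by (intro finite_cartesian_product) (auto intro: finite_subset[of _ "Pow (Pow E)"])

context rank_function
begin

lemma sketch_in_space:
  assumes s: "2 \<le> s" and K: "1 \<le> K" and r: "2 \<le> rk E" and \<theta>: "1 \<le> \<theta>"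
    and \<Lambda>: "4 * (card E choose rk E) div (s * (s - 1)) + (card E choose (rk E - 1)) div (K * (rk E - 1)) \<le> \<Lambda>"
    and \<Theta>: "(card E choose rk E) div \<theta> \<le> \<Theta>"
  shows "sketch s K \<theta> \<in> sketch_space E (rk E) s \<Lambda> \<Theta>"
proof -
  have fin: "finite (long_circs s)" "finite (spread_circs K)"
  proof -
    have "long_circs s \<subseteq> circ ` near" "spread_circs K \<subseteq> circ ` near" by (auto simp: long_circs_def spread_circs_def)
    then show "finite (long_circs s)" "finite (spread_circs K)" using finite_near by (auto intro: finite_subset)
  qed
  have cc: "circ X \<subseteq> E \<and> rk E - card (circ X) = card (X - circ X)" if "X \<in> near" for X
  proof -
    have "card (X - circ X) = card X - card (circ X)"
      using nearD[OF that] circ_subset[of X] by (intro card_Diff_subset) (auto intro: finite_subset)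
    then show ?thesis using nearD[OF that] circ_subset[of X] by auto
  qed
  have L: "long_circs s \<union> spread_circs K \<subseteq> {C. C \<subseteq> E \<and> card C < rk E}"
    using cc unfolding long_circs_def spread_circs_def by fastforce
  have one: "rk E - card C = 1" if "C \<in> spread_circs K" for C
    using that cc by (auto simp: spread_circs_def)
  have "(\<Sum>C\<in>long_circs s \<union> spread_circs K. rk E - card C) \<le>
      (\<Sum>C\<in>long_circs s. rk E - card C) + (\<Sum>C\<in>spread_circs K. rk E - card C)"
    using sum.union_inter[OF fin, of "\<lambda>C. rk E - card C"] by linarith
  also have "(\<Sum>C\<in>spread_circs K. rk E - card C) = card (spread_circs K)" using one by simp
  also have "(\<Sum>C\<in>long_circs s. rk E - card C) \<le> 4 * (card E choose rk E) div (s * (s - 1))"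
    using sum_long_circs[of s] s by (simp add: less_eq_div_iff_mult_less_eq)
  also have "card (spread_circs K) \<le> (card E choose (rk E - 1)) div (K * (rk E - 1))"
    using card_spread_circs[of K] K r by (simp add: less_eq_div_iff_mult_less_eq)
  finally have sumL: "(\<Sum>C\<in>long_circs s \<union> spread_circs K. rk E - card C) \<le> \<Lambda>" using \<Lambda> by linarith
  have "card (big_flats \<theta>) \<le> (card E choose rk E) div \<theta>" "card (big_hyps \<theta>) \<le> (card E choose rk E) div \<theta>"
    using card_big_flats[of \<theta>] card_big_hyps[of \<theta>] \<theta> by (simp_all add: less_eq_div_iff_mult_less_eq)
  then have "card (big_flats \<theta>) \<le> \<Theta>" "card (big_hyps \<theta>) \<le> \<Theta>" using \<Theta> by linarith+
  moreover have "big_flats \<theta> \<subseteq> Pow E" "big_hyps \<theta> \<subseteq> Pow E" "coshort s \<subseteq> {H. H \<subseteq> E \<and> card (E - H) \<le> s}"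
    by (auto simp: big_flats_def big_hyps_def coshort_def)
  ultimately show ?thesis using L sumL unfolding sketch_def sketch_space_def by simp
qed

lemma basis_exists: "\<exists>B\<in>rsets E (rk E). rk B = rk E"
proof -
  interpret M: matroid E "indeps E rk" by (rule matroid_indeps)
  obtain B where "B \<in> indeps E rk" "B \<subseteq> E" "card B = matroid_rank (indeps E rk) E" using M.rank_attained by blast
  then show ?thesis using matroid_rank_indeps[of E] by (auto simp: rsets_def indeps_def)
qed

end

text \<open>A matroid together with one of its certificates is encoded injectively by a basis, the
  two sketches and the certificate. \<open>Z\<close> is no part of the code, so it must be the same
  for the whole class.\<close>

lemma class_count:
  assumes E: "finite E"
    and M: "\<And>I. I \<in> \<M> \<Longrightarrow> matroid E I \<and> matroid_rank I E = r \<and> Z \<subseteq> rank_function.nonbases E (matroid_rank I) \<and>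
        G \<le> card {T. rank_function.valid E (matroid_rank I) s K \<theta> Z T} \<and>
        rank_function.sketch E (matroid_rank I) s K \<theta> \<in> \<S> \<and>
        rank_function.sketch E (corank E (matroid_rank I)) s K \<theta> \<in> \<S>'"
    and fin: "finite \<S>" "finite \<S>'"
  shows "card \<M> * G \<le> 2 ^ card E * card \<S> * card \<S>' * card {T. T \<subseteq> rsets E r \<and> stable_family T}"
proof -
  have RF: "rank_function E (matroid_rank I)" if "I \<in> \<M>" for I
    using M[OF that] matroid.rank_function_matroid_rank by blast
  define val where "val I = {T. rank_function.valid E (matroid_rank I) s K \<theta> Z T}" for I
  define bas where "bas I = (SOME B. B \<in> rsets E r \<and> matroid_rank I B = r)" for I
  define sk where "sk I = rank_function.sketch E (matroid_rank I) s K \<theta>" for I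
  define sk' where "sk' I = rank_function.sketch E (corank E (matroid_rank I)) s K \<theta>" for I
  have bas: "bas I \<in> rsets E r" "matroid_rank I (bas I) = r" if "I \<in> \<M>" for I
  proof -
    have "\<exists>B. B \<in> rsets E r \<and> matroid_rank I B = r"
      using rank_function.basis_exists[OF RF[OF that]] M[OF that] by auto
    from someI_ex[OF this] show "bas I \<in> rsets E r" "matroid_rank I (bas I) = r" by (auto simp: bas_def)
  qed
  define f where "f p = (bas (fst p), sk (fst p), sk' (fst p), snd p)" for p :: "'a set set \<times> 'a set set"
  define C where "C = Pow E \<times> \<S> \<times> \<S>' \<times> {T. T \<subseteq> rsets E r \<and> stable_family T}"
  have fM: "finite \<M>"
    using M by (intro finite_subset[OF _ finite_matroids[OF E]]) auto
  have fval: "finite (val I)" if "I \<in> \<M>" for I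
    unfolding val_def by (rule rank_function.finite_valid[OF RF[OF that]])
  \<comment> \<open>Equal codes give equal reconstructions. These consist of nonbases of
    \<open>I\<close> and contain all sets of rank r - 1 of \<open>J\<close>, so every basis of
    \<open>I\<close> is one of \<open>J\<close>.\<close>
  have sub: "I \<subseteq> J" if IJ: "I \<in> \<M>" "J \<in> \<M>" "T \<in> val I" "T \<in> val J" "bas I = bas J" "sk I = sk J" "sk' I = sk' J" for I J T
  proof (rule matroid_eq_of_bases[of E])
    show "matroid E I" "matroid E J" "matroid_rank I E = r" "matroid_rank J E = r" using M IJ by auto
    interpret A: rank_function E "matroid_rank I" by (rule RF) fact
    interpret B: rank_function E "matroid_rank J" by (rule RF) fact
    have rr: "matroid_rank I E = r" "matroid_rank J E = r" using M IJ by auto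
    have "A.valid s K \<theta> Z T" "B.valid s K \<theta> Z T" using IJ by (auto simp: val_def)
    then have 1: "B.near \<subseteq> recon E r (sk J) (sk' J) Z T" "T \<subseteq> A.nonbases"
      by (auto simp: A.valid_def B.valid_def rr sk_def sk'_def)
    have "recon E r (sk I) (sk' I) Z T \<subseteq> A.nonbases"
      using A.recon_nonbases[OF _ 1(2), of Z s K \<theta>] M[OF IJ(1)] by (simp add: rr sk_def sk'_def)
    then have 2: "recon E r (sk J) (sk' J) Z T \<subseteq> A.nonbases" using IJ by simp
    show "matroid_rank J Ba = r" if "Ba \<in> rsets E r" "matroid_rank I Ba = r" for Ba
      by (rule bases_determined[OF A.rank_function_axioms B.rank_function_axioms rr 1(1) 2
            bas(1)[OF IJ(1)] bas(2)[OF IJ(1)] bas(2)[OF IJ(2), folded IJ(5)] that])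
  qed
  have "inj_on f (Sigma \<M> val)"
  proof (rule inj_onI)
    fix p q assume pq: "p \<in> Sigma \<M> val" "q \<in> Sigma \<M> val" "f p = f q"
    obtain I T J T' where e: "p = (I, T)" "q = (J, T')" by (cases p, cases q)
    have h: "I \<in> \<M>" "J \<in> \<M>" "T \<in> val I" "T' \<in> val J" "bas I = bas J" "sk I = sk J" "sk' I = sk' J" "T = T'"
      using pq by (auto simp: e f_def)
    have "I \<subseteq> J" using sub[of I J T] h by simp
    moreover have "J \<subseteq> I" using sub[of J I T] h by simp
    ultimately show "p = q" using h e by auto
  qed
  moreover have "f ` Sigma \<M> val \<subseteq> C"
  proof
    fix y assume "y \<in> f ` Sigma \<M> val"
    then obtain I T where I: "I \<in> \<M>" "T \<in> val I" "y = f (I, T)" by auto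
    interpret A: rank_function E "matroid_rank I" by (rule RF) fact
    have "T \<subseteq> A.nonbases" "stable_family T" using I by (auto simp: val_def A.valid_def)
    then have "T \<subseteq> rsets E r" using M[OF I(1)] by (auto simp: A.nonbases_def)
    moreover have "sk I \<in> \<S>" "sk' I \<in> \<S>'" using M[OF I(1)] by (auto simp: sk_def sk'_def)
    moreover have "bas I \<in> Pow E" using bas(1)[OF I(1)] by (auto simp: rsets_def)
    ultimately show "y \<in> C" using I \<open>stable_family T\<close> by (simp add: C_def f_def)
  qed
  moreover have "finite C"
    unfolding C_def using E fin finite_rsets[OF E] by (intro finite_cartesian_product) auto
  ultimately have "card (Sigma \<M> val) \<le> card C" by (rule card_inj_on_le)
  moreover have "card (Sigma \<M> val) = (\<Sum>I\<in>\<M>. card (val I))" using fM fval by (simp add: card_SigmaI)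
  moreover have "card \<M> * G \<le> (\<Sum>I\<in>\<M>. card (val I))"
    using sum_mono[of \<M> "\<lambda>_. G" "\<lambda>I. card (val I)"] M by (simp add: val_def)
  moreover have "card C = 2 ^ card E * card \<S> * card \<S>' * card {T. T \<subseteq> rsets E r \<and> stable_family T}"
    by (simp add: C_def card_cartesian_product card_Pow E)
  ultimately show ?thesis by linarith
qed

text \<open>Compare the number of families with the generating function \<open>\<Prod>C\<in>U. 1 + x ^ w C\<close>.\<close>

lemma card_weighted_families:
  fixes x :: real
  assumes U: "finite U" and x: "0 < x" "x \<le> 1"
  shows "real (card {L. L \<subseteq> U \<and> (\<Sum>C\<in>L. w C) \<le> \<Lambda>}) * x ^ \<Lambda> \<le> exp (\<Sum>C\<in>U. x ^ w C)"
proof -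
  let ?F = "{L. L \<subseteq> U \<and> (\<Sum>C\<in>L. w C) \<le> \<Lambda>}"
  have "real (card ?F) * x ^ \<Lambda> = (\<Sum>L\<in>?F. x ^ \<Lambda>)" by simp
  also have "\<dots> \<le> (\<Sum>L\<in>?F. (\<Prod>C\<in>L. x ^ w C))"
  proof (rule sum_mono)
    fix L assume "L \<in> ?F"
    then show "x ^ \<Lambda> \<le> (\<Prod>C\<in>L. x ^ w C)" using x by (auto simp flip: power_sum intro!: power_decreasing)
  qed
  also have "\<dots> \<le> (\<Sum>L\<in>Pow U. (\<Prod>C\<in>L. x ^ w C))"
    using U x by (intro sum_mono2) (auto intro!: prod_nonneg)
  also have "\<dots> = (\<Prod>C\<in>U. 1 + x ^ w C)"
    using prod_add[OF U, of "\<lambda>C. x ^ w C" "\<lambda>_. 1"] by (simp add: add.commute)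
  also have "\<dots> \<le> (\<Prod>C\<in>U. exp (x ^ w C))" using x by (intro prod_mono) (auto intro: add_nonneg_nonneg)
  also have "\<dots> = exp (\<Sum>C\<in>U. x ^ w C)" using U by (simp add: exp_sum)
  finally show ?thesis .
qed

section \<open>Number of sketches\<close>

lemma card_small_sets_le:
  assumes "finite E"
  shows "card {A. A \<subseteq> E \<and> card A \<le> s} \<le> (card E + 1) ^ s"
proof -
  have "{A. A \<subseteq> E \<and> card A \<le> s} = (\<Union>i\<le>s. {A. A \<subseteq> E \<and> card A = i})" by auto
  then have "card {A. A \<subseteq> E \<and> card A \<le> s} \<le> (\<Sum>i\<le>s. card E choose i)"
    using card_UN_le[of "{..s}" "\<lambda>i. {A. A \<subseteq> E \<and> card A = i}"] n_subsets[OF assms] by simp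
  also have "\<dots> \<le> (\<Sum>i\<le>s. (s choose i) * card E ^ i)"
  proof (rule sum_mono)
    fix i assume "i \<in> {..s}"
    then have "1 \<le> s choose i" by (simp add: Suc_leI)
    moreover have "card E choose i \<le> card E ^ i"
      by (cases "i \<le> card E") (auto simp: binomial_le_pow binomial_eq_0)
    ultimately show "card E choose i \<le> (s choose i) * card E ^ i"
      using mult_le_mono by fastforce
  qed
  also have "\<dots> = (card E + 1) ^ s" using binomial[of "card E" 1 s] by simp
  finally show ?thesis .
qed

lemma binomial_step_down:
  assumes "4 * r \<le> 3 * n" "i < r"
  shows "n choose i \<le> 3 * (n choose Suc i)"
proof -
  have "Suc i * (n choose Suc i) = (n - i) * (n choose i)"
    by (simp only: binomial_absorption binomial_absorb_comp)
  moreover have "Suc i \<le> 3 * (n - i)" using assms by linarith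
  ultimately have "(n - i) * (n choose i) \<le> (3 * (n - i)) * (n choose Suc i)"
    by (metis mult_le_mono1)
  then show ?thesis using assms by simp
qed

lemma binomial_steps_down:
  assumes "4 * r \<le> 3 * n" "j \<le> r"
  shows "n choose (r - j) \<le> 3 ^ j * (n choose r)"
  using assms(2)
proof (induction j)
  case (Suc j)
  have "n choose (r - Suc j) \<le> 3 * (n choose Suc (r - Suc j))"
    using Suc.prems by (intro binomial_step_down[OF assms(1)]) simp
  also have "Suc (r - Suc j) = r - j" using Suc.prems by simp
  finally show ?case using Suc by simp
qed simp

lemma card_sketch_space:
  assumes E: "finite E" and n: "card E = n" "3 \<le> n" and r: "4 * r \<le> 3 * n"
  shows "real (card (sketch_space E r s \<Lambda> \<Theta>)) \<le>
    2 ^ ((n + 1) ^ s) * (real n ^ (2 * \<Lambda>) * exp (6 * real (n choose r) / real n ^ 2)) * (3 * 2 ^ (n * \<Theta>)) * (3 * 2 ^ (n * \<Theta>))"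
proof -
  define N where "N = real (n choose r)"
  have c1: "card {Q. Q \<subseteq> {H. H \<subseteq> E \<and> card (E - H) \<le> s}} \<le> 2 ^ ((n + 1) ^ s)"
  proof -
    have "bij_betw (\<lambda>H. E - H) {H. H \<subseteq> E \<and> card (E - H) \<le> s} {A. A \<subseteq> E \<and> card A \<le> s}"
    proof (rule bij_betwI[where g = "\<lambda>H. E - H"])
      have "E - (E - H) = H" if "H \<subseteq> E" for H using that by blast
      then show "(\<lambda>H. E - H) \<in> {H. H \<subseteq> E \<and> card (E - H) \<le> s} \<rightarrow> {A. A \<subseteq> E \<and> card A \<le> s}"
        "(\<lambda>H. E - H) \<in> {A. A \<subseteq> E \<and> card A \<le> s} \<rightarrow> {H. H \<subseteq> E \<and> card (E - H) \<le> s}"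
        "\<And>x. x \<in> {H. H \<subseteq> E \<and> card (E - H) \<le> s} \<Longrightarrow> E - (E - x) = x"
        "\<And>y. y \<in> {A. A \<subseteq> E \<and> card A \<le> s} \<Longrightarrow> E - (E - y) = y" by auto
    qed
    then have "card {H. H \<subseteq> E \<and> card (E - H) \<le> s} \<le> (n + 1) ^ s"
      using card_small_sets_le[OF E, of s] n by (simp add: bij_betw_same_card)
    moreover have "card {Q. Q \<subseteq> {H. H \<subseteq> E \<and> card (E - H) \<le> s}} = 2 ^ card {H. H \<subseteq> E \<and> card (E - H) \<le> s}"
      using card_Pow[of "{H. H \<subseteq> E \<and> card (E - H) \<le> s}"] E by (simp add: Pow_def)
    ultimately show ?thesis by (simp add: power_increasing)
  qed
  \<comment> \<open>With this \<open>x\<close>, the sets of size r - j contribute at most N (3 /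
    n^2)^j to the exponent, a geometric series of order N / n^2; the price is a factor n^2 per unit
    of weight.\<close>
  define x where "x = 1 / real n ^ 2"
  have x: "0 < x" "x \<le> 1" "3 * x \<le> 1 / 2"
  proof -
    have "real 3 ^ 2 \<le> real n ^ 2" using n by (intro power_mono) auto
    then have "9 \<le> real n ^ 2" by simp
    then show "0 < x" "x \<le> 1" "3 * x \<le> 1 / 2" using n by (auto simp: x_def field_simps)
  qed
  have c2: "real (card {L. L \<subseteq> {C. C \<subseteq> E \<and> card C < r} \<and> (\<Sum>C\<in>L. r - card C) \<le> \<Lambda>}) \<le>
      real n ^ (2 * \<Lambda>) * exp (6 * N / real n ^ 2)" (is "?c \<le> _")
  proof -
    have "(\<Sum>C\<in>{C. C \<subseteq> E \<and> card C < r}. x ^ (r - card C)) = (\<Sum>i<r. \<Sum>C\<in>{C. C \<subseteq> E \<and> card C = i}. x ^ (r - card C))"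
    proof -
      have "{C. C \<subseteq> E \<and> card C < r} = (\<Union>i<r. {C. C \<subseteq> E \<and> card C = i})" by auto
      then show ?thesis using E by (subst sum.UNION_disjoint[symmetric]) auto
    qed
    also have "\<dots> = (\<Sum>i<r. real (n choose i) * x ^ (r - i))"
      using n_subsets[OF E] n by (intro sum.cong) auto
    also have "\<dots> = (\<Sum>j<r. real (n choose (r - Suc j)) * x ^ (Suc j))"
      by (subst sum.nat_diff_reindex[symmetric]) (auto intro!: sum.cong)
    also have "\<dots> \<le> (\<Sum>j<r. N * (3 * x) * (1 / 2) ^ j)"
    proof (rule sum_mono)
      fix j assume j: "j \<in> {..<r}"
      have "real (n choose (r - Suc j)) \<le> 3 ^ Suc j * N"
      proof -
        have "n choose (r - Suc j) \<le> 3 ^ Suc j * (n choose r)"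
          using binomial_steps_down[OF r, of "Suc j"] j by simp
        then have "real (n choose (r - Suc j)) \<le> real (3 ^ Suc j * (n choose r))" by (rule of_nat_mono)
        then show ?thesis by (simp add: N_def)
      qed
      then have "real (n choose (r - Suc j)) * x ^ Suc j \<le> 3 ^ Suc j * N * x ^ Suc j"
        using x by (intro mult_right_mono) auto
      also have "\<dots> = N * (3 * x) * (3 * x) ^ j" by (simp add: power_mult_distrib)
      also have "\<dots> \<le> N * (3 * x) * (1 / 2) ^ j"
        using x by (intro mult_left_mono power_mono) (auto simp: N_def)
      finally show "real (n choose (r - Suc j)) * x ^ Suc j \<le> N * (3 * x) * (1 / 2) ^ j" .
    qed
    also have "\<dots> = N * (3 * x) * (\<Sum>j<r. (1 / 2) ^ j)" by (simp add: sum_distrib_left)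
    also have "\<dots> \<le> N * (3 * x) * 2"
      using x by (intro mult_left_mono) (auto simp: N_def sum_gp_strict)
    finally have le: "(\<Sum>C\<in>{C. C \<subseteq> E \<and> card C < r}. x ^ (r - card C)) \<le> 6 * N / real n ^ 2"
      by (simp add: x_def)
    have "?c * x ^ \<Lambda> \<le> exp (\<Sum>C\<in>{C. C \<subseteq> E \<and> card C < r}. x ^ (r - card C))"
      using E x by (intro card_weighted_families) auto
    also have "\<dots> \<le> exp (6 * N / real n ^ 2)" using le by simp
    finally have "?c * x ^ \<Lambda> \<le> exp (6 * N / real n ^ 2)" .
    moreover have "x ^ \<Lambda> * real n ^ (2 * \<Lambda>) = 1"
      using n by (simp add: x_def power_mult power_one_over)
    moreover have "?c * (x ^ \<Lambda> * real n ^ (2 * \<Lambda>)) \<le> exp (6 * N / real n ^ 2) * real n ^ (2 * \<Lambda>)"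
      unfolding mult.assoc[symmetric] by (rule mult_right_mono) (use \<open>?c * x ^ \<Lambda> \<le> exp (6 * N / real n ^ 2)\<close> in simp_all)
    ultimately show ?thesis by (simp add: mult.commute)
  qed
  have c3: "real (card {F. F \<subseteq> Pow E \<and> card F \<le> \<Theta>}) \<le> 3 * 2 ^ (n * \<Theta>)" (is "?d \<le> _")
  proof -
    \<comment> \<open>The weight 2^(-n) makes the sum over all 2^n subsets of \<open>E\<close> equal
      to 1; the factor 3 bounds \<open>exp 1\<close>.\<close>
    define y where "y = 1 / (2::real) ^ n"
    have "real (card {F. F \<subseteq> Pow E \<and> (\<Sum>C\<in>F. 1) \<le> \<Theta>}) * y ^ \<Theta> \<le> exp (\<Sum>C\<in>Pow E. y ^ 1)"
      using E by (intro card_weighted_families) (auto simp: y_def)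
    also have "(\<Sum>C\<in>Pow E. y ^ 1) = 1" using E n by (simp add: y_def card_Pow)
    also have "exp (1::real) \<le> 3" by (rule exp_le)
    finally have "?d * y ^ \<Theta> \<le> 3" by simp
    then have "?d * (y ^ \<Theta> * 2 ^ (n * \<Theta>)) \<le> 3 * 2 ^ (n * \<Theta>)"
      unfolding mult.assoc[symmetric] by (rule mult_right_mono) simp
    moreover have "y ^ \<Theta> * 2 ^ (n * \<Theta>) = 1" by (simp add: y_def power_mult power_one_over)
    ultimately show ?thesis by simp
  qed
  have "real (card (sketch_space E r s \<Lambda> \<Theta>)) =
      real (card {Q. Q \<subseteq> {H. H \<subseteq> E \<and> card (E - H) \<le> s}}) *
      (real (card {L. L \<subseteq> {C. C \<subseteq> E \<and> card C < r} \<and> (\<Sum>C\<in>L. r - card C) \<le> \<Lambda>}) *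
      (real (card {F. F \<subseteq> Pow E \<and> card F \<le> \<Theta>}) * real (card {F. F \<subseteq> Pow E \<and> card F \<le> \<Theta>})))"
    unfolding sketch_space_def card_cartesian_product by simp
  also have "\<dots> \<le> 2 ^ ((n + 1) ^ s) * (real n ^ (2 * \<Lambda>) * exp (6 * N / real n ^ 2) * (3 * 2 ^ (n * \<Theta>) * (3 * 2 ^ (n * \<Theta>))))"
    using c2 c3 c1 by (intro mult_mono) (auto simp flip: of_nat_le_iff simp del: of_nat_le_iff)
  finally show ?thesis by (simp add: N_def mult.assoc)
qed

section \<open>Coloops and extreme ranks\<close>

text \<open>\<open>e\<close> is placed freely on the flat spanned by \<open>A\<close>: the condition
  on \<open>X\<close> says that \<open>X\<close> does not span \<open>A\<close>.\<close>

definition principal_ext :: "'a \<Rightarrow> 'a set set \<Rightarrow> 'a set \<Rightarrow> 'a set set" where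
  "principal_ext e J A = J \<union> {insert e X | X. X \<in> J \<and> (\<exists>a\<in>A. a \<notin> X \<and> insert a X \<in> J)}"

lemma matroid_principal_ext:
  assumes M: "matroid (E - {e}) J" and e: "e \<in> E"
  shows "matroid E (principal_ext e J A)"
proof -
  interpret matroid "E - {e}" J by (rule M)
  define free where "free X \<longleftrightarrow> X \<in> J \<and> (\<exists>a\<in>A. a \<notin> X \<and> insert a X \<in> J)" for X
  have notin: "e \<notin> X" if "X \<in> J" for X using indep_subset_ground[OF that] by auto
  have I: "Y \<in> principal_ext e J A \<longleftrightarrow> Y \<in> J \<or> (e \<in> Y \<and> free (Y - {e}))" for Y
  proof
    assume "Y \<in> principal_ext e J A"
    then show "Y \<in> J \<or> (e \<in> Y \<and> free (Y - {e}))"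
      using notin by (auto simp: principal_ext_def free_def)
  next
    assume "Y \<in> J \<or> (e \<in> Y \<and> free (Y - {e}))"
    moreover have "Y = insert e (Y - {e})" if "e \<in> Y" using that by auto
    ultimately show "Y \<in> principal_ext e J A"
      unfolding principal_ext_def free_def by blast
  qed
  have free_sub: "free Y" if XY: "free X" "Y \<subseteq> X" for X Y
  proof -
    obtain a where a: "a \<in> A" "a \<notin> X" "insert a X \<in> J" using XY by (auto simp: free_def)
    have "insert a Y \<in> J" using indep_subset[OF a(3), of "insert a Y"] XY by auto
    moreover have "Y \<in> J" using indep_subset[of X Y] XY by (auto simp: free_def)
    ultimately show ?thesis using a XY by (auto simp: free_def)
  qed
  have aug: "\<exists>y\<in>Y - X. insert y X \<in> J" if "X \<in> J" "Y \<in> J" "card X < card Y" for X Y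
    using indep_augment that by blast
  \<comment> \<open>With two elements to spare, \<open>X\<close> together with its witness
    \<open>a\<close> can be augmented from \<open>Y\<close>, and \<open>a\<close> remains a witness
    afterwards.\<close>
  have key: "\<exists>y\<in>Y - X. free (insert y X)" if X: "free X" and Y: "Y \<in> J" "card X + 1 < card Y" for X Y
  proof -
    obtain a where a: "a \<in> A" "a \<notin> X" "insert a X \<in> J" using X by (auto simp: free_def)
    have "finite X" using X finite_indep by (auto simp: free_def)
    then have "card (insert a X) < card Y" using a Y by simp
    then obtain y where y: "y \<in> Y - insert a X" "insert y (insert a X) \<in> J" using aug[OF a(3) Y(1)] by blast
    then have "insert a (insert y X) \<in> J" by (simp add: insert_commute)
    moreover have "insert y X \<in> J" using indep_subset[OF y(2), of "insert y X"] by auto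
    ultimately show ?thesis using a y by (auto simp: free_def)
  qed
  show ?thesis
  proof
    show "finite E" using finite_ground by simp
    show "{} \<in> principal_ext e J A" using I indep_empty by simp
    show "\<And>X. X \<in> principal_ext e J A \<Longrightarrow> X \<subseteq> E"
      using I indep_subset_ground e unfolding free_def by blast
    show "Y \<in> principal_ext e J A" if X: "X \<in> principal_ext e J A" and YX: "Y \<subseteq> X" for X Y
    proof (cases "X \<in> J")
      case True then show ?thesis using I indep_subset YX by blast
    next
      case False
      then have f: "free (X - {e})" using I X by simp
      then have "free (Y - {e})" using free_sub YX by blast
      then show ?thesis unfolding I by (cases "e \<in> Y") (auto simp: free_def)
    qed
  next
    fix X Y assume XI: "X \<in> principal_ext e J A" and YI: "Y \<in> principal_ext e J A" and lt: "card X < card Y"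
    have finJ: "finite X" if "X \<in> J" for X using that finite_indep by blast
    show "\<exists>y\<in>Y - X. insert y X \<in> principal_ext e J A"
    proof (cases "X \<in> J")
      case XJ: True
      show ?thesis
      proof (cases "Y \<in> J")
        case True then show ?thesis using aug[OF XJ True lt] I by blast
      next
        case False
        then have Y: "e \<in> Y" "free (Y - {e})" using I YI by auto
        define Y' where "Y' = Y - {e}"
        have Y': "free Y'" "Y' \<in> J" "card Y = Suc (card Y')"
        proof -
          show "free Y'" "Y' \<in> J" using Y by (auto simp: Y'_def free_def)
          then have "finite Y" using finJ[of Y'] by (simp add: Y'_def)
          then show "card Y = Suc (card Y')" using Y card_Suc_Diff1[of Y e] by (simp add: Y'_def)
        qed
        show ?thesis
        proof (cases "card X < card Y'")
          case True
          then show ?thesis using aug[OF XJ Y'(2) True] I by (auto simp: Y'_def)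
        next
          \<comment> \<open>Here \<open>X\<close> and \<open>Y'\<close> have the same size. If
            \<open>X\<close> is not free, augmenting it from \<open>insert a Y'\<close> cannot pick
            \<open>a\<close>, since \<open>insert a X\<close> in \<open>J\<close> would make
            \<open>X\<close> free.\<close>
          case ge: False
          show ?thesis
          proof (cases "free X")
            case True
            then have "insert e X \<in> principal_ext e J A" using I notin[OF XJ] by simp
            then show ?thesis using Y notin[OF XJ] by auto
          next
            case nf: False
            obtain a where a: "a \<in> A" "a \<notin> Y'" "insert a Y' \<in> J" using Y'(1) by (auto simp: free_def)
            have "card X < card (insert a Y')" using a finJ[OF Y'(2)] lt Y'(3) by simp
            then obtain y where y: "y \<in> insert a Y' - X" "insert y X \<in> J" using aug[OF XJ a(3)] by blast
            have "y \<noteq> a" using nf y a XJ by (auto simp: free_def)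
            then show ?thesis using y I by (auto simp: Y'_def)
          qed
        qed
      qed
    next
      case False
      then have X: "e \<in> X" "free (X - {e})" using I XI by auto
      define X' where "X' = X - {e}"
      have X': "free X'" "X' \<in> J" "card X = Suc (card X')"
      proof -
        show "free X'" "X' \<in> J" using X by (auto simp: X'_def free_def)
        then have "finite X" using finJ[of X'] by (simp add: X'_def)
        then show "card X = Suc (card X')" using X card_Suc_Diff1[of X e] by (simp add: X'_def)
      qed
      have Xe: "insert y X \<in> principal_ext e J A" if "free (insert y X')" "y \<noteq> e" for y
      proof -
        have "insert y X - {e} = insert y X'" using that by (auto simp: X'_def)
        then show ?thesis using I that X by simp
      qed
      show ?thesis
      proof (cases "Y \<in> J")
        case True
        then obtain y where "y \<in> Y - X'" "free (insert y X')" using key[OF X'(1) True] lt X'(3) by auto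
        then show ?thesis using Xe[of y] notin[OF True] by (intro bexI[of _ y]) (auto simp: X'_def)
      next
        case False
        then have Y: "e \<in> Y" "free (Y - {e})" using I YI by auto
        define Y' where "Y' = Y - {e}"
        have Y': "free Y'" "Y' \<in> J" "card Y = Suc (card Y')"
        proof -
          show "free Y'" "Y' \<in> J" using Y by (auto simp: Y'_def free_def)
          then have "finite Y" using finJ[of Y'] by (simp add: Y'_def)
          then show "card Y = Suc (card Y')" using Y card_Suc_Diff1[of Y e] by (simp add: Y'_def)
        qed
        have lt': "card X' < card Y'" using lt X'(3) Y'(3) by simp
        have "\<exists>y\<in>Y' - X'. free (insert y X')"
        proof (cases "card X' + 1 < card Y'")
          case True then show ?thesis by (rule key[OF X'(1) Y'(2)])
        next
          \<comment> \<open>Only one element to spare: augment \<open>insert a X'\<close> from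
            \<open>insert b Y'\<close>. If this adds \<open>b\<close>, then \<open>W\<close> exceeds
            \<open>X'\<close> by two elements of \<open>A\<close>, and augmenting
            \<open>insert y X'\<close> from \<open>W\<close> adds one of them, which witnesses
            freeness.\<close>
          case False
          obtain a where a: "a \<in> A" "a \<notin> X'" "insert a X' \<in> J" using X'(1) by (auto simp: free_def)
          obtain b where b: "b \<in> A" "b \<notin> Y'" "insert b Y' \<in> J" using Y'(1) by (auto simp: free_def)
          have c: "card (insert a X') = card Y'" "card (insert b Y') = Suc (card Y')"
            using a b finJ[OF X'(2)] finJ[OF Y'(2)] False lt' by simp_all
          then obtain z where z: "z \<in> insert b Y' - insert a X'" "insert z (insert a X') \<in> J"
            using aug[OF a(3) b(3)] by auto
          show ?thesis
          proof (cases "z \<in> Y'")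
            case True
            have "insert a (insert z X') \<in> J" using z by (simp add: insert_commute)
            moreover have "insert z X' \<in> J" using indep_subset[OF z(2), of "insert z X'"] by auto
            ultimately have "free (insert z X')" using a z by (auto simp: free_def)
            then show ?thesis using True z by auto
          next
            case zb: False
            then have zb: "z = b" using z by simp
            obtain y where y: "y \<in> Y' - X'" "insert y X' \<in> J" using aug[OF X'(2) Y'(2) lt'] by blast
            define W where "W = insert z (insert a X')"
            have W: "W \<in> J" "card W = Suc (Suc (card X'))"
              using z a finJ[OF X'(2)] by (auto simp: W_def)
            have cy: "card (insert y X') < card W" using y W finJ[OF X'(2)] by simp
            obtain w where w: "w \<in> W - insert y X'" "insert w (insert y X') \<in> J" using aug[OF y(2) W(1) cy] by blast
            then have "w \<in> {z, a}" by (auto simp: W_def)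
            then have "w \<in> A" using a b zb by auto
            then show ?thesis using w y by (auto simp: free_def)
          qed
        qed
        then obtain y where y: "y \<in> Y' - X'" "free (insert y X')" by blast
        then have "y \<in> Y" "y \<noteq> e" by (auto simp: Y'_def)
        then show ?thesis using y Xe[of y] by (intro bexI[of _ y]) (auto simp: X'_def)
      qed
    qed
  qed
qed

text \<open>A matroid with coloop \<open>e\<close> is determined by its deletion. Putting
  \<open>e\<close> back by a principal extension on a subset \<open>A\<close> of a chosen basis of
  the deletion gives 2^(r - 1) matroids. Both data can be read off: the deletion is unchanged, and
  \<open>a\<close> is in \<open>A\<close> iff \<open>e\<close> can replace \<open>a\<close> in that
  basis.\<close>

lemma card_coloop_class:
  assumes E: "finite E" and e: "e \<in> E"
  shows "card {I. matroid E I \<and> matroid_rank I E = r \<and> matroid_rank I (E - {e}) < r} * 2 ^ (r - 1) \<le> card {I. matroid E I}"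
proof -
  define \<M> where "\<M> = {I. matroid E I \<and> matroid_rank I E = r \<and> matroid_rank I (E - {e}) < r}"
  define del where "del I = {X \<in> I. e \<notin> X}" for I :: "'a set set"
  define bas where "bas I = (SOME B. B \<in> del I \<and> card B = r - 1)" for I
  have RF: "rank_function E (matroid_rank I)" if "I \<in> \<M>" for I
    using that matroid.rank_function_matroid_rank by (auto simp: \<M>_def)
  have rk: "Suc (matroid_rank I (E - {e})) = r" if "I \<in> \<M>" for I
  proof -
    interpret rank_function E "matroid_rank I" by (rule RF[OF that])
    have "insert e (E - {e}) = E" using e by auto
    then show ?thesis using rk_insert_le[of e "E - {e}"] that by (simp add: \<M>_def)
  qed
  have mdel: "matroid (E - {e}) (del I)" if "I \<in> \<M>" for I
  proof -
    interpret matroid E I using that by (simp add: \<M>_def)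
    show ?thesis
    proof
      show "finite (E - {e})" using E by simp
      show "\<And>X. X \<in> del I \<Longrightarrow> X \<subseteq> E - {e}" using indep_subset_ground by (auto simp: del_def)
      show "{} \<in> del I" using indep_empty by (simp add: del_def)
      show "\<And>X Y. X \<in> del I \<Longrightarrow> Y \<subseteq> X \<Longrightarrow> Y \<in> del I" using indep_subset by (auto simp: del_def)
      show "\<exists>y\<in>Y - X. insert y X \<in> del I" if "X \<in> del I" "Y \<in> del I" "card X < card Y" for X Y
        using indep_augment[of X Y] that by (auto simp: del_def)
    qed
  qed
  have det: "I \<subseteq> J" if I: "I \<in> \<M>" and J: "J \<in> \<M>" and eq: "del I = del J" for I J
  proof
    interpret A: rank_function E "matroid_rank J" by (rule RF[OF J])
    interpret MI: matroid E I using I by (simp add: \<M>_def)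
    interpret MJ: matroid E J using J by (simp add: \<M>_def)
    fix X assume X: "X \<in> I"
    have XE: "X \<subseteq> E" using X MI.indep_subset_ground by blast
    have "X - {e} \<in> del I" using MI.indep_subset[OF X] by (auto simp: del_def)
    then have "X - {e} \<in> del J" unfolding eq .
    then have Xe: "X - {e} \<in> J" by (simp add: del_def)
    show "X \<in> J"
    proof (cases "e \<in> X")
      case True
      have "matroid_rank J (insert e (X - {e})) \<noteq> matroid_rank J (X - {e})"
      proof
        assume "matroid_rank J (insert e (X - {e})) = matroid_rank J (X - {e})"
        then have "matroid_rank J (insert e (E - {e})) = matroid_rank J (E - {e})"
          by (rule A.rk_insert_span_mono) (use XE in auto)
        moreover have "insert e (E - {e}) = E" using e by auto
        ultimately show False using J by (simp add: \<M>_def)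
      qed
      moreover have "insert e (X - {e}) = X" using True by auto
      moreover have "matroid_rank J (X - {e}) = card (X - {e})" using MJ.indep_iff_rank Xe by simp
      moreover have "Suc (card (X - {e})) = card X" using True XE E finite_subset card_Suc_Diff1 by metis
      ultimately have "matroid_rank J X = card X" using A.rk_insert_cases[of e "X - {e}"] by simp
      then show ?thesis using MJ.indep_iff_rank XE by simp
    qed (use Xe in simp)
  qed
  have bas: "bas I \<in> del I" "card (bas I) = r - 1" if "I \<in> \<M>" for I
  proof -
    interpret matroid E I using that by (simp add: \<M>_def)
    obtain B where "B \<in> I" "B \<subseteq> E - {e}" "card B = matroid_rank I (E - {e})" using rank_attained by blast
    then have "\<exists>B. B \<in> del I \<and> card B = r - 1" using rk[OF that] by (intro exI[of _ B]) (auto simp: del_def)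
    from someI_ex[OF this] show "bas I \<in> del I" "card (bas I) = r - 1" by (auto simp: bas_def)
  qed
  define f where "f p = principal_ext e (del (fst p)) (snd p)" for p :: "'a set set \<times> 'a set"
  have fM: "finite \<M>" unfolding \<M>_def by (rule finite_subset[OF _ finite_matroids[OF E]]) auto
  have fb: "finite (bas I)" if "I \<in> \<M>" for I
    using matroid.indep_subset_ground[OF mdel[OF that] bas(1)[OF that]] E by (auto intro: finite_subset)
  have dec1: "del (f (I, A)) = del I" for I A by (auto simp: f_def principal_ext_def del_def)
  have dec2: "A = {a \<in> bas I. insert e (bas I - {a}) \<in> f (I, A)}" if I: "I \<in> \<M>" and A: "A \<subseteq> bas I" for I A
  proof -
    interpret matroid "E - {e}" "del I" by (rule mdel[OF I])
    have "insert e (bas I - {a}) \<in> f (I, A) \<longleftrightarrow> a \<in> A" if a: "a \<in> bas I" for a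
    proof
      assume "insert e (bas I - {a}) \<in> f (I, A)"
      then obtain X where X: "insert e (bas I - {a}) = insert e X" "X \<in> del I" "\<exists>b\<in>A. b \<notin> X \<and> insert b X \<in> del I"
        unfolding f_def principal_ext_def by (auto simp: del_def)
      have "e \<notin> X" "e \<notin> bas I" using X(2) bas(1)[OF I] by (auto simp: del_def)
      have "X = insert e X - {e}" using \<open>e \<notin> X\<close> by auto
      also have "\<dots> = bas I - {a}" unfolding X(1)[symmetric] using \<open>e \<notin> bas I\<close> by auto
      finally have "X = bas I - {a}" .
      then show "a \<in> A" using X(3) A by auto
    next
      assume aA: "a \<in> A"
      have "insert a (bas I - {a}) = bas I" using a by auto
      then have "insert a (bas I - {a}) \<in> del I" using bas(1)[OF I] by simp
      moreover have "bas I - {a} \<in> del I" using indep_subset[OF bas(1)[OF I]] by auto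
      ultimately have "\<exists>b\<in>A. b \<notin> bas I - {a} \<and> insert b (bas I - {a}) \<in> del I" using aA by blast
      then show "insert e (bas I - {a}) \<in> f (I, A)"
        using \<open>bas I - {a} \<in> del I\<close> unfolding f_def principal_ext_def by auto
    qed
    then show ?thesis using A by auto
  qed
  have "inj_on f (SIGMA I:\<M>. Pow (bas I))"
  proof (rule inj_onI)
    fix p q assume pq: "p \<in> (SIGMA I:\<M>. Pow (bas I))" "q \<in> (SIGMA I:\<M>. Pow (bas I))" "f p = f q"
    obtain I A J B where e: "p = (I, A)" "q = (J, B)" by (cases p, cases q)
    have h: "I \<in> \<M>" "J \<in> \<M>" "A \<subseteq> bas I" "B \<subseteq> bas J" "f (I, A) = f (J, B)" using pq by (auto simp: e)
    have "del I = del J" using dec1[of I A] dec1[of J B] h by simp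
    then have "I \<subseteq> J" "J \<subseteq> I" using det[OF h(1,2)] det[OF h(2,1)] by simp_all
    then have "I = J" by (rule subset_antisym)
    then show "p = q" using dec2[OF h(1,3)] dec2[OF h(2,4)] h e by simp
  qed
  moreover have "f ` (SIGMA I:\<M>. Pow (bas I)) \<subseteq> {I. matroid E I}"
    using matroid_principal_ext[OF mdel e] by (auto simp: f_def)
  ultimately have "card (SIGMA I:\<M>. Pow (bas I)) \<le> card {I. matroid E I}"
    using finite_matroids[OF E] by (rule card_inj_on_le)
  moreover have "card (SIGMA I:\<M>. Pow (bas I)) = (\<Sum>I\<in>\<M>. 2 ^ (r - 1))"
    using fM fb bas by (subst card_SigmaI) (auto simp: card_Pow)
  ultimately show ?thesis unfolding \<M>_def by simp
qed

section \<open>Crude bounds on the number of matroids\<close>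

lemma card_rank_class_le:
  assumes E: "finite E"
  shows "card {I. matroid E I \<and> matroid_rank I E = r} \<le> 2 ^ (card E choose r)"
proof -
  have "card {I. matroid E I \<and> matroid_rank I E = r} \<le> card (Pow (rsets E r))"
  proof (rule card_inj_on_le[of "\<lambda>I. {B \<in> rsets E r. matroid_rank I B = r}"])
    show "inj_on (\<lambda>I. {B \<in> rsets E r. matroid_rank I B = r}) {I. matroid E I \<and> matroid_rank I E = r}"
    proof (rule inj_onI)
      fix I J assume IJ: "I \<in> {I. matroid E I \<and> matroid_rank I E = r}" "J \<in> {I. matroid E I \<and> matroid_rank I E = r}"
        "{B \<in> rsets E r. matroid_rank I B = r} = {B \<in> rsets E r. matroid_rank J B = r}"
      then have "I \<subseteq> J" "J \<subseteq> I"
        using matroid_eq_of_bases[of E I J r] matroid_eq_of_bases[of E J I r] by blast+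
      then show "I = J" by blast
    qed
  qed (use finite_rsets[OF E] in auto)
  then show ?thesis using card_Pow[OF finite_rsets[OF E]] card_rsets[OF E] by metis
qed

lemma card_matroids_ge:
  assumes E: "finite E" and r: "1 \<le> r" and g: "card E * g \<le> (card E choose r)" and n: "0 < card E"
  shows "2 ^ g \<le> card {I. matroid E I}"
proof -
  obtain C where C: "C \<subseteq> rsets E r" "stable_family C" "card (rsets E r) \<le> card E * card C"
    using large_stable_subset[OF E order_refl n] by blast
  have "card E * g \<le> card E * card C" using order_trans[OF g, of "card E * card C"] C(3) card_rsets[OF E, of r] by simp
  then have gC: "g \<le> card C" using n by simp
  have fC: "finite C" using C(1) finite_rsets[OF E] by (rule finite_subset)
  have "Pow C \<subseteq> {T. T \<subseteq> rsets E r \<and> stable_family T}" using C stable_subset by blast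
  then have "card (Pow C) \<le> card {T. T \<subseteq> rsets E r \<and> stable_family T}"
    using finite_rsets[OF E] by (intro card_mono) auto
  also have "\<dots> \<le> card {I. matroid E I}" by (rule card_stable_le_matroids[OF E r])
  finally have "2 ^ card C \<le> card {I. matroid E I}" using card_Pow[OF fC] by simp
  then show ?thesis using gC by (meson le_trans one_le_numeral power_increasing)
qed

section \<open>Separations\<close>

context rank_function
begin

text \<open>A maximal nonspanning set around \<open>B\<close> is a hyperplane, and it misses no more
  elements than \<open>B\<close>.\<close>

lemma extend_to_hyperplane:
  assumes B: "B \<subseteq> E" "rk B < rk E"
  shows "\<exists>H. B \<subseteq> H \<and> H \<in> coshort (card (E - B)) \<and> H \<noteq> E"
proof -
  let ?F = "{H. B \<subseteq> H \<and> H \<subseteq> E \<and> rk H < rk E}"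
  have "finite ?F" by (rule finite_subset[of _ "Pow E"]) (use finite_E in auto)
  moreover have "B \<in> ?F" using B by auto
  ultimately obtain H where H: "H \<in> ?F" "\<And>H'. H' \<in> ?F \<Longrightarrow> H \<subseteq> H' \<Longrightarrow> H = H'"
    using finite_has_maximal[of ?F] by (metis (no_types, lifting) empty_iff)
  have step: "rk (insert e H) = rk E" if e: "e \<in> E - H" for e
  proof (rule ccontr)
    assume "rk (insert e H) \<noteq> rk E"
    moreover have "rk (insert e H) \<le> rk E" using e H(1) by (intro rk_mono) auto
    ultimately have "insert e H \<in> ?F" using e H(1) by auto
    then show False using H(2)[of "insert e H"] e by auto
  qed
  have HE: "H \<noteq> E" using H(1) by auto
  then obtain e where e: "e \<in> E - H" using H(1) by auto
  have "Suc (rk H) = rk E" using step[OF e] rk_insert_le[of e H] H(1) by simp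
  moreover have "card (E - H) \<le> card (E - B)" using finite_E H(1) by (intro card_mono) auto
  ultimately show ?thesis using step H(1) HE by (auto simp: coshort_def)
qed

lemma coshort_mono: "H \<in> coshort s \<Longrightarrow> card (E - H) \<le> s' \<Longrightarrow> H \<in> coshort s'"
  by (auto simp: coshort_def)

text \<open>More than \<open>rk A\<close> elements in \<open>A\<close>, or more than
  \<open>rk B\<close> in \<open>B\<close>, force dependence. \<open>W\<close> asks for one element
  more, so that its neighbours stay in \<open>Z\<close>. As \<open>Z\<close> depends only on the two
  sides, their ranks and r, a whole class of matroids shares it.\<close>

lemma many_valid_separation:
  assumes E: "card E = n" "0 < n"
    and AB: "A \<union> B = E" "A \<inter> B = {}" and k: "rk A + rk B < rk E + k"
    and A: "k + 2 \<le> card A" and B: "k + 2 \<le> card B" and kr: "k + 2 \<le> rk E"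
    and Z: "Z = {X \<in> rsets E (rk E). rk A < card (X \<inter> A) \<or> rk B < card (X \<inter> B)}"
    and g: "n * g \<le> (n - 2 * (k + 2)) choose (rk E - (k + 2))"
    and s: "s = K * (2 * t)" and t: "0 < t"
    and \<theta>: "\<theta> \<le> (rk E - 1) * (t choose 2)" "\<theta> \<le> (card E - rk E - 1) * (t choose 2)"
  shows "2 ^ g \<le> card {T. valid s K \<theta> Z T}" "Z \<subseteq> nonbases"
proof -
  define m where "m = k + 2"
  define W where "W = {X \<in> rsets E (rk E). Suc (rk A) < card (X \<inter> A) \<or> Suc (rk B) < card (X \<inter> B)}"
  show Zn: "Z \<subseteq> nonbases"
  proof
    fix X assume X: "X \<in> Z"
    then have Xr: "X \<in> rsets E (rk E)" "finite X" "card X = rk E"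
      using finite_subset_E by (auto simp: Z rsets_def)
    have "rk X \<noteq> card X"
    proof
      assume i: "rk X = card X"
      have "rk (X \<inter> A) = card (X \<inter> A)" "rk (X \<inter> B) = card (X \<inter> B)"
        using rk_subset_indep[OF Xr(2) i] by auto
      moreover have "rk (X \<inter> A) \<le> rk A" "rk (X \<inter> B) \<le> rk B" by (auto intro: rk_mono)
      ultimately show False using X by (auto simp: Z)
    qed
    then show "X \<in> nonbases" using Xr rk_le_card[of X] by (auto simp: nonbases_def)
  qed
  have WZ: "W \<subseteq> Z" by (auto simp: W_def Z)
  have adjZ: "Y \<in> Z" if XY: "X \<in> W" "Y \<in> near" "adj Y X" for X Y
  proof -
    obtain u v where uv: "u \<in> Y" "v \<notin> Y" "X = insert v (Y - {u})" using XY(3) unfolding adj_def by blast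
    have Y: "Y \<in> rsets E (rk E)" "finite Y" using XY nearD[of Y] by (auto simp: near_def)
    have "card (X \<inter> S) \<le> Suc (card (Y \<inter> S))" for S
    proof -
      have "card (X \<inter> S) \<le> card (insert v (Y \<inter> S))" using uv Y by (intro card_mono) auto
      also have "\<dots> \<le> Suc (card (Y \<inter> S))" using card_insert_le_m1[of "Suc (card (Y \<inter> S))" "Y \<inter> S" v] by simp
      finally show ?thesis .
    qed
    then have "card (X \<inter> A) \<le> Suc (card (Y \<inter> A))" "card (X \<inter> B) \<le> Suc (card (Y \<inter> B))" by auto
    moreover have "Suc (rk A) < card (X \<inter> A) \<or> Suc (rk B) < card (X \<inter> B)" using XY by (simp add: W_def)
    ultimately have "rk A < card (Y \<inter> A) \<or> rk B < card (Y \<inter> B)" by linarith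
    then show ?thesis using Y by (simp add: Z)
  qed
  have fAB: "finite A" "finite B" using AB finite_E by auto
  obtain A0 where A0: "A0 \<subseteq> A" "card A0 = m" using A obtain_subset_with_card_n m_def by metis
  obtain B0 where B0: "B0 \<subseteq> B" "card B0 = m" using B obtain_subset_with_card_n m_def by metis
  have fin0: "finite A0" "finite B0" using A0 B0 fAB finite_subset by blast+
  \<comment> \<open>The sizes of \<open>(Y \<union> A0) \<inter> A\<close> and
    \<open>(Y \<union> B0) \<inter> B\<close> add up to r + m = r + k + 2, which exceeds
    \<open>(rk A + 1) + (rk B + 1)\<close>. So one of the two completions of \<open>Y\<close> lies
    in \<open>W\<close>, and \<open>Y\<close> is recovered by deleting \<open>A0\<close> and
    \<open>B0\<close>.\<close>
  define V0 where "V0 = rsets (E - A0 - B0) (rk E - m)"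
  define f where "f Y = (if Y \<union> A0 \<in> W then Y \<union> A0 else Y \<union> B0)" for Y
  have inW: "f Y \<in> W \<and> Y = f Y - (A0 \<union> B0)" if Y: "Y \<in> V0" for Y
  proof -
    have Y': "Y \<subseteq> E" "Y \<inter> A0 = {}" "Y \<inter> B0 = {}" "card Y = rk E - m" "finite Y"
      using Y finite_subset_E by (auto simp: V0_def rsets_def)
    have dis: "A0 \<inter> B0 = {}" "A0 \<inter> B = {}" "B0 \<inter> A = {}" using A0 B0 AB by auto
    have rs: "Y \<union> A0 \<in> rsets E (rk E)" "Y \<union> B0 \<in> rsets E (rk E)"
      using Y' A0 B0 fin0 AB kr by (auto simp: rsets_def m_def card_Un_disjoint)
    have cA: "card ((Y \<union> A0) \<inter> A) = card (Y \<inter> A) + m"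
    proof -
      have "(Y \<union> A0) \<inter> A = (Y \<inter> A) \<union> A0" using A0 by auto
      then show ?thesis using Y' fin0 A0(2) by (simp add: card_Un_disjoint Int_commute Int_left_commute inf_assoc)
    qed
    have cB: "card ((Y \<union> B0) \<inter> B) = card (Y \<inter> B) + m"
    proof -
      have "(Y \<union> B0) \<inter> B = (Y \<inter> B) \<union> B0" using B0 by auto
      then show ?thesis using Y' fin0 B0(2) by (simp add: card_Un_disjoint Int_commute Int_left_commute inf_assoc)
    qed
    have "card Y = card (Y \<inter> A) + card (Y \<inter> B)"
    proof -
      have "Y = (Y \<inter> A) \<union> (Y \<inter> B)" using Y' AB by auto
      then show ?thesis using Y' AB by (subst card_Un_disjoint[symmetric]) auto
    qed
    then have "Suc (rk A) < card (Y \<inter> A) + m \<or> Suc (rk B) < card (Y \<inter> B) + m"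
      using Y' k kr by (simp add: m_def) linarith
    then have "f Y \<in> W" using rs cA cB by (auto simp: f_def W_def)
    moreover have "Y = f Y - (A0 \<union> B0)" using Y' by (auto simp: f_def)
    ultimately show ?thesis by simp
  qed
  have "inj_on f V0" using inW by (metis inj_onI)
  moreover have "f ` V0 \<subseteq> W" using inW by auto
  moreover have "finite W" using finite_rsets[OF finite_E] by (simp add: W_def)
  ultimately have "card V0 \<le> card W" by (rule card_inj_on_le)
  moreover have "card V0 = (n - 2 * m) choose (rk E - m)"
  proof -
    have "card (E - A0 - B0) = n - 2 * m"
    proof -
      have "E - A0 - B0 = E - (A0 \<union> B0)" by auto
      moreover have "card (A0 \<union> B0) = 2 * m" using A0 B0 fin0 AB by (subst card_Un_disjoint) auto
      ultimately show ?thesis using A0(1) B0(1) AB E fin0 card_Diff_subset[of "A0 \<union> B0" E] by auto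
    qed
    then show ?thesis unfolding V0_def using finite_E by (simp add: card_rsets)
  qed
  ultimately have "n * g \<le> card W" using g by (simp add: m_def)
  then show "2 ^ g \<le> card {T. valid s K \<theta> Z T}"
    using many_valid_interior[OF E Zn WZ _ _ s t \<theta>] adjZ by blast
qed

end

section \<open>Binomial coefficients\<close>

lemma binomial_delete:
  assumes "4 * r \<le> 3 * n" "10 * q \<le> n"
  shows "n choose r \<le> 6 ^ q * ((n - q) choose r)"
  using assms(2)
proof (induction q)
  case (Suc q)
  have "(n - q - r) * ((n - q) choose r) = (n - q) * ((n - q - 1) choose r)" by (rule binomial_absorb_comp)
  \<comment> \<open>The extreme case r = 3n/4, q = n/10 has ratio (9/10) / (3/20) = 6.\<close>
  moreover have "n - q \<le> 6 * (n - q - r)" "0 < n - q - r"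
  proof -
    have p: "10 * q + 10 \<le> n" using Suc.prems by simp
    have "q + r \<le> n" using assms(1) p by linarith
    then obtain d where d: "n = q + r + d" using le_Suc_ex by blast
    then have "n - q = r + d" "n - q - r = d" by auto
    moreover have "r + 5 \<le> 5 * d"
    proof -
      have "r \<le> 3 * q + 3 * d" "9 * q + 10 \<le> r + d" using assms(1) p unfolding d by simp_all
      then show ?thesis by linarith
    qed
    then have "r + d \<le> 6 * d" "0 < d" by simp_all
    ultimately show "n - q \<le> 6 * (n - q - r)" "0 < n - q - r" by simp_all
  qed
  ultimately have "(n - q - r) * ((n - q) choose r) \<le> (n - q - r) * (6 * ((n - q - 1) choose r))"
    using mult_le_mono1[of "n - q" "6 * (n - q - r)" "(n - q - 1) choose r"] by (simp add: ac_simps)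
  then have "(n - q) choose r \<le> 6 * ((n - Suc q) choose r)" using \<open>0 < n - q - r\<close> by simp
  then have "6 ^ q * ((n - q) choose r) \<le> 6 ^ Suc q * ((n - Suc q) choose r)" by simp
  moreover have "n choose r \<le> 6 ^ q * ((n - q) choose r)" using Suc by simp
  ultimately show ?case by linarith
qed simp

lemma binomial_delete_both:
  assumes "n \<le> 4 * r" "4 * r \<le> 3 * n" "8 * m \<le> n"
  shows "n choose r \<le> 36 ^ m * ((n - 2 * m) choose (r - m))"
  using assms(3)
proof (induction m)
  case (Suc m)
  define a b where "a = n - 2 * m" and "b = r - m"
  \<comment> \<open>One factor 6 for an element of the r-set and one for an element of its
    complement. At m = n/8 the ground set has 3n/4 elements left, and both parts have at least
    n/8.\<close>
  have ab: "1 \<le> b" "b \<le> a - 1" "a \<le> 6 * b" "a - 1 \<le> 6 * (a - b)" "2 \<le> a" "0 < a - b"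
  proof -
    have p: "8 * m + 8 \<le> n" using Suc.prems by simp
    have "m \<le> r" using assms(1) p by linarith
    then obtain b' where b': "r = m + b'" using le_Suc_ex by blast
    have "4 * m + 4 * b' \<le> 3 * n" using assms(2) unfolding b' by simp
    then have "2 * m + b' \<le> n" using p by linarith
    then obtain c where c: "n = 2 * m + b' + c" using le_Suc_ex by blast
    have ab: "b = b'" "a = b' + c" by (auto simp: a_def b_def b' c)
    have i: "c \<le> 2 * m + 3 * b'" "b' \<le> 2 * m + 3 * c" "6 * m + 8 \<le> b' + c"
      using assms(1,2) p unfolding b' c by simp_all
    have "3 * c \<le> 3 * (2 * m + 3 * b')" "3 * b' \<le> 3 * (2 * m + 3 * c)" using i(1,2) by simp_all
    then have j: "2 * c + 8 \<le> 10 * b'" "2 * b' + 8 \<le> 10 * c" using i(3) by simp_all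
    from j have "1 \<le> b'" "1 \<le> c" "b' + c \<le> 6 * b'" "b' + c \<le> 6 * c" by simp_all
    then show "1 \<le> b" "b \<le> a - 1" "a \<le> 6 * b" "a - 1 \<le> 6 * (a - b)" "2 \<le> a" "0 < a - b"
      unfolding ab by simp_all
  qed
  have "b * (a choose b) = a * ((a - 1) choose (b - 1))"
    using binomial_absorption[of "b - 1" a] ab by simp
  also have "\<dots> \<le> 6 * b * ((a - 1) choose (b - 1))" using ab by (intro mult_le_mono1)
  finally have "b * (a choose b) \<le> b * (6 * ((a - 1) choose (b - 1)))" by (simp add: ac_simps)
  then have 1: "a choose b \<le> 6 * ((a - 1) choose (b - 1))" using ab by simp
  have "(a - 1 - (b - 1)) * ((a - 1) choose (b - 1)) = (a - 1) * ((a - 1 - 1) choose (b - 1))"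
    by (rule binomial_absorb_comp)
  moreover have "a - 1 - (b - 1) = a - b" using ab by simp
  ultimately have "(a - b) * ((a - 1) choose (b - 1)) \<le> 6 * (a - b) * ((a - 2) choose (b - 1))"
    using ab by (metis Suc_1 diff_diff_left mult_le_mono1 plus_1_eq_Suc)
  then have "(a - b) * ((a - 1) choose (b - 1)) \<le> (a - b) * (6 * ((a - 2) choose (b - 1)))" by (simp add: ac_simps)
  then have 2: "(a - 1) choose (b - 1) \<le> 6 * ((a - 2) choose (b - 1))" using ab by simp
  have "a choose b \<le> 36 * ((a - 2) choose (b - 1))" using 1 2 by linarith
  moreover have "a - 2 = n - 2 * Suc m" "b - 1 = r - Suc m" by (auto simp: a_def b_def)
  ultimately have "36 ^ m * ((n - 2 * m) choose (r - m)) \<le> 36 ^ Suc m * ((n - 2 * Suc m) choose (r - Suc m))"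
    by (simp add: a_def b_def)
  moreover have "n choose r \<le> 36 ^ m * ((n - 2 * m) choose (r - m))" using Suc by simp
  ultimately show ?case by linarith
qed simp

lemma binomial_exponential:
  assumes "n \<le> 4 * r" "4 * r \<le> 3 * n"
  shows "2 powr (real n / 4) \<le> real (n choose r)"
proof -
  have half: "2 powr (real n / 4) \<le> real (n choose k)" if k: "n \<le> 4 * k" "2 * k \<le> n" for k
  proof (cases "k = 0")
    case False
    have "(2::real) powr (real n / 4) \<le> 2 powr real k" using k by simp
    also have "\<dots> = 2 ^ k" by (simp add: powr_realpow)
    also have "\<dots> \<le> (real n / real k) ^ k" using k False by (intro power_mono) (auto simp: field_simps)
    also have "\<dots> \<le> real (n choose k)" using k by (intro binomial_ge_n_over_k_pow_k) auto
    finally show ?thesis .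
  qed (use k in auto)
  show ?thesis
  proof (cases "2 * r \<le> n")
    case False
    then have "2 powr (real n / 4) \<le> real (n choose (n - r))" using assms by (intro half) linarith+
    then show ?thesis using binomial_symmetric[of r n] assms by simp
  qed (use half assms in auto)
qed

section \<open>Choice of the parameters\<close>

text \<open>\<open>K\<close> is of order n^(1/5), t of order n^(3/5), s of order n^(4/5) and
  \<open>\<theta>\<close> of order n t^2 = n^(11/5). Then s^2, K n and \<open>\<theta> / n\<close>
  are all at least of order n^(6/5), so every list costs at most about N log n / n^(6/5) bits, while
  s is small enough for (n + 1)^s to be 2^o(n).\<close>

definition base_param :: "nat \<Rightarrow> nat" where "base_param n = nat \<lfloor>real n powr (1 / 5)\<rfloor>"
definition t_param :: "nat \<Rightarrow> nat" where "t_param n = base_param n ^ 3"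
definition s_param :: "nat \<Rightarrow> nat" where "s_param n = base_param n * (2 * t_param n)"
definition \<theta>_param :: "nat \<Rightarrow> nat" where "\<theta>_param n = (n div 4 - 1) * (t_param n choose 2)"
definition \<Lambda>_param :: "nat \<Rightarrow> nat \<Rightarrow> nat" where
  "\<Lambda>_param n r = 4 * (n choose r) div (s_param n * (s_param n - 1)) + 3 * (n choose r) div (base_param n * (n div 4 - 1))"
definition \<Theta>_param :: "nat \<Rightarrow> nat \<Rightarrow> nat" where "\<Theta>_param n r = (n choose r) div \<theta>_param n"

lemma param_bounds:
  "eventually (\<lambda>n. 2 \<le> base_param n \<and> real n powr (1/5) / 2 \<le> real (base_param n) \<and>
     real (base_param n) \<le> real n powr (1/5) \<and> 100 \<le> n) sequentially"
proof -
  have "eventually (\<lambda>n. real n powr (1/5) \<ge> 4 \<and> n \<ge> 100) sequentially"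
  proof (rule eventually_conj)
    show "eventually (\<lambda>n. real n powr (1/5) \<ge> 4) sequentially" by real_asymp
  qed (rule eventually_ge_at_top)
  then show ?thesis
  proof (eventually_elim)
    case (elim n)
    then have "real (base_param n) = of_int \<lfloor>real n powr (1/5)\<rfloor>" by (simp add: base_param_def)
    then have "real (base_param n) \<le> real n powr (1/5)" "real n powr (1/5) - 1 < real (base_param n)" by linarith+
    then show ?case using elim by linarith
  qed
qed

lemma powr_power: "(real n powr a) ^ k = real n powr (a * real k)" if "0 < n"
  using that by (simp add: powr_powr flip: powr_realpow)

lemma param_estimates:
  assumes n: "2 \<le> base_param n" "real n powr (1/5) / 2 \<le> real (base_param n)"
     "real (base_param n) \<le> real n powr (1/5)" "100 \<le> n"
  defines "N r \<equiv> real (n choose r)"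
  shows "real (s_param n) \<le> 2 * real n powr (4/5)"
    "real (\<Lambda>_param n r) \<le> N r * (512 * real n powr (-8/5) + 48 * real n powr (-6/5))"
    "real (n * \<Theta>_param n r) \<le> N r * (2048 * real n powr (-6/5))"
    "1 \<le> \<theta>_param n" "2 \<le> s_param n"
proof -
  define m where "m = base_param n"
  have n0: "0 < n" and m2: "2 \<le> m" using n by (auto simp: m_def)
  have s: "s_param n = 2 * m ^ 4" by (simp add: s_param_def t_param_def m_def eval_nat_numeral algebra_simps)
  have up: "real m ^ k \<le> real n powr (real k / 5)" for k
  proof -
    have "real m ^ k \<le> (real n powr (1/5)) ^ k" using n by (intro power_mono) (auto simp: m_def)
    then show ?thesis using powr_power[OF n0, of "1/5" k] by simp
  qed
  have low: "real n powr (real k / 5) / 2 ^ k \<le> real m ^ k" for k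
  proof -
    have "(real n powr (1/5) / 2) ^ k \<le> real m ^ k" using n by (intro power_mono) (auto simp: m_def)
    then show ?thesis using powr_power[OF n0, of "1/5" k] by (simp add: power_divide)
  qed
  show "real (s_param n) \<le> 2 * real n powr (4/5)" using up[of 4] by (simp add: s)
  have m4: "1 \<le> m ^ 4" using m2 by simp
  show "2 \<le> s_param n" using m4 by (simp add: s)
  have ss: "2 * real m ^ 8 \<le> real (s_param n * (s_param n - 1))"
  proof -
    have "m ^ 4 \<le> s_param n - 1" using m4 by (simp add: s)
    then have "2 * m ^ 4 * m ^ 4 \<le> s_param n * (s_param n - 1)" unfolding s by (intro mult_le_mono) auto
    then have "real (2 * m ^ 4 * m ^ 4) \<le> real (s_param n * (s_param n - 1))" by (rule of_nat_mono)
    also have "real (2 * m ^ 4 * m ^ 4) = 2 * (real m ^ 4 * real m ^ 4)" by simp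
    also have "real m ^ 4 * real m ^ 4 = real m ^ 8" by (simp flip: power_add)
    finally show ?thesis .
  qed
  have m8: "real n powr (8/5) / 256 \<le> real m ^ 8" using low[of 8] by simp
  have pos: "0 < real n powr x" for x using n0 by simp
  have inv: "1 / real n powr x = real n powr (- x)" for x using n0 by (simp add: powr_minus_divide)
  have div_le: "real (a div b) \<le> real a / c" if "0 < c" "c \<le> real b" for a b :: nat and c
  proof -
    have "real (a div b) \<le> real a / real b" by (rule of_nat_div_le_of_nat)
    also have "\<dots> \<le> real a / c" using that by (intro divide_left_mono) auto
    finally show ?thesis .
  qed
  have n8: "real n / 8 \<le> real (n div 4 - 1)"
  proof -
    have "n \<le> 8 * (n div 4 - 1)" using n(4) by linarith
    then have "real n \<le> real (8 * (n div 4 - 1))" by (rule of_nat_mono)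
    then show ?thesis by simp
  qed
  have L1: "real (4 * (n choose r) div (s_param n * (s_param n - 1))) \<le> N r * (512 * real n powr (-8/5))"
  proof -
    have "real (4 * (n choose r) div (s_param n * (s_param n - 1))) \<le> real (4 * (n choose r)) / (real n powr (8/5) / 128)"
      using ss m8 pos by (intro div_le) auto
    also have "\<dots> = N r * (512 * (1 / real n powr (8/5)))" by (simp add: N_def)
    finally show ?thesis by (simp add: inv)
  qed
  have L2: "real (3 * (n choose r) div (base_param n * (n div 4 - 1))) \<le> N r * (48 * real n powr (-6/5))"
  proof -
    have "real n powr (6/5) / 16 = (real n powr (1/5) / 2) * (real n / 8)"
      using n0 powr_mult_base[of "real n" "1/5"] by (simp add: mult.commute)
    also have "\<dots> \<le> real (base_param n * (n div 4 - 1))"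
      using n(2) n8 n0 unfolding of_nat_mult by (intro mult_mono) auto
    finally have "real (3 * (n choose r) div (base_param n * (n div 4 - 1))) \<le> real (3 * (n choose r)) / (real n powr (6/5) / 16)"
      using pos by (intro div_le) auto
    also have "\<dots> = N r * (48 * (1 / real n powr (6/5)))" by (simp add: N_def)
    finally show ?thesis by (simp add: inv)
  qed
  show "real (\<Lambda>_param n r) \<le> N r * (512 * real n powr (-8/5) + 48 * real n powr (-6/5))"
    using L1 L2 by (simp add: \<Lambda>_param_def distrib_left)
  have t2: "2 \<le> t_param n"
  proof -
    have "2 ^ 3 \<le> m ^ 3" using m2 by (intro power_mono) auto
    then show ?thesis by (simp add: t_param_def m_def)
  qed
  have ct: "real m ^ 6 / 4 \<le> real (t_param n choose 2)"
  proof -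
    have "real (t_param n choose 2) = real (t_param n) * (real (t_param n) - 1) / 2"
      using t2 by (simp add: choose_two real_of_nat_div even_mult_iff of_nat_diff)
    moreover have "real (t_param n) / 2 \<le> real (t_param n) - 1" using t2 by simp
    then have "real (t_param n) * (real (t_param n) / 2) \<le> real (t_param n) * (real (t_param n) - 1)"
      by (intro mult_left_mono) auto
    moreover have "real (t_param n) * real (t_param n) = real m ^ 6"
      by (simp add: t_param_def m_def flip: power_add)
    ultimately show ?thesis by simp
  qed
  have th: "real n powr (11/5) / 2048 \<le> real (\<theta>_param n)"
  proof -
    have "real n powr (11/5) / 2048 = (real n / 8) * (real n powr (6/5) / 64 / 4)"
      using n0 powr_mult_base[of "real n" "6/5"] by simp
    also have "\<dots> \<le> real (n div 4 - 1) * real (t_param n choose 2)"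
      using n8 ct low[of 6] n0 by (intro mult_mono) auto
    finally show ?thesis by (simp add: \<theta>_param_def)
  qed
  show "1 \<le> \<theta>_param n" using th pos[of "11/5"] by (cases "\<theta>_param n = 0") auto
  have "real (n * \<Theta>_param n r) \<le> real n * (real (n choose r) / (real n powr (11/5) / 2048))"
    unfolding \<Theta>_param_def of_nat_mult using th pos by (intro mult_left_mono div_le) auto
  also have "\<dots> = N r * (2048 * (real n * (1 / real n powr (11/5))))" by (simp add: N_def)
  also have "real n * (1 / real n powr (11/5)) = real n powr (- 6/5)"
    unfolding inv using n0 powr_mult_base[of "real n" "- (11/5)"] by simp
  finally show "real (n * \<Theta>_param n r) \<le> N r * (2048 * real n powr (-6/5))" .
qed

text \<open>The factor 2^n pays for the basis in \<open>class_count\<close>. The exponent 1.1 lies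
  between 1 and 6/5: the gap to 6/5 absorbs the logarithm and the constants. The (n + 1)^s bits for
  cocircuits are negligible because N is at least 2^(n/4).\<close>

lemma card_sketch_space_param:
  "eventually (\<lambda>n. \<forall>r. n \<le> 4 * r \<longrightarrow> 4 * r \<le> 3 * n \<longrightarrow>
     2 ^ n * real (card (sketch_space {1..n} r (s_param n) (\<Lambda>_param n r) (\<Theta>_param n r))) *
       real (card (sketch_space {1..n} (n - r) (s_param n) (\<Lambda>_param n r) (\<Theta>_param n r)))
     \<le> 2 powr (real (n choose r) / real n powr 1.1)) sequentially"
proof -
  have ev1: "eventually (\<lambda>n::nat. real n + 8 + 2 * exp (2 * real n powr (4/5) * ln (real n + 1))
      \<le> 2 powr (real n / 4) * (1 / 2 / real n powr 1.1)) sequentially"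
    by real_asymp
  have ev2: "eventually (\<lambda>n::nat. 4 * (512 * real n powr (-8/5) + 48 * real n powr (-6/5)) * log 2 (real n) + 24 / real n ^ 2
      + 4 * (2048 * real n powr (-6/5)) \<le> 1 / 2 / real n powr 1.1) sequentially"
    by real_asymp
  show ?thesis
    using param_bounds ev1 ev2
  proof eventually_elim
    case (elim n)
    have n: "2 \<le> base_param n" "real n powr (1/5) / 2 \<le> real (base_param n)"
     "real (base_param n) \<le> real n powr (1/5)" "100 \<le> n" using elim by auto
    note est = param_estimates[OF n]
    show ?case
    proof (intro allI impI)
      fix r assume r: "n \<le> 4 * r" "4 * r \<le> 3 * n"
      define N where "N = real (n choose r)"
      define L where "L = \<Lambda>_param n r"
      define T where "T = \<Theta>_param n r"
      define s where "s = s_param n"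
      define B where "B = 2 ^ ((n + 1) ^ s) * (real n ^ (2 * L) * exp (6 * N / real n ^ 2)) * (3 * 2 ^ (n * T)) * (3 * 2 ^ (n * T))"
      have n0: "0 < n" using n by simp
      have rn: "r \<le> n" "4 * (n - r) \<le> 3 * n" using r by linarith+
      have sym: "n choose (n - r) = n choose r" using binomial_symmetric[OF rn(1)] by simp
      have S1: "real (card (sketch_space {1..n} r s L T)) \<le> B"
        unfolding B_def N_def using n r by (intro card_sketch_space) auto
      have S2: "real (card (sketch_space {1..n} (n - r) s L T)) \<le> B"
        unfolding B_def N_def sym[symmetric] using n rn by (intro card_sketch_space) auto
      have e2: "exp (6 * N / real n ^ 2) \<le> 2 powr (12 * N / real n ^ 2)"
      proof -
        have "1 \<le> ln (4::real)" using exp_le by (subst ln_ge_iff) auto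
        also have "ln (4::real) = 2 * ln 2" using ln_realpow[of 2 2] by simp
        finally have "6 \<le> 12 * ln (2::real)" by linarith
        then have "(6 * N / real n ^ 2) \<le> (12 * N / real n ^ 2) * ln 2"
          using mult_right_mono[of 6 "12 * ln 2" "N / real n ^ 2"] by (simp add: N_def ac_simps)
        then show ?thesis by (simp add: powr_def)
      qed
      have "B \<le> 2 powr real ((n + 1) ^ s) * (2 powr (2 * L * log 2 (real n)) * 2 powr (12 * N / real n ^ 2)) *
           (2 powr (2 + real (n * T))) * (2 powr (2 + real (n * T)))"
        unfolding B_def
      proof (intro mult_mono)
        show "2 ^ (n + 1) ^ s \<le> 2 powr real ((n + 1) ^ s)" by (simp add: powr_realpow del: of_nat_power)
        have "2 powr (real (2 * L) * log 2 (real n)) = (2 powr log 2 (real n)) powr real (2 * L)"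
          by (simp add: powr_powr mult.commute)
        also have "2 powr log 2 (real n) = real n" using n0 by simp
        also have "real n powr real (2 * L) = real n ^ (2 * L)" by (rule powr_realpow) (use n0 in simp)
        finally show "real n ^ (2 * L) \<le> 2 powr (2 * L * log 2 (real n))" by simp
        show "exp (6 * N / real n ^ 2) \<le> 2 powr (12 * N / real n ^ 2)" by (rule e2)
        have "3 * 2 ^ (n * T) \<le> 4 * (2::real) ^ (n * T)" by simp
        also have "\<dots> = 2 powr (2 + real (n * T))" by (simp add: powr_add powr_realpow del: of_nat_mult)
        finally have "3 * 2 ^ (n * T) \<le> 2 powr (2 + real (n * T))" .
        then show "3 * 2 ^ (n * T) \<le> 2 powr (2 + real (n * T))" "3 * 2 ^ (n * T) \<le> 2 powr (2 + real (n * T))" by this+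
      qed auto
      also have "\<dots> = 2 powr (real ((n + 1) ^ s) + 2 * L * log 2 (real n) + 12 * N / real n ^ 2 + 4 + 2 * real (n * T))" (is "_ = 2 powr ?b")
        by (simp flip: powr_add add: ac_simps)
      finally have B: "B \<le> 2 powr ?b" .
      have s_le: "real ((n + 1) ^ s) \<le> exp (2 * real n powr (4/5) * ln (real n + 1))"
      proof -
        have "real ((n + 1) ^ s) = (real n + 1) powr real s" using powr_realpow[of "real n + 1" s] by (simp add: add.commute)
        also have "\<dots> \<le> (real n + 1) powr (2 * real n powr (4/5))" using est(1) by (intro powr_mono) (auto simp: s_def)
        finally show ?thesis by (simp add: powr_def)
      qed
      have Nbig: "2 powr (real n / 4) \<le> N" using binomial_exponential[OF r] by (simp add: N_def)
      have "real n + 2 * ?b \<le> real n + 8 + 2 * exp (2 * real n powr (4/5) * ln (real n + 1)) +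
          (4 * (real L * log 2 (real n)) + 24 * N / real n ^ 2 + 4 * real (n * T))" using s_le by simp
      also have "\<dots> \<le> N * (1 / 2 / real n powr 1.1) + N * (1 / 2 / real n powr 1.1)"
      proof (rule add_mono)
        have "real n + 8 + 2 * exp (2 * real n powr (4/5) * ln (real n + 1)) \<le> 2 powr (real n / 4) * (1 / 2 / real n powr 1.1)"
          using elim by simp
        also have "\<dots> \<le> N * (1 / 2 / real n powr 1.1)" using Nbig by (intro mult_right_mono) auto
        finally show "real n + 8 + 2 * exp (2 * real n powr (4/5) * ln (real n + 1)) \<le> N * (1 / 2 / real n powr 1.1)" .
        have "real L * log 2 (real n) \<le> N * (512 * real n powr (-8/5) + 48 * real n powr (-6/5)) * log 2 (real n)"
          using est(2)[of r] n by (intro mult_right_mono) (auto simp: L_def N_def)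
        moreover have "real (n * T) \<le> N * (2048 * real n powr (-6/5))" using est(3)[of r] by (simp only: T_def N_def)
        ultimately have "4 * (real L * log 2 (real n)) + 24 * N / real n ^ 2 + 4 * real (n * T) \<le>
          4 * (N * (512 * real n powr (-8/5) + 48 * real n powr (-6/5)) * log 2 (real n)) + 24 * N / real n ^ 2 + 4 * (N * (2048 * real n powr (-6/5)))"
          by linarith
        also have "\<dots> = N * (4 * (512 * real n powr (-8/5) + 48 * real n powr (-6/5)) * log 2 (real n) + 24 / real n ^ 2
            + 4 * (2048 * real n powr (-6/5)))" by (simp add: algebra_simps)
        also have "\<dots> \<le> N * (1 / 2 / real n powr 1.1)" using elim by (intro mult_left_mono) (auto simp: N_def)
        finally show "4 * (real L * log 2 (real n)) + 24 * N / real n ^ 2 + 4 * real (n * T) \<le> N * (1 / 2 / real n powr 1.1)" .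
      qed
      finally have fin: "real n + 2 * ?b \<le> N / real n powr 1.1" by simp
      have "2 ^ n * real (card (sketch_space {1..n} r s L T)) * real (card (sketch_space {1..n} (n - r) s L T)) \<le> 2 powr real n * B * B"
        using S1 S2 by (intro mult_mono) (auto simp: powr_realpow intro: order_trans)
      also have "\<dots> \<le> 2 powr real n * 2 powr ?b * 2 powr ?b"
        using B S1 by (intro mult_mono) (auto intro: order_trans[rotated])
      also have "\<dots> = 2 powr (real n + 2 * ?b)"
        unfolding powr_add[symmetric] by (rule arg_cong[where f = "\<lambda>x. 2 powr x"]) simp
      also have "\<dots> \<le> 2 powr (N / real n powr 1.1)" using fin by simp
      finally show "2 ^ n * real (card (sketch_space {1..n} r (s_param n) (\<Lambda>_param n r) (\<Theta>_param n r))) *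
       real (card (sketch_space {1..n} (n - r) (s_param n) (\<Lambda>_param n r) (\<Theta>_param n r)))
     \<le> 2 powr (real (n choose r) / real n powr 1.1)" by (simp add: s_def L_def T_def N_def)
    qed
  qed
qed

section \<open>Rare classes of matroids\<close>

abbreviation matroid_count :: "nat \<Rightarrow> real" where
  "matroid_count n \<equiv> real (card {I. matroid {1..n} I})"

definition mid_rank :: "nat \<Rightarrow> nat \<Rightarrow> bool" where
  "mid_rank n r \<longleftrightarrow> n \<le> 4 * r \<and> 4 * r \<le> 3 * n"

text \<open>\<open>r\<close> is tied to \<open>rk E\<close> only by the binomial coefficient, so
  that the dual, of rank n - r, is covered with the same list lengths.\<close>

lemma (in rank_function) sketch_param:
  assumes n: "card E = n" "2 \<le> base_param n" "100 \<le> n" "1 \<le> \<theta>_param n" "2 \<le> s_param n"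
    and r: "mid_rank n (rk E)" and N: "n choose rk E = n choose r"
  shows "sketch (s_param n) (base_param n) (\<theta>_param n) \<in> sketch_space E (rk E) (s_param n) (\<Lambda>_param n r) (\<Theta>_param n r)"
proof (rule sketch_in_space)
  have r4: "25 \<le> rk E" "n div 4 - 1 \<le> rk E - 1" "1 \<le> n div 4 - 1" using r n by (auto simp: mid_rank_def)
  show "2 \<le> s_param n" "1 \<le> base_param n" "2 \<le> rk E" "1 \<le> \<theta>_param n" using n r4 by auto
  show "(card E choose rk E) div \<theta>_param n \<le> \<Theta>_param n r" by (simp add: n N \<Theta>_param_def)
  have "n choose (rk E - 1) \<le> 3 * (n choose r)"
    using binomial_step_down[of "rk E" n "rk E - 1"] r r4 by (simp add: mid_rank_def N)
  then have "(n choose (rk E - 1)) div (base_param n * (rk E - 1)) \<le> 3 * (n choose r) div (base_param n * (rk E - 1))"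
    by (rule div_le_mono)
  also have "\<dots> \<le> 3 * (n choose r) div (base_param n * (n div 4 - 1))"
    using r4 n by (intro div_le_mono2) auto
  finally show "4 * (card E choose rk E) div (s_param n * (s_param n - 1)) +
      (card E choose (rk E - 1)) div (base_param n * (rk E - 1)) \<le> \<Lambda>_param n r"
    by (simp add: n N \<Lambda>_param_def)
qed

text \<open>The stable families are in turn bounded by the number of matroids, through
  \<open>card_stable_le_matroids\<close>. So the estimate is relative, and no asymptotic count of
  matroids enters.\<close>

lemma class_bound:
  "eventually (\<lambda>n. \<forall>r Z g \<M>. mid_rank n r \<longrightarrow> (\<forall>I\<in>\<M>. matroid {1..n} I \<and> matroid_rank I {1..n} = r \<and>
       Z \<subseteq> rank_function.nonbases {1..n} (matroid_rank I) \<and>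
       2 ^ g \<le> card {T. rank_function.valid {1..n} (matroid_rank I) (s_param n) (base_param n) (\<theta>_param n) Z T}) \<longrightarrow>
     real (card \<M>) \<le> 2 powr (real (n choose r) / real n powr 1.1 - real g) * matroid_count n) sequentially"
  using param_bounds card_sketch_space_param
proof eventually_elim
  case (elim n)
  have n: "2 \<le> base_param n" "real n powr (1/5) / 2 \<le> real (base_param n)"
     "real (base_param n) \<le> real n powr (1/5)" "100 \<le> n" using elim(1) by auto
  note est = param_estimates[OF n]
  show ?case
  proof (intro allI impI)
    fix r Z g \<M>
    assume r: "mid_rank n r" and M: "\<forall>I\<in>\<M>. matroid {1..n} I \<and> matroid_rank I {1..n} = r \<and>
       Z \<subseteq> rank_function.nonbases {1..n} (matroid_rank I) \<and>
       2 ^ g \<le> card {T. rank_function.valid {1..n} (matroid_rank I) (s_param n) (base_param n) (\<theta>_param n) Z T}"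
    let ?S = "sketch_space {1..n} r (s_param n) (\<Lambda>_param n r) (\<Theta>_param n r)"
    let ?S' = "sketch_space {1..n} (n - r) (s_param n) (\<Lambda>_param n r) (\<Theta>_param n r)"
    have rn: "r \<le> n" "mid_rank n (n - r)" using r by (auto simp: mid_rank_def)
    have sym: "n choose (n - r) = n choose r" using binomial_symmetric[OF rn(1)] by simp
    have "card \<M> * 2 ^ g \<le> 2 ^ card {1..n} * card ?S * card ?S' * card {T. T \<subseteq> rsets {1..n} r \<and> stable_family T}"
    proof (rule class_count)
      fix I assume I: "I \<in> \<M>"
      then have mI: "matroid {1..n} I" "matroid_rank I {1..n} = r" using M by auto
      interpret R: rank_function "{1..n}" "matroid_rank I"
        using mI matroid.rank_function_matroid_rank by blast
      interpret D: rank_function "{1..n}" "corank {1..n} (matroid_rank I)" by (rule R.rank_function_corank)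
      have cE: "corank {1..n} (matroid_rank I) {1..n} = n - r" using R.corank_E_eq mI by simp
      have "R.sketch (s_param n) (base_param n) (\<theta>_param n) \<in> ?S"
        using R.sketch_param[of n r] n est(4,5) r mI by simp
      moreover have "D.sketch (s_param n) (base_param n) (\<theta>_param n) \<in> ?S'"
        using D.sketch_param[of n r] n est(4,5) rn sym cE by simp
      ultimately show "matroid {1..n} I \<and> matroid_rank I {1..n} = r \<and> Z \<subseteq> R.nonbases \<and>
        2 ^ g \<le> card {T. R.valid (s_param n) (base_param n) (\<theta>_param n) Z T} \<and>
        R.sketch (s_param n) (base_param n) (\<theta>_param n) \<in> ?S \<and> D.sketch (s_param n) (base_param n) (\<theta>_param n) \<in> ?S'"
        using M I by blast
    qed (auto intro: finite_sketch_space)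
    also have "\<dots> \<le> 2 ^ n * card ?S * card ?S' * card {I. matroid {1..n} I}"
      using card_stable_le_matroids[of "{1..n}" r] r n by (auto simp: mid_rank_def)
    finally have "real (card \<M> * 2 ^ g) \<le> real (2 ^ n * card ?S * card ?S' * card {I. matroid {1..n} I})"
      by (rule of_nat_mono)
    then have "real (card \<M>) * 2 ^ g \<le> (2 ^ n * real (card ?S) * real (card ?S')) * matroid_count n"
      by simp
    also have "\<dots> \<le> 2 powr (real (n choose r) / real n powr 1.1) * matroid_count n"
      using elim(2) r by (intro mult_right_mono) (auto simp: mid_rank_def)
    finally show "real (card \<M>) \<le> 2 powr (real (n choose r) / real n powr 1.1 - real g) * matroid_count n"
      by (simp add: powr_diff powr_realpow field_simps)
  qed
qed

text \<open>Large enough to bound \<open>k + 2\<close> for all k below sqrt(log n), and small enough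
  for 36 to this power to be n^o(1).\<close>

definition sep_bound :: "nat \<Rightarrow> nat" where
  "sep_bound n = nat \<lceil>sqrt (log 2 (real n))\<rceil> + 3"

lemma sep_bound_estimates:
  "eventually (\<lambda>n. 10 * sep_bound n \<le> n \<and> sep_bound n \<le> s_param n \<and>
     (\<forall>m\<le>sep_bound n. 36 ^ m * (2 * real m) \<le> real n powr 0.05) \<and> 36 ^ sep_bound n \<le> real n powr 0.05) sequentially"
proof -
  have e1: "eventually (\<lambda>n::nat. 36 powr (sqrt (log 2 (real n)) + 4) * (2 * (sqrt (log 2 (real n)) + 4)) \<le> real n powr 0.05) sequentially"
    by real_asymp
  have e2: "eventually (\<lambda>n::nat. 10 * (sqrt (log 2 (real n)) + 4) \<le> real n) sequentially" by real_asymp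
  have e3: "eventually (\<lambda>n::nat. sqrt (log 2 (real n)) + 4 \<le> real n powr (1/5) / 2) sequentially" by real_asymp
  show ?thesis
    using e1 e2 e3 param_bounds
  proof eventually_elim
    case (elim n)
    have pos: "0 \<le> sqrt (log 2 (real n))" using elim(4) by simp
    have L: "real (sep_bound n) \<le> sqrt (log 2 (real n)) + 4" "3 \<le> sep_bound n"
      using pos unfolding sep_bound_def by (simp_all add: of_nat_nat) linarith
    have le: "36 ^ m * (2 * real m) \<le> real n powr 0.05" if "m \<le> sep_bound n" for m
    proof -
      have "(36::real) ^ m = 36 powr real m" by (simp add: powr_realpow)
      also have "\<dots> \<le> 36 powr (sqrt (log 2 (real n)) + 4)" using that L by (intro powr_mono) auto
      finally have "36 ^ m * (2 * real m) \<le> 36 powr (sqrt (log 2 (real n)) + 4) * (2 * (sqrt (log 2 (real n)) + 4))"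
        using that L by (intro mult_mono) auto
      then show ?thesis using elim(1) by linarith
    qed
    have "(36::real) ^ sep_bound n * 1 \<le> 36 ^ sep_bound n * (2 * real (sep_bound n))" using L by (intro mult_left_mono) auto
    then have "36 ^ sep_bound n \<le> real n powr 0.05" using le[of "sep_bound n"] by linarith
    moreover have "real (10 * sep_bound n) \<le> real n" using L elim(2) by simp
    moreover have "base_param n \<le> s_param n"
    proof -
      have "1 \<le> 2 * t_param n" using elim(4) by (simp add: t_param_def)
      then show ?thesis unfolding s_param_def by simp
    qed
    then have "real (sep_bound n) \<le> real (s_param n)" using L(1) elim(3,4) by linarith
    ultimately show ?case using le by (auto simp del: of_nat_mult)
  qed
qed

text \<open>A gain of N / n^1.05 beats the loss N / n^1.1. As N is exponential in n, even 3n bits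
  are left, enough for a union bound over the 2^n subsets.\<close>

lemma gain_estimate:
  "eventually (\<lambda>n. \<forall>r g. mid_rank n r \<longrightarrow> real (n choose r) / (real n * real n powr 0.05) - 1 \<le> real g \<longrightarrow>
     real (n choose r) / real n powr 1.1 - real g \<le> - 3 * real n) sequentially"
proof -
  have e: "eventually (\<lambda>n::nat. 3 * real n + 1 \<le> 2 powr (real n / 4) * (1 / (real n * real n powr 0.05) - 1 / real n powr 1.1) \<and>
      0 \<le> 1 / (real n * real n powr 0.05) - 1 / real n powr 1.1) sequentially"
    by (rule eventually_conj) real_asymp+
  show ?thesis
    using e
  proof eventually_elim
    case (elim n)
    show ?case
    proof (intro allI impI)
      fix r g assume r: "mid_rank n r" and g: "real (n choose r) / (real n * real n powr 0.05) - 1 \<le> real g"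
      have "3 * real n + 1 \<le> real (n choose r) * (1 / (real n * real n powr 0.05) - 1 / real n powr 1.1)"
        using elim binomial_exponential[of n r] r
        by (meson mid_rank_def mult_right_mono order_trans)
      then show "real (n choose r) / real n powr 1.1 - real g \<le> - 3 * real n"
        using g by (simp add: right_diff_distrib)
    qed
  qed
qed

lemma div_ge: "real a / real b - 1 \<le> real (a div b)" if "0 < b"
proof -
  have "a < b * (a div b) + b" using mult_div_mod_eq[of b a] mod_less_divisor[OF that, of a] by linarith
  then have "real a < real b * (real (a div b) + 1)" by (simp add: algebra_simps flip: of_nat_add of_nat_mult)
  then show ?thesis using that by (simp add: field_simps)
qed

lemma hyperplane_class_bound:
  "eventually (\<lambda>n. \<forall>r H. mid_rank n r \<longrightarrow> H \<subseteq> {1..n} \<longrightarrow> 2 \<le> card ({1..n} - H) \<longrightarrow> card ({1..n} - H) \<le> sep_bound n \<longrightarrow>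
     real (card {I. matroid {1..n} I \<and> matroid_rank I {1..n} = r \<and> H \<in> rank_function.coshort {1..n} (matroid_rank I) (s_param n)})
       \<le> 2 powr (- 3 * real n) * matroid_count n) sequentially"
  using class_bound sep_bound_estimates gain_estimate param_bounds
proof eventually_elim
  case (elim n)
  show ?case
  proof (intro allI impI)
    fix r H assume r: "mid_rank n r" and H: "H \<subseteq> {1..n}" and q: "2 \<le> card ({1..n} - H)" "card ({1..n} - H) \<le> sep_bound n"
    define q where "q = card ({1..n} - H)"
    define g where "g = ((n - q) choose r) div (2 * n * q)"
    define \<M> where "\<M> = {I. matroid {1..n} I \<and> matroid_rank I {1..n} = r \<and> H \<in> rank_function.coshort {1..n} (matroid_rank I) (s_param n)}"
    have n0: "0 < n" "0 < base_param n" using elim(4) by auto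
    have q': "2 \<le> q" "q \<le> sep_bound n" "10 * q \<le> n" using q elim(2) by (auto simp: q_def)
    have "real (card \<M>) \<le> 2 powr (real (n choose r) / real n powr 1.1 - real g) * matroid_count n"
    proof (rule elim(1)[rule_format, OF r])
      fix I assume I: "I \<in> \<M>"
      then have mI: "matroid {1..n} I" "matroid_rank I {1..n} = r" by (auto simp: \<M>_def)
      interpret R: rank_function "{1..n}" "matroid_rank I"
        using mI matroid.rank_function_matroid_rank by blast
      have HI: "H \<in> R.coshort (s_param n)" using I by (simp add: \<M>_def)
      have "2 ^ g \<le> card {T. R.valid (s_param n) (base_param n) (\<theta>_param n) {} T}"
      proof (rule R.many_valid_hyperplane[OF _ n0(1) HI])
        show "2 * n * card ({1..n} - H) * g \<le> n - card ({1..n} - H) choose matroid_rank I {1..n}"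
          unfolding mI(2) q_def[symmetric] g_def by (metis mult.commute div_times_less_eq_dividend)
        show "\<theta>_param n \<le> (matroid_rank I {1..n} - 1) * (t_param n choose 2)"
          "\<theta>_param n \<le> (card {1..n} - matroid_rank I {1..n} - 1) * (t_param n choose 2)"
          using r unfolding \<theta>_param_def mI(2) mid_rank_def by (auto intro!: mult_le_mono1)
      qed (use q n0 in \<open>auto simp: s_param_def t_param_def\<close>)
      then show "matroid {1..n} I \<and> matroid_rank I {1..n} = r \<and> {} \<subseteq> R.nonbases \<and>
        2 ^ g \<le> card {T. R.valid (s_param n) (base_param n) (\<theta>_param n) {} T}" using mI by simp
    qed
    moreover have "real (n choose r) / (real n * real n powr 0.05) - 1 \<le> real g"
    proof -
      have "real (n choose r) \<le> real (6 ^ q * ((n - q) choose r))"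
        using binomial_delete[of r n q] r q' unfolding mid_rank_def by (intro of_nat_mono) auto
      \<comment> \<open>The base is raised from 6 to 36 so that the estimate for separations can be
        reused.\<close>
      also have "\<dots> \<le> 36 ^ q * real ((n - q) choose r)" by (simp add: mult_right_mono power_mono)
      finally have 1: "real (n choose r) \<le> 36 ^ q * real ((n - q) choose r)" .
      have "real (n choose r) * (2 * real q) \<le> 36 ^ q * real ((n - q) choose r) * (2 * real q)"
        using 1 by (intro mult_right_mono) auto
      also have "\<dots> = (36 ^ q * (2 * real q)) * real ((n - q) choose r)" by simp
      also have "\<dots> \<le> real n powr 0.05 * real ((n - q) choose r)" using elim(2) q' by (intro mult_right_mono) auto
      finally have "real (n choose r) / (real n * real n powr 0.05) \<le> real ((n - q) choose r) / real (2 * n * q)"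
        using n0 q' by (simp add: field_simps)
      moreover have "real ((n - q) choose r) / real (2 * n * q) - 1 \<le> real g" unfolding g_def using n0 q' by (intro div_ge) simp
      ultimately show ?thesis by linarith
    qed
    then have "real (n choose r) / real n powr 1.1 - real g \<le> - 3 * real n" using elim(3) r by blast
    then have "2 powr (real (n choose r) / real n powr 1.1 - real g) \<le> 2 powr (- 3 * real n)" by (intro powr_mono) auto
    then have "2 powr (real (n choose r) / real n powr 1.1 - real g) * matroid_count n \<le> 2 powr (- 3 * real n) * matroid_count n"
      by (intro mult_right_mono) auto
    ultimately show "real (card {I. matroid {1..n} I \<and> matroid_rank I {1..n} = r \<and> H \<in> rank_function.coshort {1..n} (matroid_rank I) (s_param n)})
       \<le> 2 powr (- 3 * real n) * matroid_count n" unfolding \<M>_def by linarith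
  qed
qed

text \<open>Both ranks are fixed because \<open>class_bound\<close> demands one \<open>Z\<close> for
  all members.\<close>

definition sep_class :: "nat \<Rightarrow> nat \<Rightarrow> nat set \<Rightarrow> nat \<Rightarrow> nat \<Rightarrow> nat set set set" where
  "sep_class n r A \<alpha> \<beta> = {I. matroid {1..n} I \<and> matroid_rank I {1..n} = r \<and> matroid_rank I A = \<alpha> \<and> matroid_rank I ({1..n} - A) = \<beta>}"

lemma separation_class_bound:
  "eventually (\<lambda>n. \<forall>r A \<alpha> \<beta> k. mid_rank n r \<longrightarrow> A \<subseteq> {1..n} \<longrightarrow> \<alpha> + \<beta> < r + k \<longrightarrow> k + 2 \<le> card A \<longrightarrow>
     k + 2 \<le> card ({1..n} - A) \<longrightarrow> k + 2 \<le> sep_bound n \<longrightarrow>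
     real (card (sep_class n r A \<alpha> \<beta>)) \<le> 2 powr (- 3 * real n) * matroid_count n) sequentially"
  using class_bound sep_bound_estimates gain_estimate param_bounds
proof eventually_elim
  case (elim n)
  show ?case
  proof (intro allI impI)
    fix r A \<alpha> \<beta> k assume r: "mid_rank n r" and A: "A \<subseteq> {1..n}" and ab: "\<alpha> + \<beta> < r + k"
      and k: "k + 2 \<le> card A" "k + 2 \<le> card ({1..n} - A)" "k + 2 \<le> sep_bound n"
    define m where "m = k + 2"
    define B where "B = {1..n} - A"
    define g where "g = ((n - 2 * m) choose (r - m)) div n"
    define Z where "Z = {X \<in> rsets {1..n} r. \<alpha> < card (X \<inter> A) \<or> \<beta> < card (X \<inter> B)}"
    have n0: "0 < n" "0 < base_param n" using elim(4) by auto
    have m: "m \<le> sep_bound n" "10 * m \<le> n" "8 * m \<le> n" "m \<le> r" using k elim(2) r by (auto simp: m_def mid_rank_def)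
    have "real (card (sep_class n r A \<alpha> \<beta>)) \<le> 2 powr (real (n choose r) / real n powr 1.1 - real g) * matroid_count n"
    proof (rule elim(1)[rule_format, OF r])
      fix I assume I: "I \<in> sep_class n r A \<alpha> \<beta>"
      then have mI: "matroid {1..n} I" "matroid_rank I {1..n} = r" "matroid_rank I A = \<alpha>" "matroid_rank I B = \<beta>"
        by (auto simp: sep_class_def B_def)
      interpret R: rank_function "{1..n}" "matroid_rank I"
        using mI matroid.rank_function_matroid_rank by blast
      have AB: "A \<union> B = {1..n}" "A \<inter> B = {}" using A by (auto simp: B_def)
      have c: "matroid_rank I A + matroid_rank I B < matroid_rank I {1..n} + k"
        "k + 2 \<le> card A" "k + 2 \<le> card B" "k + 2 \<le> matroid_rank I {1..n}"
        "Z = {X \<in> rsets {1..n} (matroid_rank I {1..n}). matroid_rank I A < card (X \<inter> A) \<or> matroid_rank I B < card (X \<inter> B)}"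
        "n * g \<le> (n - 2 * (k + 2)) choose (matroid_rank I {1..n} - (k + 2))"
        using ab mI k m by (auto simp: B_def Z_def m_def g_def)
      have th: "s_param n = base_param n * (2 * t_param n)" "0 < t_param n"
          "\<theta>_param n \<le> (matroid_rank I {1..n} - 1) * (t_param n choose 2)"
          "\<theta>_param n \<le> (card {1..n} - matroid_rank I {1..n} - 1) * (t_param n choose 2)"
        using r n0 unfolding \<theta>_param_def mI(2) mid_rank_def by (auto intro!: mult_le_mono1 simp: s_param_def t_param_def)
      have "2 ^ g \<le> card {T. R.valid (s_param n) (base_param n) (\<theta>_param n) Z T}" "Z \<subseteq> R.nonbases"
        using R.many_valid_separation[OF _ n0(1) AB c th] by auto
      then show "matroid {1..n} I \<and> matroid_rank I {1..n} = r \<and> Z \<subseteq> R.nonbases \<and>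
        2 ^ g \<le> card {T. R.valid (s_param n) (base_param n) (\<theta>_param n) Z T}" using mI by simp
    qed
    moreover have "real (n choose r) / (real n * real n powr 0.05) - 1 \<le> real g"
    proof -
      have "real (n choose r) \<le> real (36 ^ m * ((n - 2 * m) choose (r - m)))"
        using binomial_delete_both[of n r m] r m unfolding mid_rank_def by (intro of_nat_mono) auto
      also have "\<dots> \<le> 36 ^ sep_bound n * real ((n - 2 * m) choose (r - m))"
        using m by (simp add: mult_right_mono power_increasing)
      also have "\<dots> \<le> real n powr 0.05 * real ((n - 2 * m) choose (r - m))" using elim(2) by (intro mult_right_mono) auto
      finally have "real (n choose r) / (real n * real n powr 0.05) \<le> real ((n - 2 * m) choose (r - m)) / real n"
        using n0 by (simp add: field_simps)
      moreover have "real ((n - 2 * m) choose (r - m)) / real n - 1 \<le> real g" unfolding g_def using n0 by (intro div_ge)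
      ultimately show ?thesis by linarith
    qed
    then have "real (n choose r) / real n powr 1.1 - real g \<le> - 3 * real n" using elim(3) r by blast
    then have "2 powr (real (n choose r) / real n powr 1.1 - real g) \<le> 2 powr (- 3 * real n)" by (intro powr_mono) auto
    then have "2 powr (real (n choose r) / real n powr 1.1 - real g) * matroid_count n \<le> 2 powr (- 3 * real n) * matroid_count n"
      by (intro mult_right_mono) auto
    ultimately show "real (card (sep_class n r A \<alpha> \<beta>)) \<le> 2 powr (- 3 * real n) * matroid_count n" by linarith
  qed
qed

section \<open>Ranks far from n / 2\<close>

lemma binomial_quarter_half: "2 ^ (n div 12) * (n choose (n div 4)) \<le> n choose (n div 2)"
proof -
  have "2 ^ j * (n choose (n div 4)) \<le> n choose (n div 4 + j)" if "j \<le> n div 12" for j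
    using that
  proof (induction j)
    case (Suc j)
    define i where "i = n div 4 + j"
    \<comment> \<open>This amounts to 3i + 2 \<le> n and holds since i + 1 is at most n/4 + n/12 =
      n/3.\<close>
    have i: "2 * Suc i \<le> n - i" 
      
    proof -
      obtain a b where ab: "a = n div 4" "b = n div 12" by blast
      have "a * 4 \<le> n" "b * 12 \<le> n" "Suc j \<le> b" "i = a + j"
        using Suc.prems unfolding ab i_def by (simp_all only: div_times_less_eq_dividend)
      then have "3 * i + 2 \<le> n" by presburger
      then show ?thesis by simp
    qed
    have "Suc i * (n choose Suc i) = (n - i) * (n choose i)"
      by (simp only: binomial_absorption binomial_absorb_comp)
    moreover have "2 * Suc i * (n choose i) \<le> (n - i) * (n choose i)" using i by (rule mult_le_mono1)
    ultimately have "Suc i * (2 * (n choose i)) \<le> Suc i * (n choose Suc i)" by (simp add: ac_simps)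
    then have "2 * (n choose i) \<le> n choose Suc i" by (simp only: Suc_mult_le_cancel1)
    then show ?case using Suc by (simp add: i_def)
  qed simp
  then have "2 ^ (n div 12) * (n choose (n div 4)) \<le> n choose (n div 4 + n div 12)" by simp
  also have "\<dots> \<le> n choose (n div 2)" by (rule binomial_maximum)
  finally show ?thesis .
qed

text \<open>Compare the trivial upper bound with the at least 2^(\<open>binomial n (n/2)\<close> /
  n) matroids from stable families at rank n/2: the exponents differ by an exponential
  factor.\<close>

lemma extreme_rank_bound:
  "eventually (\<lambda>n. \<forall>r\<le>n. \<not> mid_rank n r \<longrightarrow>
     real (card {I. matroid {1..n} I \<and> matroid_rank I {1..n} = r}) \<le> 2 powr (- 2 * real n) * matroid_count n) sequentially"
proof -
  have "eventually (\<lambda>n::nat. real n * (2 * real n + 2) \<le> 2 powr (real n / 12 - 1)) sequentially" by real_asymp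
  then have "eventually (\<lambda>n::nat. real n * (2 * real n + 2) \<le> 2 powr (real n / 12 - 1) \<and> 2 \<le> n) sequentially"
    by (rule eventually_conj[OF _ eventually_ge_at_top])
  then show ?thesis
  proof eventually_elim
    case (elim n)
    define g where "g = (n choose (n div 2)) div n"
    define c where "c = n choose (n div 4)"
    have n0: "0 < n" "1 \<le> n div 2" using elim by auto
    have mm: "2 ^ g \<le> card {I. matroid {1..n} I}"
      by (rule card_matroids_ge[OF _ n0(2)]) (use n0 in \<open>auto simp: g_def\<close>)
    have c1: "1 \<le> c" by (simp add: c_def Suc_leI)
    have gc: "real c - real g \<le> - 2 * real n"
    proof -
      have "real n * (2 * real n + 2) \<le> 2 powr (real n / 12 - 1)" using elim by simp
      also have "\<dots> \<le> 2 powr real (n div 12)"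
      proof -
        have "real n / 12 - 1 \<le> real (n div 12)" using div_ge[of 12 n] by simp
        then show ?thesis by (intro powr_mono) auto
      qed
      also have "\<dots> = 2 ^ (n div 12)" by (simp add: powr_realpow)
      finally have "real n * (2 * real n + 2) * real c \<le> 2 ^ (n div 12) * real c" by (intro mult_right_mono) auto
      also have "\<dots> \<le> real (n choose (n div 2))"
        using of_nat_mono[OF binomial_quarter_half[of n], where 'a = real] by (simp add: c_def)
      finally have "(2 * real n + 2) * real c \<le> real (n choose (n div 2)) / real n"
        using n0 by (simp add: field_simps)
      also have "\<dots> \<le> real g + 1" using div_ge[of n "n choose (n div 2)"] n0 by (simp add: g_def)
      finally have "(2 * real n + 2) * real c \<le> real g + 1" .
      moreover have "(2 * real n + 1) * 1 \<le> (2 * real n + 1) * real c" using c1 by (intro mult_left_mono) auto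
      ultimately show ?thesis by (simp add: algebra_simps)
    qed
    show ?case
    proof (intro allI impI)
      fix r assume r: "r \<le> n" "\<not> mid_rank n r"
      have "n choose r \<le> c"
      proof (cases "4 * r < n")
        case True
        then show ?thesis unfolding c_def by (intro binomial_mono) linarith+
      next
        case False
        then have "4 * (n - r) < n" using r by (auto simp: mid_rank_def)
        then have "n choose (n - r) \<le> c" unfolding c_def by (intro binomial_mono) linarith+
        then show ?thesis using binomial_symmetric[OF r(1)] by simp
      qed
      then have "(2::nat) ^ (n choose r) \<le> 2 ^ c" by (simp add: power_increasing)
      then have "card {I. matroid {1..n} I \<and> matroid_rank I {1..n} = r} \<le> 2 ^ c"

        using card_rank_class_le[OF finite_atLeastAtMost, of 1 n r] unfolding card_atLeastAtMost diff_Suc_1 by linarith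
      then have "real (card {I. matroid {1..n} I \<and> matroid_rank I {1..n} = r}) \<le> real (2 ^ c)" by (rule of_nat_mono)
      also have "\<dots> = 2 powr (real c - real g) * 2 ^ g" by (simp add: powr_diff powr_realpow)
      also have "\<dots> \<le> 2 powr (- 2 * real n) * matroid_count n"
      proof (rule mult_mono)
        show "2 powr (real c - real g) \<le> 2 powr (- 2 * real n)" using gc by (intro powr_mono) auto
        show "(2::real) ^ g \<le> matroid_count n" using of_nat_mono[OF mm, where 'a = real] by simp
      qed auto
      finally show "real (card {I. matroid {1..n} I \<and> matroid_rank I {1..n} = r}) \<le> 2 powr (- 2 * real n) * matroid_count n" .
    qed
  qed
qed

section \<open>Short cocircuits and the final union bound\<close>

definition short_cocircuit :: "nat \<Rightarrow> nat set set \<Rightarrow> bool" where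
  "short_cocircuit n I \<longleftrightarrow> mid_rank n (matroid_rank I {1..n}) \<and>
     (\<exists>H\<in>rank_function.coshort {1..n} (matroid_rank I) (s_param n). 1 \<le> card ({1..n} - H) \<and> card ({1..n} - H) \<le> sep_bound n)"

lemma real_card_UN_le:
  assumes "finite J" "\<And>i. i \<in> J \<Longrightarrow> real (card (F i)) \<le> b"
  shows "real (card (\<Union>i\<in>J. F i)) \<le> real (card J) * b"
proof -
  have "real (card (\<Union>i\<in>J. F i)) \<le> real (\<Sum>i\<in>J. card (F i))" by (intro of_nat_mono card_UN_le assms)
  also have "\<dots> \<le> (\<Sum>i\<in>J. b)" using assms(2) unfolding of_nat_sum by (rule sum_mono)
  finally show ?thesis by simp
qed

text \<open>A cocircuit with one element is a coloop and goes to \<open>card_coloop_class\<close>.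
  For the longer ones, the at most 2^n hyperplanes are absorbed by the bound 2^(-3n) for
  each.\<close>

lemma short_cocircuit_bound:
  "eventually (\<lambda>n. real (card {I. matroid {1..n} I \<and> short_cocircuit n I}) \<le>
     (real (n + 1) * real n * 2 powr (1 - real n / 4) + real (n + 1) * 2 powr (- 2 * real n)) * matroid_count n) sequentially"
  using hyperplane_class_bound
proof eventually_elim
  case (elim n)
  define col where "col p = {I. matroid {1..n} I \<and> matroid_rank I {1..n} = fst p \<and> matroid_rank I ({1..n} - {snd p}) < fst p}" for p
  define hyp where "hyp p = {I. matroid {1..n} I \<and> matroid_rank I {1..n} = fst p \<and> snd p \<in> rank_function.coshort {1..n} (matroid_rank I) (s_param n)}" for p
  define J1 where "J1 = {r. mid_rank n r \<and> r \<le> n} \<times> {1..n}"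
  define J2 where "J2 = {r. mid_rank n r \<and> r \<le> n} \<times> {H. H \<subseteq> {1..n} \<and> 2 \<le> card ({1..n} - H) \<and> card ({1..n} - H) \<le> sep_bound n}"
  have fin: "finite J1" "finite J2" unfolding J1_def J2_def by auto
  have cr: "card {r. mid_rank n r \<and> r \<le> n} \<le> n + 1"
    using card_mono[of "{..n}" "{r. mid_rank n r \<and> r \<le> n}"] by auto
  have cJ1: "card J1 \<le> (n + 1) * n" unfolding J1_def card_cartesian_product using mult_le_mono1[OF cr] by simp
  have cJ2: "card J2 \<le> (n + 1) * 2 ^ n"
  proof -
    have "card {H. H \<subseteq> {1..n} \<and> 2 \<le> card ({1..n} - H) \<and> card ({1..n} - H) \<le> sep_bound n} \<le> card (Pow {1..n})"
      by (intro card_mono) auto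
    then show ?thesis unfolding J2_def card_cartesian_product using mult_le_mono[OF cr] by (simp add: card_Pow)
  qed
  have "{I. matroid {1..n} I \<and> short_cocircuit n I} \<subseteq> (\<Union>p\<in>J1. col p) \<union> (\<Union>p\<in>J2. hyp p)"
  proof
    fix I assume "I \<in> {I. matroid {1..n} I \<and> short_cocircuit n I}"
    then obtain H where I: "matroid {1..n} I" "mid_rank n (matroid_rank I {1..n})" and
      H: "H \<in> rank_function.coshort {1..n} (matroid_rank I) (s_param n)" "1 \<le> card ({1..n} - H)" "card ({1..n} - H) \<le> sep_bound n"
      by (auto simp: short_cocircuit_def)
    interpret R: rank_function "{1..n}" "matroid_rank I" using I matroid.rank_function_matroid_rank by blast
    have rn: "matroid_rank I {1..n} \<le> n" using R.rk_E_le by simp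
    have HE: "H \<subseteq> {1..n}" "Suc (matroid_rank I H) = matroid_rank I {1..n}" using H(1) unfolding R.coshort_def by blast+
    show "I \<in> (\<Union>p\<in>J1. col p) \<union> (\<Union>p\<in>J2. hyp p)"
    proof (cases "card ({1..n} - H) = 1")
      case True
      then obtain e where e: "{1..n} - H = {e}" using card_1_singletonE by blast
      then have "H = {1..n} - {e}" "e \<in> {1..n}" using HE by auto
      then have "I \<in> col (matroid_rank I {1..n}, e)" "(matroid_rank I {1..n}, e) \<in> J1"
        using I HE rn by (auto simp: col_def J1_def)
      then show ?thesis by blast
    next
      case False
      then have "I \<in> hyp (matroid_rank I {1..n}, H)" "(matroid_rank I {1..n}, H) \<in> J2"
        using I H HE rn by (auto simp: hyp_def J2_def)
      then show ?thesis by blast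
    qed
  qed
  moreover have "finite ((\<Union>p\<in>J1. col p) \<union> (\<Union>p\<in>J2. hyp p))"
    by (rule finite_subset[OF _ finite_matroids[of "{1..n}"]])
      (unfold col_def hyp_def, blast, rule finite_atLeastAtMost)
  ultimately have "card {I. matroid {1..n} I \<and> short_cocircuit n I} \<le> card ((\<Union>p\<in>J1. col p) \<union> (\<Union>p\<in>J2. hyp p))"
    by (rule card_mono[rotated])
  also have "\<dots> \<le> card (\<Union>p\<in>J1. col p) + card (\<Union>p\<in>J2. hyp p)" by (rule card_Un_le)
  finally have "real (card {I. matroid {1..n} I \<and> short_cocircuit n I}) \<le> real (card (\<Union>p\<in>J1. col p)) + real (card (\<Union>p\<in>J2. hyp p))"
    by (simp only: of_nat_le_iff flip: of_nat_add)
  also have "\<dots> \<le> real (card J1) * (2 powr (1 - real n / 4) * matroid_count n) + real (card J2) * (2 powr (- 3 * real n) * matroid_count n)"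
  proof (intro add_mono real_card_UN_le fin)
    fix p assume "p \<in> J1"
    then obtain r e where p: "p = (r, e)" "mid_rank n r" "e \<in> {1..n}" by (auto simp: J1_def)
    have "card (col p) * 2 ^ (r - 1) \<le> card {I. matroid {1..n} I}"
      unfolding col_def p fst_conv snd_conv by (rule card_coloop_class) (use p in auto)
    then have "real (card (col p) * 2 ^ (r - 1)) \<le> matroid_count n" by (rule of_nat_mono)
    moreover have "2 powr (real n / 4 - 1) \<le> 2 ^ (r - 1)"
    proof -
      have "real n / 4 - 1 \<le> real (r - 1)" using p by (auto simp: mid_rank_def)
      then have "2 powr (real n / 4 - 1) \<le> 2 powr real (r - 1)" by (intro powr_mono) auto
      then show ?thesis by (simp add: powr_realpow)
    qed
    then have "real (card (col p)) * 2 powr (real n / 4 - 1) \<le> real (card (col p)) * 2 ^ (r - 1)" by (intro mult_left_mono) auto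
    ultimately have "real (card (col p)) * 2 powr (real n / 4 - 1) \<le> matroid_count n" by simp
    then have "real (card (col p)) * (2 powr (real n / 4 - 1) * 2 powr (1 - real n / 4)) \<le> 2 powr (1 - real n / 4) * matroid_count n"
      using mult_left_mono[of _ _ "2 powr (1 - real n / 4)"] by (simp add: ac_simps)
    then show "real (card (col p)) \<le> 2 powr (1 - real n / 4) * matroid_count n" by (simp flip: powr_add)
  next
    fix p assume "p \<in> J2"
    then show "real (card (hyp p)) \<le> 2 powr (- 3 * real n) * matroid_count n"
      using elim by (auto simp: J2_def hyp_def)
  qed
  also have "\<dots> \<le> (real (n + 1) * real n) * (2 powr (1 - real n / 4) * matroid_count n) +
      (real (n + 1) * 2 powr real n) * (2 powr (- 3 * real n) * matroid_count n)"
  proof (intro add_mono mult_right_mono)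
    show "real (card J1) \<le> real (n + 1) * real n" using of_nat_mono[OF cJ1, where 'a = real] by (simp add: algebra_simps)
    show "real (card J2) \<le> real (n + 1) * 2 powr real n" using of_nat_mono[OF cJ2, where 'a = real] by (simp add: powr_realpow algebra_simps)
  qed auto
  also have "\<dots> = (real (n + 1) * real n * 2 powr (1 - real n / 4) + real (n + 1) * (2 powr real n * 2 powr (- 3 * real n))) * matroid_count n"
    by (simp add: algebra_simps)
  also have "2 powr real n * 2 powr (- 3 * real n) = 2 powr (- 2 * real n)" by (simp flip: powr_add)
  finally show ?case .
qed

text \<open>If \<open>B\<close> spans, then \<open>rk A < k \<le> card A\<close>. So
  \<open>A\<close> is dependent, which means that its complement \<open>B\<close> does not span in
  the dual.\<close>

lemma (in rank_function) separation_small_side: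
  assumes AB: "A \<union> B = E" "A \<inter> B = {}" and sep: "rk A + rk B < rk E + k" and k: "k \<le> card A"
  shows "rk B < rk E \<or> corank E rk B < corank E rk E"
proof (cases "rk B < rk E")
  case False
  then have "rk A < card A" using sep k by linarith
  moreover have "E - B = A" "E \<inter> B = B" using AB by auto
  then have "corank E rk B + rk E = card B + rk A" using corank_add[of B] by simp
  moreover have "card E = card A + card B" using AB finite_E by (metis card_Un_disjoint finite_Un)
  ultimately show ?thesis using corank_E by linarith
qed simp

lemma small_side_short_cocircuit:
  assumes M: "matroid {1..n} I" and r: "mid_rank n (matroid_rank I {1..n})"
    and B: "B \<subseteq> {1..n}" "card ({1..n} - B) \<le> sep_bound n" "matroid_rank I B < matroid_rank I {1..n}"
    and s: "sep_bound n \<le> s_param n"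
  shows "short_cocircuit n I"
proof -
  interpret R: rank_function "{1..n}" "matroid_rank I" using M matroid.rank_function_matroid_rank by blast
  obtain H where H: "B \<subseteq> H" "H \<in> R.coshort (card ({1..n} - B))" "H \<noteq> {1..n}"
    using R.extend_to_hyperplane[OF B(1,3)] by blast
  have HE: "H \<subseteq> {1..n}" "card ({1..n} - H) \<le> sep_bound n"
  proof -
    have "card ({1..n} - H) \<le> card ({1..n} - B)" using H(2) unfolding R.coshort_def by blast
    then show "card ({1..n} - H) \<le> sep_bound n" using B(2) by (rule order_trans)
    show "H \<subseteq> {1..n}" using H(2) unfolding R.coshort_def by blast
  qed
  then have "{1..n} - H \<noteq> {}" using H(3) by blast
  then have "1 \<le> card ({1..n} - H)" by (simp add: Suc_leI card_gt_0_iff)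
  moreover have "H \<in> R.coshort (s_param n)" using H(2) HE s by (intro R.coshort_mono[OF H(2)]) simp
  ultimately show ?thesis using r HE by (auto simp: short_cocircuit_def)
qed

text \<open>The summands stand for extreme ranks, for short cocircuits of the matroid or its dual
  (hence the factor 2), and for separations with two large sides.\<close>

definition err :: "nat \<Rightarrow> real" where
  "err n = real (n + 1) * 2 powr (- 2 * real n) +
     2 * (real (n + 1) * real n * 2 powr (1 - real n / 4) + real (n + 1) * 2 powr (- 2 * real n)) +
     real (n + 1) ^ 4 * 2 powr (- 2 * real n)"

lemma bad_matroids_bound:
  "eventually (\<lambda>n. real (card {I. matroid {1..n} I \<and> (\<exists>k A B. real k < sqrt (log 2 (real n)) \<and> k_separation {1..n} I k A B)})
     \<le> err n * matroid_count n) sequentially"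
  using extreme_rank_bound short_cocircuit_bound separation_class_bound sep_bound_estimates
proof eventually_elim
  case (elim n)
  define Ext where "Ext = (\<Union>r\<in>{r. r \<le> n \<and> \<not> mid_rank n r}. {I. matroid {1..n} I \<and> matroid_rank I {1..n} = r})"
  define Co where "Co = {I. matroid {1..n} I \<and> short_cocircuit n I}"
  define Ci where "Ci = {I. matroid {1..n} I \<and> short_cocircuit n (dual_matroid {1..n} I)}"
  \<comment> \<open>There are at most (n + 1)^3 2^n indices, each with a class of relative size
    2^(-3n).\<close>
  define J where "J = {(r, A, \<alpha>, \<beta>) | r A \<alpha> \<beta>. r \<le> n \<and> A \<subseteq> {1..n} \<and> \<alpha> \<le> n \<and> \<beta> \<le> n \<and> mid_rank n r \<and>
     (\<exists>k. \<alpha> + \<beta> < r + k \<and> k + 2 \<le> card A \<and> k + 2 \<le> card ({1..n} - A) \<and> k + 2 \<le> sep_bound n)}"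
  define Sep where "Sep = (\<Union>(r, A, \<alpha>, \<beta>)\<in>J. sep_class n r A \<alpha> \<beta>)"
  have Jsub: "J \<subseteq> {..n} \<times> Pow {1..n} \<times> {..n} \<times> {..n}" by (auto simp: J_def)
  then have finJ: "finite J" by (rule finite_subset) simp
  have cJ: "real (card J) \<le> real (n + 1) ^ 3 * 2 powr real n"
  proof -
    have "card J \<le> card ({..n} \<times> Pow {1..n} \<times> {..n} \<times> {..n})" using Jsub by (intro card_mono) auto
    also have "\<dots> = (n + 1) ^ 3 * 2 ^ n" by (simp add: card_cartesian_product card_Pow power3_eq_cube algebra_simps)
    finally have "real (card J) \<le> real ((n + 1) ^ 3 * 2 ^ n)" by (rule of_nat_mono)
    then show ?thesis by (simp add: powr_realpow)
  qed
  have "{I. matroid {1..n} I \<and> (\<exists>k A B. real k < sqrt (log 2 (real n)) \<and> k_separation {1..n} I k A B)} \<subseteq> Ext \<union> Co \<union> Ci \<union> Sep"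
  proof
    fix I assume "I \<in> {I. matroid {1..n} I \<and> (\<exists>k A B. real k < sqrt (log 2 (real n)) \<and> k_separation {1..n} I k A B)}"
    then obtain k A B where I: "matroid {1..n} I" and k: "real k < sqrt (log 2 (real n))" and sep: "k_separation {1..n} I k A B" by blast
    interpret R: rank_function "{1..n}" "matroid_rank I" using I matroid.rank_function_matroid_rank by blast
    have kL: "k + 2 \<le> sep_bound n" using k unfolding sep_bound_def by linarith
    have AB: "A \<union> B = {1..n}" "A \<inter> B = {}" "matroid_rank I A + matroid_rank I B < matroid_rank I {1..n} + k" "k \<le> card A" "k \<le> card B"
      using sep by (auto simp: k_separation_def k_separating_def)
    have le: "matroid_rank I X \<le> n" for X
    proof -
      have "matroid_rank I X \<le> card {1..n}"
        by (rule matroid.rank_leI[OF I]) (rule card_mono[OF finite_atLeastAtMost matroid.indep_subset_ground[OF I]])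
      then show ?thesis by simp
    qed
    show "I \<in> Ext \<union> Co \<union> Ci \<union> Sep"
    proof (cases "mid_rank n (matroid_rank I {1..n})")
      case False
      then show ?thesis using I le[of "{1..n}"] by (auto simp: Ext_def)
    next
      case mid: True
      have B_eq: "B = {1..n} - A" using AB by auto
      show ?thesis
      proof (cases "k + 2 \<le> card A \<and> k + 2 \<le> card B")
        case True
        then have "(matroid_rank I {1..n}, A, matroid_rank I A, matroid_rank I B) \<in> J"
          using AB kL mid le unfolding J_def B_eq by blast
        moreover have "I \<in> sep_class n (matroid_rank I {1..n}) A (matroid_rank I A) (matroid_rank I B)"
          using I by (simp add: sep_class_def B_eq)
        ultimately show ?thesis unfolding Sep_def by blast
      next
        case False
        \<comment> \<open>The complement of a side with at most k + 1 elements is nonspanning in the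
          matroid or in its dual; a hyperplane around it leaves a cocircuit with at most k + 1
          elements.\<close>
        have side: "I \<in> Co \<union> Ci" if XY: "X \<union> Y = {1..n}" "X \<inter> Y = {}" "matroid_rank I X + matroid_rank I Y < matroid_rank I {1..n} + k"
           "k \<le> card X" "card X \<le> k + 1" for X Y
        proof -
          have Y: "Y \<subseteq> {1..n}" "{1..n} - Y = X" using XY by auto
          have cX: "card ({1..n} - Y) \<le> sep_bound n" using Y XY kL by simp
          have s: "sep_bound n \<le> s_param n" using elim(4) by simp
          consider "matroid_rank I Y < matroid_rank I {1..n}" | "corank {1..n} (matroid_rank I) Y < corank {1..n} (matroid_rank I) {1..n}"
            using R.separation_small_side[OF XY(1-4)] by blast
          then show ?thesis
          proof cases
            case 1
            then have "short_cocircuit n I" by (rule small_side_short_cocircuit[OF I mid Y(1) cX _ s])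
            then show ?thesis using I by (simp add: Co_def)
          next
            case 2
            let ?D = "dual_matroid {1..n} I"
            have "matroid_rank ?D {1..n} + matroid_rank I {1..n} = n" using rank_dual_E[OF I] by simp
            then have "mid_rank n (matroid_rank ?D {1..n})" using mid unfolding mid_rank_def by linarith
            moreover have "matroid_rank ?D Y < matroid_rank ?D {1..n}" using 2 Y rank_dual[OF I] by simp
            ultimately have "short_cocircuit n ?D" by (rule small_side_short_cocircuit[OF matroid_dual[OF I] _ Y(1) cX _ s])
            then show ?thesis using I by (simp add: Ci_def)
          qed
        qed
        consider "card A \<le> k + 1" | "card B \<le> k + 1" using False by linarith
        then have "I \<in> Co \<union> Ci"
        proof cases
          case 1 then show ?thesis by (rule side[OF AB(1-4)])
        next
          case 2
          have "B \<union> A = {1..n}" "B \<inter> A = {}" "matroid_rank I B + matroid_rank I A < matroid_rank I {1..n} + k" using AB by auto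
          then show ?thesis using side[OF _ _ _ AB(5) 2] by blast
        qed
        then show ?thesis by blast
      qed
    qed
  qed
  moreover have "finite (Ext \<union> Co \<union> Ci \<union> Sep)"
    by (rule finite_subset[OF _ finite_matroids[of "{1..n}"]]) (auto simp: Ext_def Co_def Ci_def Sep_def sep_class_def)
  ultimately have "card {I. matroid {1..n} I \<and> (\<exists>k A B. real k < sqrt (log 2 (real n)) \<and> k_separation {1..n} I k A B)} \<le> card (Ext \<union> Co \<union> Ci \<union> Sep)"
    by (rule card_mono[rotated])
  also have "\<dots> \<le> card Ext + card Co + card Ci + card Sep"
    using card_Un_le[of Ext Co] card_Un_le[of "Ext \<union> Co" Ci] card_Un_le[of "Ext \<union> Co \<union> Ci" Sep] by linarith
  also have "card Ci = card Co" unfolding Ci_def Co_def by (rule card_dual_class)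
  finally have tot: "real (card {I. matroid {1..n} I \<and> (\<exists>k A B. real k < sqrt (log 2 (real n)) \<and> k_separation {1..n} I k A B)})
      \<le> real (card Ext) + 2 * real (card Co) + real (card Sep)" by linarith
  have Ext: "real (card Ext) \<le> real (n + 1) * (2 powr (- 2 * real n) * matroid_count n)"
  proof -
    have "real (card Ext) \<le> real (card {r. r \<le> n \<and> \<not> mid_rank n r}) * (2 powr (- 2 * real n) * matroid_count n)"
      unfolding Ext_def using elim(1) by (intro real_card_UN_le) auto
    also have "\<dots> \<le> real (n + 1) * (2 powr (- 2 * real n) * matroid_count n)"
    proof (intro mult_right_mono)
      have "card {r. r \<le> n \<and> \<not> mid_rank n r} \<le> card {..n}" by (intro card_mono) auto
      then show "real (card {r. r \<le> n \<and> \<not> mid_rank n r}) \<le> real (n + 1)" by simp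
    qed auto
    finally show ?thesis .
  qed
  have Sep: "real (card Sep) \<le> real (n + 1) ^ 4 * (2 powr (- 2 * real n) * matroid_count n)"
  proof -
    have "real (card Sep) \<le> real (card J) * (2 powr (- 3 * real n) * matroid_count n)"
      unfolding Sep_def
    proof (rule real_card_UN_le[OF finJ])
      fix p assume "p \<in> J"
      then show "real (card (case p of (r, A, \<alpha>, \<beta>) \<Rightarrow> sep_class n r A \<alpha> \<beta>)) \<le> 2 powr (- 3 * real n) * matroid_count n"
        using elim(3) unfolding J_def by auto
    qed
    also have "\<dots> \<le> (real (n + 1) ^ 3 * 2 powr real n) * (2 powr (- 3 * real n) * matroid_count n)"
      using cJ by (intro mult_right_mono) auto
    also have "\<dots> = real (n + 1) ^ 3 * ((2 powr real n * 2 powr (- 3 * real n)) * matroid_count n)" by simp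
    also have "2 powr real n * 2 powr (- 3 * real n) = 2 powr (- 2 * real n)" by (simp flip: powr_add)
    also have "real (n + 1) ^ 3 * (2 powr (- 2 * real n) * matroid_count n) \<le> real (n + 1) ^ 4 * (2 powr (- 2 * real n) * matroid_count n)"
      by (intro mult_right_mono power_increasing) auto
    finally show ?thesis .
  qed
  show ?case using tot Ext Sep elim(2) unfolding Co_def err_def by (simp add: algebra_simps)
qed

theorem theorem4p12:
  shows "\<exists>c::real. c > 0 \<and>
    (\<lambda>n. real (card {I \<in> matroids_on n.
                  ereal (c * sqrt (log 2 (real n))) \<le> ereal_of_enat (matroid_connectivity {1..n} I)})
          / real (card (matroids_on n))) \<longlonglongrightarrow> 1"
\<comment> \<open>c = 1 is the constant for which \<open>sep_bound\<close> is set up.\<close>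
proof (intro exI[of _ 1] conjI)
  define good where "good n = {I \<in> matroids_on n. ereal (1 * sqrt (log 2 (real n))) \<le> ereal_of_enat (matroid_connectivity {1..n} I)}" for n
  define bad where "bad n = {I. matroid {1..n} I \<and> (\<exists>k A B. real k < sqrt (log 2 (real n)) \<and> k_separation {1..n} I k A B)}" for n
  have frac: "real (card (good n)) / real (card (matroids_on n)) = 1 - real (card (bad n)) / matroid_count n" and pos: "0 < matroid_count n" for n
  proof -
    have fin: "finite (matroids_on n)" by (rule finite_matroids_on)
    show pos: "0 < matroid_count n" using matroids_on_nonempty[of n] fin by (simp add: matroids_on_def card_gt_0_iff)
    have "good n = matroids_on n - bad n"
      unfolding good_def bad_def le_matroid_connectivity_iff matroids_on_def by auto
    moreover have "bad n \<subseteq> matroids_on n" by (auto simp: bad_def matroids_on_def)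
    ultimately have "card (good n) = card (matroids_on n) - card (bad n)" "card (bad n) \<le> card (matroids_on n)"
      using fin by (auto simp: card_Diff_subset finite_subset card_mono)
    then have "real (card (good n)) = matroid_count n - real (card (bad n))" by (simp add: matroids_on_def of_nat_diff)
    then show "real (card (good n)) / real (card (matroids_on n)) = 1 - real (card (bad n)) / matroid_count n"
      using pos by (simp add: matroids_on_def diff_divide_distrib)
  qed
  have "err \<longlonglongrightarrow> 0" unfolding err_def by real_asymp
  have le: "eventually (\<lambda>n. real (card (bad n)) / matroid_count n \<le> err n) sequentially"
    using bad_matroids_bound unfolding bad_def[symmetric]
    by eventually_elim (use pos in \<open>simp add: divide_le_eq\<close>)
  have "eventually (\<lambda>n. 0 \<le> real (card (bad n)) / matroid_count n) sequentially"
    by (rule always_eventually) simp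
  then have "(\<lambda>n. real (card (bad n)) / matroid_count n) \<longlonglongrightarrow> 0"
    using le tendsto_const \<open>err \<longlonglongrightarrow> 0\<close> by (rule tendsto_sandwich)
  then have "(\<lambda>n. 1 - real (card (bad n)) / matroid_count n) \<longlonglongrightarrow> 1 - 0" by (intro tendsto_intros)
  then show "(\<lambda>n. real (card {I \<in> matroids_on n.
                  ereal (1 * sqrt (log 2 (real n))) \<le> ereal_of_enat (matroid_connectivity {1..n} I)})
          / real (card (matroids_on n))) \<longlonglongrightarrow> 1"
    using frac unfolding good_def by simp
qed simp

end
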